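(* Let $(S,\mathcal{S},\hat{\mathcal{S}})$ be a localized Borel space. A random signed measure $\xi$ on $S$ has independent increments if and only if almost surely $$\xi(B)=\sum_{j=1}^{p}X_j\delta_{s_j}(B)+\alpha(B)+\int_{\mathbb{R}\setminus\{0\}}x\,\Psi(B\times dx),\qquad B\in\hat{\mathcal{S}},$$ where $p\in\mathbb{N}\cup\{\infty\}$, $X_1,\dots,X_p$ are independent real-valued random variables, $s_1,\dots,s_p$ are fixed points in $S$, $\alpha$ is given by the difference of two deterministic atomless measures in $\mathcal{M}_S$, and $\Psi$ is a Poisson process on $S\times(\mathbb{R}\setminus\{0\})$ independent of $X_1,\dots,X_p$, whose intensity measure $F$ satisfies $$\int_{\mathbb{R}\setminus\{0\}}(1\wedge|x|)\,F(B\times dx)<\infty\quad\text{for every }B\in\hat{\mathcal{S}},$$ and $F(\{s\}\times(\mathbb{R}\setminus\{0\}))=0$ for every $s\in S$. Moreover, this representation is almost surely unique.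
   Context: A localized Borel space $(S,\mathcal{S},\hat{\mathcal{S}})$ consists of a Borel space $(S,\mathcal{S})$ and a localizing ring $\hat{\mathcal{S}}$, i.e. a ring $\hat{\mathcal{S}}\subset\mathcal{S}$ such that $B\cap C\in\hat{\mathcal{S}}$ for all $B\in\hat{\mathcal{S}}$, $C\in\mathcal{S}$, and $\hat{\mathcal{S}}=\bigcup_n(\mathcal{S}\cap S_n)$ for some sets $S_n\uparrow S$ in $\hat{\mathcal{S}}$, where $\mathcal{S}\cap S_n=\{C\cap S_n:C\in\mathcal{S}\}$. $\mathcal{M}_S$ is the space of measures on $(S,\mathcal{S})$ that are finite on $\hat{\mathcal{S}}$. $\mathsf{M}_S$ is the space of countably additive set functions $\mu:\hat{\mathcal{S}}\to\mathbb{R}$ ($\mu(\emptyset)=0$ and $\mu(\bigcup_k A_k)=\sum_k\mu(A_k)$, absolutely convergent, for disjoint $A_k\in\hat{\mathcal{S}}$ with union in $\hat{\mathcal{S}}$), with the $\sigma$-algebra $\mathcal{B}_{\mathsf{M}_S}$ generated by $\mu\mapsto\mu(B)$, $B\in\hat{\mathcal{S}}$. A random signed measure on $S$ is a measurable map from a probability space $(\Omega,\mathcal{F},\mathbb{P})$ to $(\mathsf{M}_S,\mathcal{B}_{\mathsf{M}_S})$. It has independent increments (equivalently, is a completely random signed measure) if $\xi(B_1),\dots,\xi(B_n)$ are jointly independent for any $n\in\mathbb{N}$ and any disjoint $B_1,\dots,B_n\in\hat{\mathcal{S}}$. When $p=\infty$, $X_1,\dots,X_p$ and $s_1,\dots,s_p$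 denote infinite sequences. *)

theory Defs
  imports "HOL-Probability.Probability"
begin

text \<open>
  A measurable space is given by a \<open>'a measure\<close>, of which only \<^const>\<open>space\<close> and
  \<^const>\<open>sets\<close> matter. A localized Borel space is such an \<open>M\<close> together with its localizing
  ring \<open>R\<close>.
\<close>

definition borel_space :: "'a measure \<Rightarrow> bool" where
  "borel_space M \<longleftrightarrow>
    (\<exists>A \<in> sets (borel :: real measure). A \<subseteq> {0..1} \<and>
      (\<exists>f \<in> M \<rightarrow>\<^sub>M restrict_space borel A. \<exists>g \<in> restrict_space borel A \<rightarrow>\<^sub>M M.
        (\<forall>x \<in> space M. g (f x) = x) \<and> (\<forall>y \<in> A. f (g y) = y)))"

definition localizing_ring :: "'a measure \<Rightarrow> 'a set set \<Rightarrow> bool" where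
  "localizing_ring M R \<longleftrightarrow>
    ring_of_sets (space M) R \<and> R \<subseteq> sets M \<and>
    (\<forall>B \<in> R. \<forall>C \<in> sets M. B \<inter> C \<in> R) \<and>
    (\<exists>S :: nat \<Rightarrow> 'a set. range S \<subseteq> R \<and> incseq S \<and> (\<Union>n. S n) = space M \<and>
      R = (\<Union>n. {C \<inter> S n | C. C \<in> sets M}))"

definition localized_borel_space :: "'a measure \<Rightarrow> 'a set set \<Rightarrow> bool" where
  "localized_borel_space M R \<longleftrightarrow> borel_space M \<and> localizing_ring M R"

definition loc_finite :: "'a measure \<Rightarrow> 'a set set \<Rightarrow> 'a measure \<Rightarrow> bool" where
  "loc_finite M R \<mu> \<longleftrightarrow> sets \<mu> = sets M \<and> (\<forall>B \<in> R. emeasure \<mu> B < \<infinity>)"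

text \<open>
  A signed measure is a function on \<open>R\<close> only; as HOL functions are total, its values off
  \<open>R\<close> are fixed by \<^const>\<open>extensional\<close>.
\<close>

definition signed_measures :: "'a set set \<Rightarrow> ('a set \<Rightarrow> real) set" where
  "signed_measures R = {\<mu> \<in> extensional R. \<mu> {} = 0 \<and>
    (\<forall>A :: nat \<Rightarrow> 'a set. range A \<subseteq> R \<and> disjoint_family A \<and> (\<Union>k. A k) \<in> R \<longrightarrow>
      summable (\<lambda>k. \<bar>\<mu> (A k)\<bar>) \<and> (\<lambda>k. \<mu> (A k)) sums \<mu> (\<Union>k. A k))}"

definition signed_measure_algebra :: "'a set set \<Rightarrow> ('a set \<Rightarrow> real) measure" where
  "signed_measure_algebra R = sigma (signed_measures R)
    {(\<lambda>\<mu>. \<mu> B) -` A \<inter> signed_measures R | B A. B \<in> R \<and> A \<in> sets borel}"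

definition indep_increments ::
    "'w measure \<Rightarrow> 'a set set \<Rightarrow> ('w \<Rightarrow> 'a set \<Rightarrow> 'b::topological_space) \<Rightarrow> bool" where
  "indep_increments P R \<xi> \<longleftrightarrow>
    (\<forall>(n::nat) B. (\<forall>i<n. B i \<in> R) \<and> disjoint_family_on B {..<n} \<longrightarrow>
      prob_space.indep_vars P (\<lambda>_. borel) (\<lambda>i \<omega>. \<xi> \<omega> (B i)) {..<n})"

text \<open>Point measures: integer-valued (in particular finite) on the localizing ring.\<close>

definition point_measures :: "'a measure \<Rightarrow> 'a set set \<Rightarrow> 'a measure set" where
  "point_measures M R =
    {\<mu>. sets \<mu> = sets M \<and> (\<forall>B \<in> R. \<exists>k :: nat. emeasure \<mu> B = of_nat k)}"

definition point_measure_algebra :: "'a measure \<Rightarrow> 'a set set \<Rightarrow> 'a measure measure" where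
  "point_measure_algebra M R = sigma (point_measures M R)
    {(\<lambda>\<mu>. emeasure \<mu> B) -` A \<inter> point_measures M R | B A. B \<in> R \<and> A \<in> sets borel}"

text \<open>
  The Poisson weights are spelled out because \<^const>\<open>poisson_pmf\<close> is only specified for
  positive rates.
\<close>

definition poisson_process ::
    "'w measure \<Rightarrow> 'a measure \<Rightarrow> 'a set set \<Rightarrow> 'a measure \<Rightarrow> ('w \<Rightarrow> 'a measure) \<Rightarrow> bool" where
  "poisson_process P M R F \<Psi> \<longleftrightarrow>
    loc_finite M R F \<and>
    \<Psi> \<in> P \<rightarrow>\<^sub>M point_measure_algebra M R \<and>
    (\<forall>B \<in> R. \<forall>k :: nat. measure P {\<omega> \<in> space P. emeasure (\<Psi> \<omega>) B = of_nat k}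
        = measure F B ^ k / fact k * exp (- measure F B)) \<and>
    indep_increments P R (\<lambda>\<omega>. emeasure (\<Psi> \<omega>))"

abbreviation punctured_line :: "real measure" where
  "punctured_line \<equiv> restrict_space borel (UNIV - {0})"

definition jump_space :: "'a measure \<Rightarrow> ('a \<times> real) measure" where
  "jump_space M = M \<Otimes>\<^sub>M punctured_line"

text \<open>
  The localizing ring on the product of \<open>M\<close> with the punctured line: bounded sets lie over a
  bounded set of \<open>M\<close> and stay away from jump size 0. Under the integrability condition on
  the intensity below, the intensity is finite on this ring.
\<close>

definition jump_ring :: "'a measure \<Rightarrow> 'a set set \<Rightarrow> ('a \<times> real) set set" where
  "jump_ring M R = {C \<in> sets (jump_space M). \<exists>B \<in> R. \<exists>\<epsilon>>0. C \<subseteq> B \<times> {x. \<epsilon> \<le> \<bar>x\<bar>}}"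

text \<open>The measure \<open>A \<mapsto> \<mu> (B \<times> A)\<close> on the punctured line, i.e. \<open>\<mu>(B \<times> dx)\<close>.\<close>

definition slice :: "('a \<times> real) measure \<Rightarrow> 'a set \<Rightarrow> real measure" where
  "slice \<mu> B = distr (restrict_space \<mu> (B \<times> (UNIV - {0}))) punctured_line snd"

lemma emeasure_slice:
  assumes "sets \<mu> = sets (jump_space M)" "B \<in> sets M" "A \<in> sets punctured_line"
  shows "emeasure (slice \<mu> B) A = emeasure \<mu> (B \<times> A)"
proof -
  let ?C = "B \<times> (UNIV - {0::real})"
  have UN: "UNIV - {0::real} \<in> sets punctured_line"
    by (metis Diff_UNIV Diff_eq Int_UNIV_right sets.top space_borel space_restrict_space Int_UNIV_left)
  have C: "?C \<in> sets \<mu>"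
    unfolding assms(1) jump_space_def using assms(2) UN by (rule pair_measureI)
  have sp: "space \<mu> = space M \<times> (UNIV - {0})"
    using sets_eq_imp_space_eq[OF assms(1)]
    by (simp add: jump_space_def space_pair_measure space_restrict_space)
  have meas: "snd \<in> restrict_space \<mu> ?C \<rightarrow>\<^sub>M punctured_line"
    by (rule measurable_restrict_space1)
      (simp add: measurable_cong_sets[OF assms(1) refl] jump_space_def)
  have A: "A \<subseteq> UNIV - {0}"
    using sets.sets_into_space[OF assms(3)] by (simp add: space_restrict_space)
  have BM: "B \<subseteq> space M" using assms(2) by (rule sets.sets_into_space)
  have eq: "snd -` A \<inter> space (restrict_space \<mu> ?C) = B \<times> A"
    using A BM by (auto simp: space_restrict_space sp)
  show ?thesis
    unfolding slice_def emeasure_distr[OF meas assms(3)] eq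
    using A C by (intro emeasure_restrict_space) (auto simp: sets.Int_space_eq2)
qed

text \<open>
  The data of a representation: the fixed jumps are indexed by
  \<open>{j. enat j < p}\<close>, which is \<open>{0, ..., p - 1}\<close> for finite \<open>p\<close> (empty if
  \<open>p = 0\<close>) and all of \<open>\<nat>\<close> for \<open>p = \<infinity>\<close>.
\<close>

definition fixed_part ::
    "'a measure \<Rightarrow> enat \<Rightarrow> (nat \<Rightarrow> 'w \<Rightarrow> real) \<Rightarrow> (nat \<Rightarrow> 'a) \<Rightarrow> 'w \<Rightarrow> 'a set \<Rightarrow> real" where
  "fixed_part M p X s \<omega> B =
    (\<Sum>\<^sub>\<infinity>j \<in> {j. enat j < p}. X j \<omega> * measure (return M (s j)) B)"

text \<open>
  Atoms are points of positive mass. For locally finite measures on a localized Borel space this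
  agrees with the definition by measurable sets that cannot be split.
\<close>

definition atomless :: "'a measure \<Rightarrow> bool" where
  "atomless \<mu> \<longleftrightarrow> (\<forall>s \<in> space \<mu>. emeasure \<mu> {s} = 0)"

definition atomless_difference :: "'a measure \<Rightarrow> 'a set set \<Rightarrow> ('a set \<Rightarrow> real) \<Rightarrow> bool" where
  "atomless_difference M R \<alpha> \<longleftrightarrow>
    (\<exists>\<alpha>\<^sub>1 \<alpha>\<^sub>2. loc_finite M R \<alpha>\<^sub>1 \<and> loc_finite M R \<alpha>\<^sub>2 \<and> atomless \<alpha>\<^sub>1 \<and> atomless \<alpha>\<^sub>2 \<and>
      (\<forall>B \<in> R. \<alpha> B = measure \<alpha>\<^sub>1 B - measure \<alpha>\<^sub>2 B))"

text \<open>
  Independence of \<open>\<Psi>\<close> from the whole family \<open>X\<close> is that of the generated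
  sigma-algebras (\<^const>\<open>prob_space.indep_var\<close> needs both variables to have the same value
  type). The \<open>summable_on\<close> and \<open>integrable\<close> clauses say that the sum and the
  integral in the representation exist; \<open>infsum\<close> and the Bochner integral would
  otherwise silently be 0.
\<close>

definition increment_representation ::
    "'w measure \<Rightarrow> 'a measure \<Rightarrow> 'a set set \<Rightarrow> ('w \<Rightarrow> 'a set \<Rightarrow> real) \<Rightarrow>
     enat \<Rightarrow> (nat \<Rightarrow> 'w \<Rightarrow> real) \<Rightarrow> (nat \<Rightarrow> 'a) \<Rightarrow> ('a set \<Rightarrow> real) \<Rightarrow>
     ('w \<Rightarrow> ('a \<times> real) measure) \<Rightarrow> ('a \<times> real) measure \<Rightarrow> bool" where
  "increment_representation P M R \<xi> p X s \<alpha> \<Psi> F \<longleftrightarrow>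
    prob_space.indep_vars P (\<lambda>_. borel) X {j. enat j < p} \<and>
    (\<forall>j. enat j < p \<longrightarrow> s j \<in> space M) \<and>
    atomless_difference M R \<alpha> \<and>
    poisson_process P (jump_space M) (jump_ring M R) F \<Psi> \<and>
    prob_space.indep_set P
      (sets (vimage_algebra (space P) (\<lambda>\<omega>. \<lambda>j \<in> {j. enat j < p}. X j \<omega>)
        (PiM {j. enat j < p} (\<lambda>_. borel))))
      (sets (vimage_algebra (space P) \<Psi>
        (point_measure_algebra (jump_space M) (jump_ring M R)))) \<and>
    (\<forall>B \<in> R. (\<integral>\<^sup>+x. ennreal (min 1 \<bar>x\<bar>) \<partial>slice F B) < \<infinity>) \<and>
    (\<forall>t \<in> space M. emeasure F ({t} \<times> (UNIV - {0})) = 0) \<and>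
    (AE \<omega> in P. \<forall>B \<in> R.
      (\<lambda>j. X j \<omega> * measure (return M (s j)) B) summable_on {j. enat j < p} \<and>
      integrable (slice (\<Psi> \<omega>) B) (\<lambda>x. x) \<and>
      \<xi> \<omega> B = fixed_part M p X s \<omega> B + \<alpha> B + (\<integral>x. x \<partial>slice (\<Psi> \<omega>) B))"

text \<open>
  The list of fixed jumps contains no repeated locations and no trivial terms. Only for such
  lists can \<open>p\<close>, \<open>X\<close> and \<open>s\<close> themselves be unique, and then up to reindexing;
  in general only the random signed measure \<^const>\<open>fixed_part\<close> is unique.
\<close>

definition reduced_jumps ::
    "'w measure \<Rightarrow> enat \<Rightarrow> (nat \<Rightarrow> 'w \<Rightarrow> real) \<Rightarrow> (nat \<Rightarrow> 'a) \<Rightarrow> bool" where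
  "reduced_jumps P p X s \<longleftrightarrow>
    inj_on s {j. enat j < p} \<and> (\<forall>j. enat j < p \<longrightarrow> \<not> (AE \<omega> in P. X j \<omega> = 0))"

end

theory Submission
  imports Defs
begin

text \<open>
  Let \<open>D\<close> be the countable set of points \<open>s\<close> with \<open>P (\<xi> {s} \<noteq> 0) > 0\<close>, and split \<open>\<xi>\<close> into
  its restriction to \<open>D\<close>, the jumps of its restriction \<open>\<eta>\<close> to the complement of \<open>D\<close>, and the atomless
  rest \<open>\<zeta>\<close>. Cut a bounded set into the \<open>2 ^ n + 1\<close> cells given by a Borel code in \<open>[0, 1]\<close>: the
  values on the cells are independent for each \<open>n\<close>, and for a signed measure \<open>\<mu>\<close> the sums of
  \<open>\<mu> (cell)\<^sup>2\<close> converge to the sum of \<open>\<mu> {t}\<^sup>2\<close> over the atoms. For \<open>\<zeta>\<close> this limit is 0, and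
  truncation gives variances tending to 0, so \<open>\<zeta>\<close> is almost surely constant. The
  counts of points \<open>(t, \<eta> {t})\<close> have finite means \<open>F\<close>, because a sum of independent nonnegative
  variables that is bounded in probability has bounded truncated means; as \<open>F\<close> has no mass on
  fibres, comparing generating functions cell by cell gives independent Poisson counts.

  Conversely, in any representation the Poisson process almost surely has at most one point on each fibre
  \<open>{t} \<times> (UNIV - {0})\<close> and none over the fixed atoms, so it is determined by the values \<open>\<xi> {t}\<close>;
  its void probabilities determine \<open>F\<close>, and restricting \<open>\<xi>\<close> to the fixed atoms
  separates the fixed part from \<open>\<alpha>\<close>.
\<close>

section \<open>Dyadic cells and signed measures\<close>

text \<open>Sums of absolute values over cells would converge to the total variation, diffuse part
  included; squares let only the atoms survive and make them visible through countably many
  increments. This also makes jump counts measurable with respect to the increments over a given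
  set, so that independence over disjoint sets passes from increments to such nonlinear functionals;
  independence of the fixed jumps and the Poisson process comes from applying it to \<open>D\<close>
  and its complement. No moments are assumed: the bound on truncated means rests only on each path
  having finite total variation on bounded sets. The fixed atoms have to be removed beforehand,
  since otherwise the counts would not be Poisson and the squared cell masses of \<open>F\<close>
  would not vanish in the limit. Constancy is obtained for one bounded set at a time; countably many
  cells determine a signed measure, which leaves countably many null sets to discard. For
  uniqueness, a fibre with at most one point reveals that point as the integral over the
  fibre.\<close>

locale localized_borel =
  fixes M :: "'a measure" and R :: "'a set set"
  assumes localized_borel: "localized_borel_space M R"
begin

lemma code_ex: "\<exists>f::'a \<Rightarrow> real. f \<in> borel_measurable M \<and> f ` space M \<subseteq> {0..1} \<and> inj_on f (space M) \<and>
    (\<forall>B\<in>sets M. \<exists>U\<in>sets borel. B = f -` U \<inter> space M)"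
proof -
  from localized_borel obtain A f g where A: "A \<in> sets (borel :: real measure)" "A \<subseteq> {0..1}"
    and f: "f \<in> M \<rightarrow>\<^sub>M restrict_space borel A" and g: "g \<in> restrict_space borel A \<rightarrow>\<^sub>M M"
    and gf: "\<forall>x \<in> space M. g (f x) = x" and fg: "\<forall>y \<in> A. f (g y) = y"
    unfolding localized_borel_space_def borel_space_def by blast
  have fm: "f \<in> borel_measurable M"
    using f by (metis measurable_restrict_space2_iff)
  have fA: "f x \<in> A" if "x \<in> space M" for x
    using measurable_space[OF f that] by (simp add: space_restrict_space)
  have inj: "inj_on f (space M)"
    by (metis gf inj_onI)
  have "\<exists>U\<in>sets borel. B = f -` U \<inter> space M" if B: "B \<in> sets M" for B
  proof
    have "g -` B \<inter> space (restrict_space borel A) \<in> sets (restrict_space borel A)"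
      using measurable_sets[OF g B] .
    then show "g -` B \<inter> A \<in> sets borel"
      using A(1) by (simp add: space_restrict_space sets_restrict_space_iff)
    show "B = f -` (g -` B \<inter> A) \<inter> space M"
      using gf fA sets.sets_into_space[OF B] by auto
  qed
  then show ?thesis using fm fA A(2) inj by blast
qed

definition code :: "'a \<Rightarrow> real" where
  "code = (SOME f. f \<in> borel_measurable M \<and> f ` space M \<subseteq> {0..1} \<and> inj_on f (space M) \<and>
    (\<forall>B\<in>sets M. \<exists>U\<in>sets borel. B = f -` U \<inter> space M))"

lemma code_measurable [measurable]: "code \<in> borel_measurable M"
  and code_range: "x \<in> space M \<Longrightarrow> 0 \<le> code x \<and> code x \<le> 1"
  and code_inj: "inj_on code (space M)"
  and code_vimage: "B \<in> sets M \<Longrightarrow> \<exists>U\<in>sets borel. B = code -` U \<inter> space M"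
  using someI_ex[OF code_ex, folded code_def] by auto

text \<open>Index of the half-open dyadic interval containing the code. The code 1 falls into
  interval number \<open>2 ^ n\<close>, hence the ranges \<open>k \<le> 2 ^ n\<close> below.\<close>

definition cell :: "nat \<Rightarrow> 'a \<Rightarrow> nat" where
  "cell n x = nat \<lfloor>2 ^ n * code x\<rfloor>"

definition cells :: "nat \<Rightarrow> nat \<Rightarrow> 'a set" where
  "cells n k = {x \<in> space M. cell n x = k}"

lemma cell_measurable [measurable]: "cell n \<in> M \<rightarrow>\<^sub>M count_space UNIV"
  unfolding cell_def by measurable

lemma cells_sets [measurable]: "cells n k \<in> sets M"
  unfolding cells_def by measurable

lemma cell_le: assumes "x \<in> space M" shows "cell n x \<le> 2 ^ n"
proof -
  have "2 ^ n * code x \<le> 2 ^ n" using code_range[OF assms] by simp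
  then have "\<lfloor>2 ^ n * code x\<rfloor> \<le> \<lfloor>2 ^ n :: real\<rfloor>" by (rule floor_mono)
  also have "\<lfloor>2 ^ n :: real\<rfloor> = 2 ^ n"
    by (metis floor_of_int of_int_numeral of_int_power)
  finally show ?thesis unfolding cell_def by (simp add: nat_le_iff)
qed

lemma UN_cells: "(\<Union>k\<le>2 ^ n. cells n k) = space M"
  using cell_le by (auto simp: cells_def)

lemma disjoint_cells: "disjoint_family (cells n)"
  by (auto simp: disjoint_family_on_def cells_def)

lemma mem_cells: "x \<in> space M \<Longrightarrow> x \<in> cells n (cell n x)"
  by (simp add: cells_def)

text \<open>Taking the floor at the finer level first does not change the floor at the coarser one.
  Hence every cell of level \<open>m\<close> lies in a single cell of level
  \<open>n\<close>.\<close>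

lemma cell_refine:
  assumes "n \<le> m" "x \<in> space M" shows "cell n x = cell m x div 2 ^ (m - n)"
proof -
  have "\<lfloor>2 ^ n * code x\<rfloor> = \<lfloor>2 ^ m * code x / real_of_int (2 ^ (m - n))\<rfloor>"
  proof -
    have "(2::real) ^ m = 2 ^ n * 2 ^ (m - n)" using assms(1) by (simp flip: power_add)
    then show ?thesis by simp
  qed
  also have "\<dots> = \<lfloor>2 ^ m * code x\<rfloor> div 2 ^ (m - n)"
    by (rule floor_divide_real_eq_div) simp
  finally show ?thesis unfolding cell_def
    using code_range[OF assms(2)] by (simp add: nat_div_distrib nat_power_eq)
qed

text \<open>Points of one cell have codes that differ by less than the width of the cell, which
  fails from some level on because \<open>code\<close> is injective.\<close>

lemma cell_separates:
  assumes "x \<in> space M" "y \<in> space M" "x \<noteq> y"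
  shows "\<forall>\<^sub>F n in sequentially. cell n x \<noteq> cell n y"
proof -
  let ?d = "\<bar>code x - code y\<bar>"
  have d: "?d > 0" using assms code_inj by (auto simp: inj_on_def)
  obtain n0 where n0: "inverse ?d < 2 ^ n0"
    using real_arch_pow[of 2 "inverse ?d"] by auto
  have "cell n x \<noteq> cell n y" if "n \<ge> n0" for n
  proof
    assume "cell n x = cell n y"
    then have "\<lfloor>2 ^ n * code x\<rfloor> = \<lfloor>2 ^ n * code y\<rfloor>"
      unfolding cell_def using code_range assms by (subst (asm) eq_nat_nat_iff) auto
    then have "\<bar>2 ^ n * code x - 2 ^ n * code y\<bar> < 1" by linarith
    then have "2 ^ n * ?d < 1"
      by (metis abs_mult abs_numeral power_abs right_diff_distrib')
    moreover have "(2::real) ^ n0 \<le> 2 ^ n" using that by simp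
    ultimately have "2 ^ n0 * ?d < 1" using d
      by (smt (verit) mult_right_mono)
    then show False using n0 d by (simp add: field_simps)
  qed
  then show ?thesis by (auto simp: eventually_sequentially)
qed

lemma singleton_sets [measurable, simp]: assumes "s \<in> space M" shows "{s} \<in> sets M"
proof -
  have "{s} = code -` {code s} \<inter> space M"
    using assms code_inj by (auto simp: inj_on_def)
  then show ?thesis using measurable_sets[OF code_measurable, of "{code s}"] by simp
qed

text \<open>\<open>code\<close> is the pointwise limit of \<open>real (cell n x) / 2 ^ n\<close>,
  each of which is measurable for the sigma-algebra generated by the cells, and every set of
  \<open>M\<close> is a preimage under \<open>code\<close>.\<close>

lemma sets_eq_sigma_cells:
  "sets M = sigma_sets (space M) ({cells n k | n k. True} \<union> {{}})"
proof
  let ?G = "{cells n k | n k. True} \<union> {{}}"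
  show "sigma_sets (space M) ?G \<subseteq> sets M"
    by (rule sets.sigma_sets_subset) auto
  define N where "N = sigma (space M) ?G"
  have G: "?G \<subseteq> Pow (space M)" using sets.sets_into_space[OF cells_sets] by auto
  have sN: "space N = space M" "sets N = sigma_sets (space M) ?G"
    using G by (auto simp: N_def)
  have cm: "cell n \<in> N \<rightarrow>\<^sub>M count_space UNIV" for n
    by (subst measurable_count_space_eq_countable)
       (auto simp: sN cells_def vimage_def Int_def conj_commute intro!: sigma_sets.Basic exI)
  have lim: "(\<lambda>n. real (cell n x) / 2 ^ n) \<longlonglongrightarrow> code x" if x: "x \<in> space M" for x
  proof (rule tendsto_sandwich[of "\<lambda>n. code x - (1/2)^n" _ _ "\<lambda>n. code x"])
    have c: "real (cell n x) = of_int \<lfloor>2 ^ n * code x\<rfloor>" for n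
      unfolding cell_def using code_range[OF x] by simp
    have "code x - (1/2)^n \<le> real (cell n x) / 2 ^ n \<and> real (cell n x) / 2 ^ n \<le> code x" for n
    proof -
      have "2 ^ n * code x - 1 \<le> real (cell n x)" "real (cell n x) \<le> 2 ^ n * code x"
        unfolding c by linarith+
      then have "(2 ^ n * code x - 1) / 2 ^ n \<le> real (cell n x) / 2 ^ n"
        "real (cell n x) / 2 ^ n \<le> (2 ^ n * code x) / 2 ^ n"
        by - (rule divide_right_mono, assumption, simp)+
      then show ?thesis by (simp add: diff_divide_distrib power_one_over)
    qed
    then show "\<forall>\<^sub>F n in sequentially. code x - (1/2)^n \<le> real (cell n x) / 2 ^ n"
      "\<forall>\<^sub>F n in sequentially. real (cell n x) / 2 ^ n \<le> code x" by auto
    show "(\<lambda>n. code x - (1/2)^n) \<longlonglongrightarrow> code x"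
      using tendsto_diff[OF tendsto_const LIMSEQ_power_zero[of "1/2::real"], of "code x"] by simp
  qed simp
  have "code \<in> borel_measurable N"
  proof (rule borel_measurable_LIMSEQ_real)
    show "\<And>x. x \<in> space N \<Longrightarrow> (\<lambda>n. real (cell n x) / 2 ^ n) \<longlonglongrightarrow> code x"
      using lim by (simp add: sN)
    show "(\<lambda>x. real (cell n x) / 2 ^ n) \<in> borel_measurable N" for n
      using cm[of n] by measurable
  qed
  note code_N = this
  show "sets M \<subseteq> sigma_sets (space M) ?G"
  proof
    fix B assume "B \<in> sets M"
    from code_vimage[OF this] obtain U where "U \<in> sets borel" "B = code -` U \<inter> space M" by blast
    then show "B \<in> sigma_sets (space M) ?G"
      using measurable_sets[OF code_N, of U] by (simp add: sN)
  qed
qed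

text \<open>Dyadic cells are nested or disjoint; the empty set is kept in the generator for the
  second case.\<close>

lemma Int_stable_cells: "Int_stable ({cells n k | n k. True} \<union> {{}})"
proof -
  have *: "cells n k \<inter> cells m l = cells m l \<or> cells n k \<inter> cells m l = {}" if "n \<le> m" for n m k l
    using cell_refine[OF that] by (auto simp: cells_def)
  have "cells n k \<inter> cells m l \<in> {cells n k | n k. True} \<union> {{}}" for n m k l
    using *[of n m k l] *[of m n l k] by (cases "n \<le> m") (auto simp: Int_commute)
  then show ?thesis unfolding Int_stable_def by blast
qed

end

section \<open>Countably additive set functions on the ring and their Jordan decomposition\<close>

text \<open>The defining property of \<open>signed_measures\<close> without extensionality, so that
  it applies directly to negatives, differences and traces
  \<open>\<lambda>B. \<mu> (B \<inter> E)\<close>.\<close>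

definition countably_additive_on :: "'a set set \<Rightarrow> ('a set \<Rightarrow> real) \<Rightarrow> bool" where
  "countably_additive_on R \<mu> \<longleftrightarrow> \<mu> {} = 0 \<and>
    (\<forall>A :: nat \<Rightarrow> 'a set. range A \<subseteq> R \<and> disjoint_family A \<and> (\<Union>k. A k) \<in> R \<longrightarrow>
      summable (\<lambda>k. \<bar>\<mu> (A k)\<bar>) \<and> (\<lambda>k. \<mu> (A k)) sums \<mu> (\<Union>k. A k))"

lemma signed_measures_iff: "\<mu> \<in> signed_measures R \<longleftrightarrow> \<mu> \<in> extensional R \<and> countably_additive_on R \<mu>"
  by (auto simp: signed_measures_def countably_additive_on_def)

lemma countably_additive_onD:
  assumes "countably_additive_on R \<mu>" "\<And>k::nat. A k \<in> R" "disjoint_family A" "(\<Union>k. A k) \<in> R"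
  shows "summable (\<lambda>k. \<bar>\<mu> (A k)\<bar>)" "(\<lambda>k. \<mu> (A k)) sums \<mu> (\<Union>k. A k)"
  using assms unfolding countably_additive_on_def by blast+

lemma countably_additive_on_minus:
  "countably_additive_on R \<mu> \<Longrightarrow> countably_additive_on R (\<lambda>B. - \<mu> B)"
  unfolding countably_additive_on_def by (auto intro: sums_minus)

lemma countably_additive_on_diff:
  assumes "countably_additive_on R \<mu>" "countably_additive_on R \<nu>"
  shows "countably_additive_on R (\<lambda>B. \<mu> B - \<nu> B)"
  unfolding countably_additive_on_def
proof (intro conjI allI impI)
  show "\<mu> {} - \<nu> {} = 0" using assms by (auto simp: countably_additive_on_def)
  fix A :: "nat \<Rightarrow> 'a set" assume A: "range A \<subseteq> R \<and> disjoint_family A \<and> (\<Union>k. A k) \<in> R"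
  have "summable (\<lambda>k. \<bar>\<mu> (A k)\<bar>)" "(\<lambda>k. \<mu> (A k)) sums \<mu> (\<Union>k. A k)"
    "summable (\<lambda>k. \<bar>\<nu> (A k)\<bar>)" "(\<lambda>k. \<nu> (A k)) sums \<nu> (\<Union>k. A k)"
    using A by (intro countably_additive_onD[OF assms(1)] countably_additive_onD[OF assms(2)]; auto)+
  note * = this
  show "(\<lambda>k. \<mu> (A k) - \<nu> (A k)) sums (\<mu> (\<Union>k. A k) - \<nu> (\<Union>k. A k))"
    using * by (intro sums_diff)
  show "summable (\<lambda>k. \<bar>\<mu> (A k) - \<nu> (A k)\<bar>)"
    by (rule summable_comparison_test'[OF summable_add[OF *(1) *(3)], of 0]) auto
qed

lemma loc_finite_countably_additive_on:
  assumes "loc_finite M R p" "R \<subseteq> sets M"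
  shows "countably_additive_on R (measure p)"
  unfolding countably_additive_on_def
proof (intro conjI allI impI)
  fix A :: "nat \<Rightarrow> 'a set" assume A: "range A \<subseteq> R \<and> disjoint_family A \<and> (\<Union>k. A k) \<in> R"
  have "(\<lambda>k. measure p (A k)) sums measure p (\<Union>k. A k)"
    using A assms by (intro measure_UNION) (auto simp: loc_finite_def)
  then show "(\<lambda>k. measure p (A k)) sums measure p (\<Union>k. A k)"
    "summable (\<lambda>k. \<bar>measure p (A k)\<bar>)" by (auto simp: sums_iff)
qed simp

context localized_borel
begin

lemma loc_ring: "localizing_ring M R"
  using localized_borel by (simp add: localized_borel_space_def)

lemma ring: "ring_of_sets (space M) R"
  using loc_ring by (simp add: localizing_ring_def)

lemma R_sets: "B \<in> R \<Longrightarrow> B \<in> sets M"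
  using loc_ring by (auto simp: localizing_ring_def)

lemma R_subset_sets: "R \<subseteq> sets M"
  using R_sets by blast

lemma R_Int: "B \<in> R \<Longrightarrow> C \<in> sets M \<Longrightarrow> B \<inter> C \<in> R"
  using loc_ring by (auto simp: localizing_ring_def)

lemma R_subset: "B \<in> R \<Longrightarrow> C \<in> sets M \<Longrightarrow> C \<subseteq> B \<Longrightarrow> C \<in> R"
  using R_Int[of B C] by (simp add: Int_absorb1)

lemma R_Diff: "B \<in> R \<Longrightarrow> C \<in> sets M \<Longrightarrow> B - C \<in> R"
  by (rule R_subset[of B]) (auto dest: R_sets)

lemma R_empty [simp]: "{} \<in> R" and R_Un: "A \<in> R \<Longrightarrow> B \<in> R \<Longrightarrow> A \<union> B \<in> R"
  using ring by (simp_all add: ring_of_sets_iff)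

definition exh :: "nat \<Rightarrow> 'a set" where
  "exh = (SOME S. range S \<subseteq> R \<and> incseq S \<and> (\<Union>n. S n) = space M \<and>
      R = (\<Union>n. {C \<inter> S n | C. C \<in> sets M}))"

lemma exh_R [simp, intro]: "exh n \<in> R" and exh_incseq: "incseq exh"
  and UN_exh: "(\<Union>n. exh n) = space M" and R_eq_exh: "R = (\<Union>n. {C \<inter> exh n | C. C \<in> sets M})"
proof -
  have "\<exists>S::nat \<Rightarrow> 'a set. range S \<subseteq> R \<and> incseq S \<and> (\<Union>n. S n) = space M \<and>
      R = (\<Union>n. {C \<inter> S n | C. C \<in> sets M})"
    using loc_ring unfolding localizing_ring_def by blast
  from someI_ex[OF this, folded exh_def]
  show "exh n \<in> R" "incseq exh" "(\<Union>n. exh n) = space M" 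
    "R = (\<Union>n. {C \<inter> exh n | C. C \<in> sets M})" by blast+
qed

lemma R_sub_exh: "B \<in> R \<Longrightarrow> \<exists>n. B \<subseteq> exh n"
proof -
  assume "B \<in> R"
  then have "B \<in> (\<Union>n. {C \<inter> exh n | C. C \<in> sets M})" by (subst (asm) R_eq_exh)
  then show ?thesis by auto
qed

lemma singleton_R [simp]: "s \<in> space M \<Longrightarrow> {s} \<in> R"
proof -
  assume s: "s \<in> space M"
  then obtain n where "s \<in> exh n" using UN_exh by auto
  then show ?thesis using s by (intro R_subset[OF exh_R[of n]]) auto
qed

lemma countable_sets: assumes "countable D" "D \<subseteq> space M" shows "D \<in> sets M"
  using assms sets.countable[of D M] by (auto simp: subset_iff)

lemma additive_on:
  assumes "countably_additive_on R \<mu>" "A \<in> R" "B \<in> R" "A \<inter> B = {}"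
  shows "\<mu> (A \<union> B) = \<mu> A + \<mu> B"
proof -
  have 0: "\<mu> {} = 0" using assms by (simp add: countably_additive_on_def)
  have eq: "(\<Union>k. binaryset A B k) = A \<union> B" by (rule UN_binaryset_eq)
  have "binaryset A B k \<in> R" for k using assms by (auto simp: binaryset_def)
  moreover have "disjoint_family (binaryset A B)"
    using assms(4) by (auto simp: disjoint_family_on_def binaryset_def)
  ultimately have "(\<lambda>k. \<mu> (binaryset A B k)) sums \<mu> (A \<union> B)"
    using countably_additive_onD(2)[OF assms(1), of "binaryset A B"] assms eq by (simp add: R_Un)
  then show ?thesis
    using binaryset_sums[of \<mu> A B] 0 sums_unique2 by blast
qed

lemma additive_on_finite:
  assumes mu: "countably_additive_on R \<mu>" and "finite I" "disjoint_family_on A I"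
    and A: "\<And>i. i \<in> I \<Longrightarrow> A i \<in> R"
  shows "(\<Union>i\<in>I. A i) \<in> R \<and> \<mu> (\<Union>i\<in>I. A i) = (\<Sum>i\<in>I. \<mu> (A i))"
  using assms(2-)
proof (induction I rule: finite_induct)
  case empty
  then show ?case using mu by (simp add: countably_additive_on_def)
next
  case (insert i I)
  have IH: "(\<Union>i\<in>I. A i) \<in> R" "\<mu> (\<Union>i\<in>I. A i) = (\<Sum>i\<in>I. \<mu> (A i))"
    using insert by (auto simp: disjoint_family_on_def)
  have "A i \<inter> (\<Union>i\<in>I. A i) = {}"
    using insert by (auto simp: disjoint_family_on_def)
  then show ?case using additive_on[OF mu _ IH(1)] IH insert by (auto simp: R_Un)
qed

lemma Diff_on:
  assumes "countably_additive_on R \<mu>" "A \<in> R" "C \<in> sets M" "C \<subseteq> A"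
  shows "\<mu> (A - C) = \<mu> A - \<mu> C"
proof -
  have "\<mu> (A - C \<union> C) = \<mu> (A - C) + \<mu> C"
    using assms R_subset[OF assms(2,3,4)] R_Diff by (intro additive_on[OF assms(1)]) auto
  then show ?thesis using assms(4) by (simp add: Un_absorb2)
qed

lemma sum_cells:
  assumes "countably_additive_on R \<mu>" "B \<in> R"
  shows "(\<Sum>k\<le>2 ^ n. \<mu> (B \<inter> cells n k)) = \<mu> B"
proof -
  have "\<mu> (\<Union>k\<in>{..2 ^ n}. B \<inter> cells n k) = (\<Sum>k\<le>2 ^ n. \<mu> (B \<inter> cells n k))"
    using assms disjoint_cells[of n]
    by (intro conjunct2[OF additive_on_finite]) (auto simp: R_Int disjoint_family_on_def)
  also have "(\<Union>k\<in>{..2 ^ n}. B \<inter> cells n k) = B"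
    using UN_cells[of n] sets.sets_into_space[OF R_sets[OF assms(2)]] by blast
  finally show ?thesis by simp
qed

text \<open>Positive variation. The supremum is meaningful for sets outside \<open>R\<close> too,
  which turns a set function on the ring into a measure on all of \<open>sets M\<close>.\<close>

definition pos_var :: "('a set \<Rightarrow> real) \<Rightarrow> 'a set \<Rightarrow> ennreal" where
  "pos_var \<mu> A = (SUP C\<in>{C \<in> R. C \<subseteq> A}. ennreal (\<mu> C))"

lemma pos_var_ge: "C \<in> R \<Longrightarrow> C \<subseteq> A \<Longrightarrow> ennreal (\<mu> C) \<le> pos_var \<mu> A"
  unfolding pos_var_def by (rule SUP_upper) auto

lemma pos_var_mono: "A \<subseteq> B \<Longrightarrow> pos_var \<mu> A \<le> pos_var \<mu> B"
  unfolding pos_var_def by (rule SUP_subset_mono) auto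

text \<open>A test set inside \<open>A\<close> and one inside \<open>B\<close> unite to a test set
  inside \<open>A \<union> B\<close>.\<close>

lemma pos_var_superadd:
  assumes mu: "countably_additive_on R \<mu>" and AB: "A \<inter> B = {}"
  shows "pos_var \<mu> A + pos_var \<mu> B \<le> pos_var \<mu> (A \<union> B)"
proof -
  have ne: "{C \<in> R. C \<subseteq> A} \<noteq> {}" "{C \<in> R. C \<subseteq> B} \<noteq> {}" for A B using R_empty by blast+
  have *: "ennreal (\<mu> C) + ennreal (\<mu> D) \<le> pos_var \<mu> (A \<union> B)"
    if "C \<in> R" "C \<subseteq> A" "D \<in> R" "D \<subseteq> B" for C D
  proof -
    have C: "ennreal (\<mu> C) \<le> pos_var \<mu> (A \<union> B)" "ennreal (\<mu> D) \<le> pos_var \<mu> (A \<union> B)"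
      using that by (auto intro!: pos_var_ge)
    have "\<mu> (C \<union> D) = \<mu> C + \<mu> D" using that AB by (intro additive_on[OF mu]) auto
    moreover have "ennreal (\<mu> (C \<union> D)) \<le> pos_var \<mu> (A \<union> B)"
      using that by (intro pos_var_ge R_Un) auto
    ultimately have CD: "ennreal (\<mu> C + \<mu> D) \<le> pos_var \<mu> (A \<union> B)" by simp
    \<comment> \<open>\<open>ennreal\<close> cuts negative values to 0, so if one mass is
      nonpositive the other set alone gives the bound; additivity is used when both are
      nonnegative.\<close>
    consider "\<mu> C \<le> 0" | "\<mu> D \<le> 0" | "\<mu> C \<ge> 0" "\<mu> D \<ge> 0" by linarith
    then show ?thesis
      using C CD by cases (auto simp: ennreal_neg)
  qed
  have "pos_var \<mu> A + pos_var \<mu> B = (SUP C\<in>{C \<in> R. C \<subseteq> A}. ennreal (\<mu> C) + pos_var \<mu> B)"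
    unfolding pos_var_def[of \<mu> A] by (subst ennreal_SUP_add_left[OF ne(1)]) simp
  also have "\<dots> = (SUP C\<in>{C \<in> R. C \<subseteq> A}. SUP D\<in>{D \<in> R. D \<subseteq> B}. ennreal (\<mu> C) + ennreal (\<mu> D))"
    unfolding pos_var_def[of \<mu> B] by (subst ennreal_SUP_add_right[OF ne(2)]) simp
  also have "\<dots> \<le> pos_var \<mu> (A \<union> B)"
    by (intro SUP_least) (auto intro: *)
  finally show ?thesis .
qed

text \<open>One inequality is superadditivity for finite unions. For the other, a test set is cut
  along the \<open>A i\<close>, and its mass is at most the sum of the positive parts of the pieces,
  which converges by absolute convergence.\<close>

lemma pos_var_UN:
  fixes A :: "nat \<Rightarrow> 'a set"
  assumes mu: "countably_additive_on R \<mu>" and A: "\<And>i. A i \<in> sets M" "disjoint_family A"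
  shows "(\<Sum>i. pos_var \<mu> (A i)) = pos_var \<mu> (\<Union>i. A i)"
proof (rule antisym)
  have "(\<Sum>i<n. pos_var \<mu> (A i)) \<le> pos_var \<mu> (\<Union>i<n. A i)" for n
  proof (induction n)
    case (Suc n)
    have "A i \<inter> A n = {}" if "i < n" for i
      using A(2) that by (auto simp: disjoint_family_on_def)
    then have "(\<Union>i<n. A i) \<inter> A n = {}" by auto
    then have "pos_var \<mu> (\<Union>i<n. A i) + pos_var \<mu> (A n) \<le> pos_var \<mu> ((\<Union>i<n. A i) \<union> A n)"
      by (rule pos_var_superadd[OF mu])
    also have "(\<Union>i<n. A i) \<union> A n = (\<Union>i<Suc n. A i)" by (auto simp: less_Suc_eq)
    finally have *: "pos_var \<mu> (\<Union>i<n. A i) + pos_var \<mu> (A n) \<le> pos_var \<mu> (\<Union>i<Suc n. A i)" .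
    have "(\<Sum>i<Suc n. pos_var \<mu> (A i)) \<le> pos_var \<mu> (\<Union>i<n. A i) + pos_var \<mu> (A n)"
      unfolding sum.lessThan_Suc by (rule add_right_mono[OF Suc])
    from order_trans[OF this *] show ?case .
  qed simp
  also have "pos_var \<mu> (\<Union>i<n. A i) \<le> pos_var \<mu> (\<Union>i. A i)" for n
    by (rule pos_var_mono) auto
  finally show "(\<Sum>i. pos_var \<mu> (A i)) \<le> pos_var \<mu> (\<Union>i. A i)"
    by (simp add: suminf_eq_SUP SUP_least)
  have "ennreal (\<mu> C) \<le> (\<Sum>i. pos_var \<mu> (A i))" if C: "C \<in> R" "C \<subseteq> (\<Union>i. A i)" for C
  proof -
    have R: "C \<inter> A i \<in> R" for i using R_Int[OF C(1) A(1)] .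
    have eq: "(\<Union>i. C \<inter> A i) = C" using C by auto
    have "disjoint_family (\<lambda>i. C \<inter> A i)" using A(2) by (auto simp: disjoint_family_on_def)
    from countably_additive_onD[OF mu R this] C eq
    have s: "summable (\<lambda>k. \<bar>\<mu> (C \<inter> A k)\<bar>)" "(\<lambda>k. \<mu> (C \<inter> A k)) sums \<mu> C" by auto
    have s': "summable (\<lambda>k. max 0 (\<mu> (C \<inter> A k)))"
      by (rule summable_comparison_test'[OF s(1), of 0]) auto
    have "\<mu> C \<le> (\<Sum>k. max 0 (\<mu> (C \<inter> A k)))"
      using suminf_le[of "\<lambda>k. \<mu> (C \<inter> A k)" "\<lambda>k. max 0 (\<mu> (C \<inter> A k))"] s s'
      by (auto simp: sums_iff)
    then have "ennreal (\<mu> C) \<le> ennreal (\<Sum>k. max 0 (\<mu> (C \<inter> A k)))" by (rule ennreal_leI)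
    also have "\<dots> = (\<Sum>k. ennreal (max 0 (\<mu> (C \<inter> A k))))"
      using s' by (intro suminf_ennreal2[symmetric]) auto
    also have "\<dots> \<le> (\<Sum>i. pos_var \<mu> (A i))"
    proof (intro suminf_le allI)
      fix k show "ennreal (max 0 (\<mu> (C \<inter> A k))) \<le> pos_var \<mu> (A k)"
        using pos_var_ge[OF R, of k "A k" \<mu>] by (auto simp: max_def)
    qed auto
    finally show ?thesis .
  qed
  then show "pos_var \<mu> (\<Union>i. A i) \<le> (\<Sum>i. pos_var \<mu> (A i))"
    unfolding pos_var_def[of \<mu> "\<Union>i. A i"] by (intro SUP_least) auto
qed

text \<open>
  A set of infinite variation splits into a piece of mass at least 1 and another set of infinite
  variation; iterating contradicts absolute convergence.
\<close>

lemma pos_var_finite: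
  assumes mu: "countably_additive_on R \<mu>" and B: "B \<in> R"
  shows "pos_var \<mu> B < \<infinity>"
proof (rule ccontr)
  assume "\<not> pos_var \<mu> B < \<infinity>"
  then have inf: "pos_var \<mu> B = \<infinity>" by (simp add: less_top[symmetric])
  have step: "\<exists>C. C \<in> R \<and> C \<subseteq> D \<and> pos_var \<mu> C = \<infinity> \<and> \<bar>\<mu> (D - C)\<bar> \<ge> 1"
    if D: "D \<in> R" "pos_var \<mu> D = \<infinity>" for D
  proof -
    \<comment> \<open>Exceeding \<open>\<bar>\<mu> D\<bar> + 1\<close> gives both \<open>C\<close>
      and \<open>D - C\<close> a mass of absolute value at least 1, so it does not matter which of
      the two inherits the infinite variation.\<close>
    have "ennreal (\<bar>\<mu> D\<bar> + 1) < pos_var \<mu> D" using D(2) by simp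
    then obtain C where C: "C \<in> R" "C \<subseteq> D" "ennreal (\<bar>\<mu> D\<bar> + 1) < ennreal (\<mu> C)"
      unfolding pos_var_def less_SUP_iff by auto
    then have "\<mu> C > \<bar>\<mu> D\<bar> + 1"
      by (subst (asm) ennreal_less_iff) auto
    moreover have "\<mu> (D - C) = \<mu> D - \<mu> C"
      using C R_sets by (intro Diff_on[OF mu D(1)]) auto
    ultimately have b: "\<bar>\<mu> (D - C)\<bar> \<ge> 1" "\<bar>\<mu> (D - (D - C))\<bar> \<ge> 1"
      using C(2) by (auto simp: double_diff)
    have DC: "D - C \<in> R" using D C R_Diff R_sets by blast
    have "pos_var \<mu> D = pos_var \<mu> C + pos_var \<mu> (D - C)"
    proof -
      have "(\<Union>i. binaryset C (D - C) i) = D" using C(2) by (auto simp: UN_binaryset_eq)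
      moreover have "(\<Sum>i. pos_var \<mu> (binaryset C (D - C) i)) = pos_var \<mu> (\<Union>i. binaryset C (D - C) i)"
        using C(1) DC by (intro pos_var_UN[OF mu]) (auto simp: binaryset_def disjoint_family_on_def R_sets)
      moreover have "pos_var \<mu> {} = 0"
        using mu by (simp add: pos_var_def countably_additive_on_def)
      ultimately show ?thesis using suminf_binaryset_eq[of "pos_var \<mu>"] by simp
    qed
    then have "pos_var \<mu> C = \<infinity> \<or> pos_var \<mu> (D - C) = \<infinity>"
      using D(2) by (metis ennreal_add_eq_top infinity_ennreal_def)
    then show ?thesis using C DC b by blast
  qed
  define next_set where
    "next_set D = (SOME C. C \<in> R \<and> C \<subseteq> D \<and> pos_var \<mu> C = \<infinity> \<and> \<bar>\<mu> (D - C)\<bar> \<ge> 1)" for D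
  define D where "D n = (next_set ^^ n) B" for n
  have D: "D n \<in> R \<and> pos_var \<mu> (D n) = \<infinity>" for n
  proof (induction n)
    case (Suc n)
    then show ?case using someI_ex[OF step[of "D n"], folded next_set_def] by (simp add: D_def)
  qed (simp add: D_def inf B)
  have DS: "D (Suc n) \<subseteq> D n \<and> \<bar>\<mu> (D n - D (Suc n))\<bar> \<ge> 1" for n
    using someI_ex[OF step[of "D n"], folded next_set_def] D[of n] by (simp add: D_def)
  then have dec: "decseq D" by (simp add: decseq_Suc_iff)
  define A where "A n = D n - D (Suc n)" for n
  have AR: "A n \<in> R" for n using D R_Diff R_sets unfolding A_def by blast
  have disj: "disjoint_family A"
  proof -
    have "A m \<inter> A n = {}" if "m < n" for m n
      using decseqD[OF dec, of "Suc m" n] that by (auto simp: A_def)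
    then show ?thesis unfolding disjoint_family_on_def by (metis Int_commute linorder_neqE_nat)
  qed
  have "A n \<subseteq> B" for n using decseqD[OF dec, of 0 n] by (auto simp: A_def D_def)
  then have "(\<Union>n. A n) \<in> R"
    using AR R_sets by (intro R_subset[OF B]) auto
  from countably_additive_onD(1)[OF mu AR disj this]
  have "(\<lambda>n. \<bar>\<mu> (A n)\<bar>) \<longlonglongrightarrow> 0" by (rule summable_LIMSEQ_zero)
  then have "\<forall>\<^sub>F n in sequentially. \<bar>\<mu> (A n)\<bar> < 1" by (rule order_tendstoD) simp
  then obtain n where "\<bar>\<mu> (A n)\<bar> < 1" by (auto simp: eventually_sequentially)
  then show False using DS[of n] by (simp add: A_def)
qed

text \<open>The two measures are the positive variations of \<open>\<mu>\<close> and of its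
  negative. By the last two clauses at most one of them has an atom at any given point; the
  evaluation of the sums of squares depends on this.\<close>

lemma jordan_decomposition:
  assumes mu: "countably_additive_on R \<mu>"
  shows "\<exists>p q. loc_finite M R p \<and> loc_finite M R q \<and> (\<forall>B\<in>R. \<mu> B = measure p B - measure q B) \<and>
    (\<forall>s\<in>space M. measure p {s} = max 0 (\<mu> {s})) \<and> (\<forall>s\<in>space M. measure q {s} = max 0 (- \<mu> {s}))"
proof -
  define v where "v \<nu> = measure_of (space M) (sets M) (pos_var \<nu>)" for \<nu>
  have ev: "emeasure (v \<nu>) A = pos_var \<nu> A" if nu: "countably_additive_on R \<nu>" "A \<in> sets M" for \<nu> A
    unfolding v_def
  proof (rule emeasure_measure_of_sigma)
    show "sigma_algebra (space M) (sets M)" ..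
    show "positive (sets M) (pos_var \<nu>)"
      using nu by (simp add: positive_def pos_var_def countably_additive_on_def)
    show "countably_additive (sets M) (pos_var \<nu>)"
      using pos_var_UN[OF nu(1)] by (auto simp: countably_additive_def)
  qed (use that in auto)
  have sv: "sets (v \<nu>) = sets M" for \<nu> by (simp add: v_def)
  have lf: "loc_finite M R (v \<nu>)" if "countably_additive_on R \<nu>" for \<nu>
    using pos_var_finite[OF that] ev[OF that] R_sets by (auto simp: loc_finite_def sv)
  have mv: "measure (v \<nu>) {s} = max 0 (\<nu> {s})" if nu: "countably_additive_on R \<nu>" "s \<in> space M" for \<nu> s
  proof -
    have "{C \<in> R. C \<subseteq> {s}} = {{}, {s}}" using that by auto
    moreover have "\<nu> {} = 0" using nu(1) by (simp add: countably_additive_on_def)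
    ultimately have "pos_var \<nu> {s} = sup 0 (ennreal (\<nu> {s}))"
      by (simp add: pos_var_def)
    also have "\<dots> = ennreal (max 0 (\<nu> {s}))"
      by (cases "\<nu> {s} \<ge> 0") (auto simp: ennreal_neg sup_absorb2)
    finally have "pos_var \<nu> {s} = ennreal (max 0 (\<nu> {s}))" .
    then have "emeasure (v \<nu>) {s} = ennreal (max 0 (\<nu> {s}))" using ev[OF nu(1), of "{s}"] that by simp
    then show ?thesis by (cases "\<nu> {s} \<ge> 0") (auto simp: measure_def ennreal_neg)
  qed
  note mu' = countably_additive_on_minus[OF mu]
  have eq: "\<mu> B = measure (v \<mu>) B - measure (v (\<lambda>B. - \<mu> B)) B" if B: "B \<in> R" for B
  proof -
    \<comment> \<open>Complementing inside \<open>B\<close> turns test sets for the negative of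
      \<open>\<nu>\<close> into test sets for \<open>\<nu>\<close>. This gives one inequality;
      applying it to \<open>\<mu>\<close> and to its negative gives equality.\<close>
    have le: "\<nu> B \<le> measure (v \<nu>) B - measure (v (\<lambda>B. - \<nu> B)) B" if nu: "countably_additive_on R \<nu>" for \<nu>
    proof -
      note nu' = countably_additive_on_minus[OF nu]
      have fin: "emeasure (v \<nu>) B \<noteq> \<infinity>" using lf[OF nu] B by (auto simp: loc_finite_def)
      have "emeasure (v (\<lambda>B. - \<nu> B)) B \<le> ennreal (measure (v \<nu>) B - \<nu> B)"
        unfolding ev[OF nu' R_sets[OF B]] pos_var_def
      proof (intro SUP_least)
        fix C assume C: "C \<in> {C \<in> R. C \<subseteq> B}"
        have BC: "B - C \<in> R" using C B R_Diff R_sets by blast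
        have "ennreal (\<nu> (B - C)) \<le> emeasure (v \<nu>) B"
          using BC ev[OF nu R_sets[OF B]] by (auto intro!: pos_var_ge)
        also have "\<dots> = ennreal (measure (v \<nu>) B)" using fin by (simp add: emeasure_eq_ennreal_measure)
        finally have "\<nu> (B - C) \<le> measure (v \<nu>) B" by (simp add: ennreal_le_iff)
        moreover have "\<nu> (B - C) = \<nu> B - \<nu> C" using C B R_sets by (intro Diff_on[OF nu]) auto
        ultimately show "ennreal (- \<nu> C) \<le> ennreal (measure (v \<nu>) B - \<nu> B)"
          by (intro ennreal_leI) simp
      qed
      moreover have "measure (v \<nu>) B - \<nu> B \<ge> 0"
      proof -
        have "ennreal (\<nu> B) \<le> emeasure (v \<nu>) B" using B ev[OF nu R_sets[OF B]] by (auto intro!: pos_var_ge)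
        also have "\<dots> = ennreal (measure (v \<nu>) B)" using fin by (simp add: emeasure_eq_ennreal_measure)
        finally show ?thesis by (simp add: ennreal_le_iff)
      qed
      ultimately have "measure (v (\<lambda>B. - \<nu> B)) B \<le> measure (v \<nu>) B - \<nu> B"
        by (simp add: measure_def enn2real_leI)
      then show ?thesis by simp
    qed
    have "(\<lambda>B. - (- \<mu> B)) = \<mu>" by auto
    then show ?thesis using le[OF mu] le[OF mu'] by simp
  qed
  show ?thesis
    by (intro exI conjI ballI) (rule lf[OF mu] lf[OF mu'] eq mv[OF mu] mv[OF mu']; assumption)+
qed

end

section \<open>Cell masses of measures and the atoms they detect\<close>

text \<open>Restriction as a density, so that the underlying space remains that of \<open>M\<close>
  and statements on finite measures over \<open>M\<close> apply.\<close>

definition restr :: "'a measure \<Rightarrow> 'a set \<Rightarrow> 'a measure" where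
  "restr p B = density p (indicator B)"

lemma sets_restr [simp, measurable_cong]: "sets (restr p B) = sets p" and space_restr [simp]: "space (restr p B) = space p"
  by (simp_all add: restr_def)

lemma emeasure_restr: "B \<in> sets p \<Longrightarrow> A \<in> sets p \<Longrightarrow> emeasure (restr p B) A = emeasure p (B \<inter> A)"
  unfolding restr_def by (subst emeasure_density) (auto simp: indicator_inter_arith[symmetric])

lemma measure_restr: "B \<in> sets p \<Longrightarrow> A \<in> sets p \<Longrightarrow> measure (restr p B) A = measure p (B \<inter> A)"
  by (simp add: measure_def emeasure_restr)

context localized_borel
begin

text \<open>The cells around \<open>x\<close> decrease to \<open>{x}\<close> because they separate
  points; finiteness gives continuity from above.\<close>

lemma cell_limit:
  assumes "finite_measure p" "sets p = sets M" "x \<in> space M"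
  shows "(\<lambda>n. measure p (cells n (cell n x))) \<longlonglongrightarrow> measure p {x}"
proof -
  interpret p: finite_measure p by fact
  have "decseq (\<lambda>n. cells n (cell n x))"
    using cell_refine assms(3) by (auto simp: cells_def decseq_def)
  moreover have "(\<Inter>n. cells n (cell n x)) = {x}"
  proof -
    have "y = x" if "\<forall>n. y \<in> cells n (cell n x)" for y
      using cell_separates[OF assms(3), of y] that by (auto simp: cells_def eventually_sequentially)
    then show ?thesis using assms(3) by (auto simp: cells_def)
  qed
  ultimately show ?thesis
    using p.finite_Lim_measure_decseq[of "\<lambda>n. cells n (cell n x)"] assms(2) by (auto simp: image_subset_iff)
qed

text \<open>
  With \<open>d = p - q\<close>, the sum of squares is the integral of \<open>d (cell of x)\<close> against
  \<open>d\<close>, so dominated convergence leaves only the atoms in the limit.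
\<close>

lemma finite_sum_cells_square:
  assumes p: "finite_measure p" "sets p = sets M" and q: "finite_measure q" "sets q = sets M"
  defines "d \<equiv> \<lambda>A. measure p A - measure q A"
  shows "(\<lambda>n. \<Sum>k\<le>2 ^ n. (d (cells n k))\<^sup>2) \<longlonglongrightarrow> (\<integral>x. d {x} \<partial>p) - (\<integral>x. d {x} \<partial>q)"
    and "(\<lambda>x. d {x}) \<in> borel_measurable M"
    and "integrable p (\<lambda>x. d {x})" "integrable q (\<lambda>x. d {x})"
proof -
  interpret p: finite_measure p by fact
  interpret q: finite_measure q by fact
  have sp: "space p = space M" "space q = space M"
    using p q by (auto dest: sets_eq_imp_space_eq)
  define \<phi> where "\<phi> n x = d (cells n (cell n x))" for n x
  define K where "K = measure p (space M) + measure q (space M)"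
  have dK: "\<bar>d A\<bar> \<le> K" for A
    unfolding d_def K_def using p.bounded_measure[of A] q.bounded_measure[of A]
    measure_nonneg[of p A] measure_nonneg[of q A] unfolding sp by linarith
  have bK: "\<bar>\<phi> n x\<bar> \<le> K" for n x unfolding \<phi>_def by (rule dK)
  have lim: "(\<lambda>n. \<phi> n x) \<longlonglongrightarrow> d {x}" if "x \<in> space M" for x
    unfolding \<phi>_def d_def by (intro tendsto_diff cell_limit p q that)
  have \<phi>m [measurable]: "\<phi> n \<in> borel_measurable M" for n
    unfolding \<phi>_def by measurable
  show dm: "(\<lambda>x. d {x}) \<in> borel_measurable M"
    by (rule borel_measurable_LIMSEQ_real[OF lim \<phi>m]) auto
  \<comment> \<open>Proved for a general \<open>r\<close>: the difference of the cases
    \<open>r = p\<close> and \<open>r = q\<close> replaces the second factor by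
    \<open>d (cells n k)\<close> and so produces the square.\<close>
  have *: "(\<lambda>n. \<Sum>k\<le>2 ^ n. d (cells n k) * measure r (cells n k)) \<longlonglongrightarrow> (\<integral>x. d {x} \<partial>r) \<and> integrable r (\<lambda>x. d {x})"
    if r: "finite_measure r" "sets r = sets M" for r
  proof -
    interpret r: finite_measure r by fact
    have sr: "space r = space M" using r by (auto dest: sets_eq_imp_space_eq)
    have mr: "borel_measurable r = borel_measurable M" using r(2) by (rule measurable_cong_sets) simp
    have "(\<integral>x. \<phi> n x \<partial>r) = (\<Sum>k\<le>2 ^ n. d (cells n k) * measure r (cells n k))" for n
    proof -
      have "(\<integral>x. \<phi> n x \<partial>r) = (\<integral>x. (\<Sum>k\<le>2 ^ n. d (cells n k) * indicator (cells n k) x) \<partial>r)"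
      proof (rule Bochner_Integration.integral_cong[OF refl])
        fix x assume "x \<in> space r"
        then have x: "x \<in> space M" by (simp add: sr)
        have "(\<Sum>k\<le>2 ^ n. d (cells n k) * indicator (cells n k) x)
            = (\<Sum>k\<le>2 ^ n. if k = cell n x then d (cells n k) else 0)"
          using x by (intro sum.cong) (auto simp: cells_def indicator_def)
        then show "\<phi> n x = (\<Sum>k\<le>2 ^ n. d (cells n k) * indicator (cells n k) x)"
          using cell_le[OF x, of n] by (simp add: \<phi>_def)
      qed
      also have "\<dots> = (\<Sum>k\<le>2 ^ n. d (cells n k) * measure r (cells n k))"
        by (subst Bochner_Integration.integral_sum)
           (auto simp: r(2) sr Int_absorb2 sets.sets_into_space[OF cells_sets] r.emeasure_finite less_top[symmetric])
      finally show ?thesis .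
    qed
    moreover have "(\<lambda>n. \<integral>x. \<phi> n x \<partial>r) \<longlonglongrightarrow> (\<integral>x. d {x} \<partial>r)"
      by (rule integral_dominated_convergence[where w = "\<lambda>_. K"])
         (auto simp: mr dm sr dK \<phi>_def[symmetric] bK intro!: AE_I2 lim)
    moreover have "integrable r (\<lambda>x. d {x})"
      by (rule r.integrable_const_bound[where B = K]) (auto simp: mr dm dK)
    ultimately show ?thesis by simp
  qed
  have "(\<lambda>n. (\<Sum>k\<le>2 ^ n. d (cells n k) * measure p (cells n k)) - (\<Sum>k\<le>2 ^ n. d (cells n k) * measure q (cells n k)))
      \<longlonglongrightarrow> (\<integral>x. d {x} \<partial>p) - (\<integral>x. d {x} \<partial>q)"
    using *[OF p] *[OF q] by (intro tendsto_diff) auto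
  then show "(\<lambda>n. \<Sum>k\<le>2 ^ n. (d (cells n k))\<^sup>2) \<longlonglongrightarrow> (\<integral>x. d {x} \<partial>p) - (\<integral>x. d {x} \<partial>q)"
    by (simp add: sum_subtractf[symmetric] power2_eq_square right_diff_distrib[symmetric] d_def)
  show "integrable p (\<lambda>x. d {x})" "integrable q (\<lambda>x. d {x})" using * p q by auto
qed

text \<open>The indicator of \<open>A\<close> is the sum of the indicators of its points, and
  countability lets sum and integral be exchanged.\<close>

lemma nn_integral_countable_support:
  assumes p: "sets p = sets M" and A: "countable A" "A \<subseteq> space M" and f: "f \<in> borel_measurable M"
  shows "(\<integral>\<^sup>+x. f x * indicator A x \<partial>p) = (\<integral>\<^sup>+t. f t * emeasure p {t} \<partial>count_space A)"
proof -
  have s: "{t} \<in> sets p" if "t \<in> A" for t using that A p by auto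
  have "(\<integral>\<^sup>+x. f x * indicator A x \<partial>p) = (\<integral>\<^sup>+x. \<integral>\<^sup>+t. f t * indicator {t} x \<partial>count_space A \<partial>p)"
  proof (rule nn_integral_cong)
    fix x
    have "(\<integral>\<^sup>+t. f t * indicator {t} x \<partial>count_space A) = (\<integral>\<^sup>+t. f x * indicator A x * indicator {x} t \<partial>count_space UNIV)"
      by (subst nn_integral_count_space_indicator) (simp, intro nn_integral_cong, auto simp: indicator_def)
    also have "\<dots> = f x * indicator A x"
      by (subst nn_integral_cmult_indicator) auto
    finally show "f x * indicator A x = (\<integral>\<^sup>+t. f t * indicator {t} x \<partial>count_space A)" by simp
  qed
  also have "\<dots> = (\<integral>\<^sup>+t. \<integral>\<^sup>+x. f t * indicator {t} x \<partial>p \<partial>count_space A)"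
    using s by (intro nn_integral_count_space_nn_integral A) auto
  also have "\<dots> = (\<integral>\<^sup>+t. f t * emeasure p {t} \<partial>count_space A)"
    using s by (intro nn_integral_cong) (auto simp: nn_integral_cmult_indicator)
  finally show ?thesis .
qed

lemma finite_restr:
  assumes "sets p = sets M" "B \<in> sets M" "emeasure p B < \<infinity>"
  shows "finite_measure (restr p B)"
  using assms sets_eq_imp_space_eq[OF assms(1)] sets.sets_into_space[OF assms(2)]
  by (intro finite_measureI) (simp add: emeasure_restr Int_absorb2)

lemma tendsto_cells:
  assumes mu: "countably_additive_on R \<mu>" and B: "B \<in> R" and t: "t \<in> space M"
  shows "(\<lambda>n. \<mu> (B \<inter> cells n (cell n t))) \<longlonglongrightarrow> \<mu> (B \<inter> {t})"
proof -
  obtain p q where pq: "loc_finite M R p" "loc_finite M R q" "\<forall>B\<in>R. \<mu> B = measure p B - measure q B"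
    using jordan_decomposition[OF mu] by blast
  note Bs = R_sets[OF B]
  have fin: "finite_measure (restr p B)" "sets (restr p B) = sets M" "finite_measure (restr q B)" "sets (restr q B) = sets M"
    using pq(1,2) B Bs by (simp_all add: finite_restr loc_finite_def)
  have eq: "\<mu> (B \<inter> A) = measure (restr p B) A - measure (restr q B) A" if "A \<in> sets M" for A
    using bspec[OF pq(3) R_Int[OF B that]] that Bs pq(1,2) by (simp add: measure_restr loc_finite_def)
  show ?thesis
    using tendsto_diff[OF cell_limit[OF fin(1,2) t] cell_limit[OF fin(3,4) t]] t by (simp add: eq)
qed

text \<open>An atom of \<open>\<mu>\<close> in \<open>B\<close> is an atom of one of the Jordan
  parts restricted to \<open>B\<close>, and a finite measure has only countably many atoms.\<close>

lemma countable_atoms: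
  assumes mu: "countably_additive_on R \<mu>" and B: "B \<in> R"
  shows "countable {t \<in> B. \<mu> {t} \<noteq> 0}"
proof -
  obtain p q where pq: "loc_finite M R p" "loc_finite M R q" "\<forall>B\<in>R. \<mu> B = measure p B - measure q B"
    "\<forall>s\<in>space M. measure p {s} = max 0 (\<mu> {s})" "\<forall>s\<in>space M. measure q {s} = max 0 (- \<mu> {s})"
    using jordan_decomposition[OF mu] by blast
  have c: "countable {t. measure (restr r B) {t} \<noteq> 0}" if "loc_finite M R r" for r
    using that B R_sets[OF B] by (intro finite_measure.countable_support finite_restr) (auto simp: loc_finite_def)
  have "{t \<in> B. \<mu> {t} \<noteq> 0} \<subseteq> {t. measure (restr p B) {t} \<noteq> 0} \<union> {t. measure (restr q B) {t} \<noteq> 0}"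
  proof safe
    fix t assume t: "t \<in> B" "\<mu> {t} \<noteq> 0" "measure (restr q B) {t} = 0" "measure (restr p B) {t} = 0"
    then have "t \<in> space M" using sets.sets_into_space[OF R_sets[OF B]] by auto
    moreover have "measure (restr r B) {t} = measure r {t}" if "loc_finite M R r" for r
      using that t(1) R_sets[OF B] \<open>t \<in> space M\<close>
      by (subst measure_restr) (simp_all add: loc_finite_def Int_absorb1)
    ultimately show False using t pq(1,2) bspec[OF pq(3), of "{t}"] by simp
  qed
  then show ?thesis by (rule countable_subset[OF _ countable_Un[OF c[OF pq(1)] c[OF pq(2)]]])
qed

text \<open>All five statements come from integrating over the countable set of atoms. There the
  Jordan parts have masses \<open>max 0 (\<mu> {t})\<close> and \<open>max 0 (- \<mu> {t})\<close>,
  so \<open>p\<close> carries the positive atoms, \<open>q\<close> the negative ones, and no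
  cancellation occurs.\<close>

lemma atoms_summable:
  assumes mu: "countably_additive_on R \<mu>" and B: "B \<in> R"
  shows "(\<integral>\<^sup>+t. ennreal \<bar>\<mu> {t}\<bar> * indicator B t \<partial>count_space (space M)) < \<infinity>"
    and "integrable (count_space {t \<in> B. \<mu> {t} \<noteq> 0}) (\<lambda>t. \<mu> {t})"
    and "(\<integral>t. \<mu> {t} \<partial>count_space {t \<in> B. \<mu> {t} \<noteq> 0}) = \<mu> {t \<in> B. \<mu> {t} \<noteq> 0}"
    and "(\<lambda>n. \<Sum>k\<le>2 ^ n. (\<mu> (B \<inter> cells n k))\<^sup>2) \<longlonglongrightarrow> enn2real (\<integral>\<^sup>+t. ennreal ((\<mu> {t})\<^sup>2) * indicator B t \<partial>count_space (space M))"
    and "(\<integral>\<^sup>+t. ennreal ((\<mu> {t})\<^sup>2) * indicator B t \<partial>count_space (space M)) < \<infinity>"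
proof -
  obtain p q where pq: "loc_finite M R p" "loc_finite M R q" "\<forall>B\<in>R. \<mu> B = measure p B - measure q B"
    "\<forall>s\<in>space M. measure p {s} = max 0 (\<mu> {s})" "\<forall>s\<in>space M. measure q {s} = max 0 (- \<mu> {s})"
    using jordan_decomposition[OF mu] by blast
  let ?A = "{t \<in> B. \<mu> {t} \<noteq> 0}"
  have Bs: "B \<in> sets M" using R_sets[OF B] .
  have BM: "B \<subseteq> space M" using sets.sets_into_space[OF Bs] .
  have cA: "countable ?A" by (rule countable_atoms[OF mu B])
  have AR: "?A \<in> R" using BM by (intro R_subset[OF B] countable_sets cA) auto
  have em: "emeasure r C = ennreal (measure r C)" if "loc_finite M R r" "C \<in> R" for r C
    using that by (intro emeasure_eq_ennreal_measure) (auto simp: loc_finite_def)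
  have int: "(\<integral>\<^sup>+t. ennreal (measure r {t}) \<partial>count_space ?A) = ennreal (measure r ?A)" if r: "loc_finite M R r" for r
  proof -
    have "(\<integral>\<^sup>+t. ennreal (measure r {t}) \<partial>count_space ?A) = (\<integral>\<^sup>+t. 1 * emeasure r {t} \<partial>count_space ?A)"
      using BM by (intro nn_integral_cong) (auto simp: em[OF r])
    also have "\<dots> = emeasure r ?A"
      using AR R_sets r BM by (subst nn_integral_countable_support[OF _ cA, symmetric]) (auto simp: loc_finite_def)
    finally show ?thesis using em[OF r AR] by simp
  qed
  have pint: "(\<integral>\<^sup>+t. ennreal (\<mu> {t}) \<partial>count_space ?A) = ennreal (measure p ?A)"
    unfolding int[OF pq(1), symmetric] using BM bspec[OF pq(4)] by (intro nn_integral_cong) auto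
  have qint: "(\<integral>\<^sup>+t. ennreal (- \<mu> {t}) \<partial>count_space ?A) = ennreal (measure q ?A)"
    unfolding int[OF pq(2), symmetric] using BM bspec[OF pq(5)] by (intro nn_integral_cong) auto
  have pq_int: "(\<integral>\<^sup>+t. ennreal \<bar>\<mu> {t}\<bar> \<partial>count_space ?A) = ennreal (measure p ?A) + ennreal (measure q ?A)"
    unfolding pint[symmetric] qint[symmetric]
    by (subst nn_integral_add[symmetric]) (auto intro!: nn_integral_cong simp: abs_if ennreal_neg)
  have AtoM: "(\<integral>\<^sup>+t. f t * indicator B t \<partial>count_space (space M)) = (\<integral>\<^sup>+t. f t \<partial>count_space ?A)"
    if "\<And>t. \<mu> {t} = 0 \<Longrightarrow> f t = 0" for f :: "'a \<Rightarrow> ennreal"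
    using that BM by (subst (1 2) nn_integral_count_space_indicator) (auto intro!: nn_integral_cong simp: indicator_def)
  show "(\<integral>\<^sup>+t. ennreal \<bar>\<mu> {t}\<bar> * indicator B t \<partial>count_space (space M)) < \<infinity>"
    by (subst AtoM) (simp_all add: pq_int)
  show i: "integrable (count_space ?A) (\<lambda>t. \<mu> {t})"
    by (rule integrableI_bounded) (simp_all add: pq_int)
  show "(\<integral>t. \<mu> {t} \<partial>count_space ?A) = \<mu> ?A"
    by (subst real_lebesgue_integral_def[OF i]) (simp add: pint qint pq(3)[rule_format, OF AR])
  let ?p = "restr p B" and ?q = "restr q B"
  define d where "d A = measure ?p A - measure ?q A" for A
  have fin: "finite_measure ?p" "sets ?p = sets M" "finite_measure ?q" "sets ?q = sets M"
    using pq(1,2) B Bs by (simp_all add: finite_restr loc_finite_def)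
  have sm: "sets p = sets M" "sets q = sets M" "space p = space M" "space q = space M"
    using pq(1,2) sets_eq_imp_space_eq[of p M] sets_eq_imp_space_eq[of q M] by (simp_all add: loc_finite_def)
  have d: "d A = \<mu> (B \<inter> A)" if "A \<in> sets M" for A
    using that Bs pq(3)[rule_format, OF R_Int[OF B that]] sm by (simp add: d_def measure_restr)
  have mu0: "\<mu> {} = 0" using mu by (simp add: countably_additive_on_def)
  have dx: "d {x} = (if x \<in> B then \<mu> {x} else 0)" if "x \<in> space M" for x
    using d[of "{x}"] that mu0 by (auto simp: Int_insert_right)
  note sq = finite_sum_cells_square[OF fin, folded d_def]
  \<comment> \<open>The sign \<open>c\<close> selects the positive or the negative part of the
    integrand, and \<open>c'\<close> records which Jordan part \<open>r\<close> is. With opposite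
    signs the integral is 0 (\<open>P2\<close>, \<open>Q2\<close>); with equal signs it collects
    squares (\<open>P1\<close>, \<open>Q1\<close>).\<close>
  have int2: "(\<integral>\<^sup>+x. ennreal (c * d {x}) \<partial>restr r B) = (\<integral>\<^sup>+t. ennreal (c * \<mu> {t}) * ennreal (measure r {t}) \<partial>count_space ?A)"
    if r: "loc_finite M R r" "\<forall>s\<in>space M. measure r {s} = max 0 (c' * \<mu> {s})" for r c c'
  proof -
    have sr: "sets r = sets M" "space r = space M"
      using r(1) sets_eq_imp_space_eq[of r M] by (simp_all add: loc_finite_def)
    have er: "emeasure (restr r B) {t} = ennreal (measure r {t})" if "t \<in> ?A" for t
      using that BM Bs em[OF r(1), of "{t}"] by (auto simp: emeasure_restr sr Int_insert_right)
    have "(\<integral>\<^sup>+x. ennreal (c * d {x}) \<partial>restr r B) = (\<integral>\<^sup>+x. ennreal (c * d {x}) * indicator ?A x \<partial>restr r B)"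
      using dx by (intro nn_integral_cong) (auto simp: sr indicator_def)
    also have "\<dots> = (\<integral>\<^sup>+t. ennreal (c * d {t}) * emeasure (restr r B) {t} \<partial>count_space ?A)"
      using BM sq(2) by (intro nn_integral_countable_support cA) (auto simp: sr)
    also have "\<dots> = (\<integral>\<^sup>+t. ennreal (c * \<mu> {t}) * ennreal (measure r {t}) \<partial>count_space ?A)"
    proof (rule nn_integral_cong)
      fix t assume "t \<in> space (count_space ?A)"
      then have t: "t \<in> ?A" by simp
      then show "ennreal (c * d {t}) * emeasure (restr r B) {t} = ennreal (c * \<mu> {t}) * ennreal (measure r {t})"
        using er[OF t] dx[of t] BM by auto
    qed
    finally show ?thesis .
  qed
  have 0: "(\<integral>\<^sup>+t. f t \<partial>count_space ?A) = 0" if "\<And>t. t \<in> ?A \<Longrightarrow> f t = 0" for f :: "'a \<Rightarrow> ennreal"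
    using that by (subst nn_integral_cong[where v = "\<lambda>_. 0"]) auto
  have p1: "\<forall>s\<in>space M. measure p {s} = max 0 (1 * \<mu> {s})"
    and q1: "\<forall>s\<in>space M. measure q {s} = max 0 (- 1 * \<mu> {s})"
    using pq(4,5) by simp_all
  have P1: "(\<integral>\<^sup>+x. ennreal (1 * d {x}) \<partial>?p) = (\<integral>\<^sup>+t. ennreal ((max 0 (\<mu> {t}))\<^sup>2) \<partial>count_space ?A)"
    using BM pq(4) by (subst int2[OF pq(1) p1], intro nn_integral_cong)
      (auto simp: max_def ennreal_neg power2_eq_square ennreal_mult)
  have P2: "(\<integral>\<^sup>+x. ennreal (- 1 * d {x}) \<partial>?p) = 0"
    using BM pq(4) by (subst int2[OF pq(1) p1], intro 0) (auto simp: max_def ennreal_neg subset_iff split: if_splits)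
  have Q1: "(\<integral>\<^sup>+x. ennreal (- 1 * d {x}) \<partial>?q) = (\<integral>\<^sup>+t. ennreal ((max 0 (- \<mu> {t}))\<^sup>2) \<partial>count_space ?A)"
    using BM pq(5) by (subst int2[OF pq(2) q1], intro nn_integral_cong)
      (auto simp: max_def ennreal_neg power2_eq_square ennreal_mult'' split: if_splits)
  have Q2: "(\<integral>\<^sup>+x. ennreal (1 * d {x}) \<partial>?q) = 0"
    using BM pq(5) by (subst int2[OF pq(2) q1], intro 0) (auto simp: max_def ennreal_neg subset_iff split: if_splits)
  have "(\<integral>x. d {x} \<partial>?p) = enn2real (\<integral>\<^sup>+x. ennreal (1 * d {x}) \<partial>?p)"
    using P2 by (subst real_lebesgue_integral_def[OF sq(3)]) simp
  moreover have "(\<integral>x. d {x} \<partial>?q) = - enn2real (\<integral>\<^sup>+x. ennreal (- 1 * d {x}) \<partial>?q)"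
    using Q2 by (subst real_lebesgue_integral_def[OF sq(4)]) simp
  moreover have f1: "(\<integral>\<^sup>+x. ennreal (1 * d {x}) \<partial>?p) < \<infinity>" 
    using integrableD(2)[OF sq(3)] by (auto simp: less_top[symmetric] real_integrable_def)
  moreover have f2: "(\<integral>\<^sup>+x. ennreal (- 1 * d {x}) \<partial>?q) < \<infinity>" 
    using sq(4) by (auto simp: less_top[symmetric] real_integrable_def)
  moreover have eq: "(\<integral>\<^sup>+x. ennreal (1 * d {x}) \<partial>?p) + (\<integral>\<^sup>+x. ennreal (- 1 * d {x}) \<partial>?q)
     = (\<integral>\<^sup>+t. ennreal ((\<mu> {t})\<^sup>2) * indicator B t \<partial>count_space (space M))"
    unfolding P1 Q1
    by (subst AtoM) (auto simp: nn_integral_add[symmetric] max_def ennreal_plus[symmetric] simp del: ennreal_plus intro!: nn_integral_cong)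
  ultimately have L: "(\<integral>x. d {x} \<partial>?p) - (\<integral>x. d {x} \<partial>?q)
     = enn2real (\<integral>\<^sup>+t. ennreal ((\<mu> {t})\<^sup>2) * indicator B t \<partial>count_space (space M))"
    by (simp add: enn2real_plus[symmetric])
  show "(\<lambda>n. \<Sum>k\<le>2 ^ n. (\<mu> (B \<inter> cells n k))\<^sup>2) \<longlonglongrightarrow> enn2real (\<integral>\<^sup>+t. ennreal ((\<mu> {t})\<^sup>2) * indicator B t \<partial>count_space (space M))"
    using sq(1) unfolding L by (simp add: d)
  show "(\<integral>\<^sup>+t. ennreal ((\<mu> {t})\<^sup>2) * indicator B t \<partial>count_space (space M)) < \<infinity>"
    unfolding eq[symmetric] using f1 f2 by simp
qed

lemma diffuse_sum_cells_square:
  assumes "countably_additive_on R \<mu>" "B \<in> R" "\<And>t. t \<in> B \<Longrightarrow> \<mu> {t} = 0"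
  shows "(\<lambda>n. \<Sum>k\<le>2 ^ n. (\<mu> (B \<inter> cells n k))\<^sup>2) \<longlonglongrightarrow> 0"
proof -
  have "(\<integral>\<^sup>+t. ennreal ((\<mu> {t})\<^sup>2) * indicator B t \<partial>count_space (space M)) = 0"
    using assms(3) by (subst nn_integral_cong[where v = "\<lambda>_. 0"]) (auto simp: indicator_def)
  then show ?thesis using atoms_summable(4)[OF assms(1,2)] by simp
qed

text \<open>The signed statement with the zero measure in the second place.\<close>

lemma finite_diffuse_sum_cells_square:
  assumes p: "finite_measure p" "sets p = sets M" "\<And>t. t \<in> space M \<Longrightarrow> measure p {t} = 0"
  shows "(\<lambda>n. \<Sum>k\<le>2 ^ n. (measure p (cells n k))\<^sup>2) \<longlonglongrightarrow> 0"
proof -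
  have sp: "space p = space M" using p by (intro sets_eq_imp_space_eq)
  have q: "finite_measure (null_measure M)" "sets (null_measure M) = sets M"
    by (auto intro!: finite_measureI)
  have "(\<integral>x. measure p {x} - measure (null_measure M) {x} \<partial>p) = (\<integral>x. 0 \<partial>p)"
    using p(3) by (intro Bochner_Integration.integral_cong) (auto simp: sp)
  moreover have "(\<integral>x. measure p {x} - measure (null_measure M) {x} \<partial>null_measure M) = (\<integral>x. 0 \<partial>null_measure M)"
    using p(3) by (intro Bochner_Integration.integral_cong) auto
  ultimately show ?thesis using finite_sum_cells_square(1)[OF p(1,2) q] by simp
qed

text \<open>
  Off its atoms the measure has small masses on all cells of a fine level; being integers, they vanish.
\<close>

lemma integer_measure_atomic:
  assumes p: "finite_measure p" "sets p = sets M"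
    and int: "\<And>A. A \<in> sets M \<Longrightarrow> \<exists>k::nat. emeasure p A = of_nat k"
  shows "countable {t. measure p {t} \<noteq> 0}" "emeasure p (space M - {t. measure p {t} \<noteq> 0}) = 0"
proof -
  interpret p: finite_measure p by fact
  let ?T = "{t. measure p {t} \<noteq> 0}"
  show cT: "countable ?T" by (rule p.countable_support)
  have "?T \<subseteq> space M"
  proof
    fix t assume "t \<in> ?T"
    then have "{t} \<in> sets p" using measure_notin_sets[of "{t}" p] by auto
    then have "{t} \<in> sets M" using p(2) by simp
    then show "t \<in> space M" using sets.sets_into_space by blast
  qed
  then have T: "?T \<in> sets M" by (rule countable_sets[OF cT])
  let ?N = "space M - ?T"
  define q where "q = restr p ?N"
  have N: "?N \<in> sets M" using T by simp
  have q: "finite_measure q" "sets q = sets M"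
    using p N unfolding q_def by (auto intro!: finite_restr simp: p.emeasure_finite less_top[symmetric])
  have eq: "emeasure q A = emeasure p (?N \<inter> A)" if "A \<in> sets M" for A
    using that N p(2) by (simp add: q_def emeasure_restr)
  have mq: "measure q {t} = 0" if "t \<in> space M" for t
    using that by (cases "t \<in> ?T") (auto simp: measure_def eq Int_insert_right)
  have "\<forall>\<^sub>F n in sequentially. (\<Sum>k\<le>2 ^ n. (measure q (cells n k))\<^sup>2) < 1"
    by (rule order_tendstoD(2)[OF finite_diffuse_sum_cells_square[OF q mq]]) simp_all
  \<comment> \<open>The threshold is 1 because a nonzero integer mass contributes at least 1 to the
    sum of squares.\<close>
  then obtain n where n: "(\<Sum>k\<le>2 ^ n. (measure q (cells n k))\<^sup>2) < 1"
    by (auto simp: eventually_sequentially)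
  have z: "emeasure q (cells n k) = 0" if k: "k \<le> 2 ^ n" for k
  proof -
    obtain m :: nat where m: "emeasure q (cells n k) = of_nat m"
      using int[OF sets.Int[OF N cells_sets]] unfolding eq[OF cells_sets] by blast
    have "(measure q (cells n k))\<^sup>2 \<le> (\<Sum>k\<le>2 ^ n. (measure q (cells n k))\<^sup>2)"
      using k by (intro member_le_sum) auto
    then have "(real m)\<^sup>2 < 1" using n m by (simp add: measure_def)
    then have "real m < 1" using abs_square_less_1[of "real m"] by simp
    then show ?thesis using m by simp
  qed
  have "emeasure q (space M) = emeasure q (\<Union>k\<in>{..2 ^ n}. cells n k)" by (simp add: UN_cells)
  also have "\<dots> \<le> (\<Sum>k\<le>2 ^ n. emeasure q (cells n k))"
    by (intro emeasure_subadditive_finite) (simp_all add: q(2) image_subset_iff)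
  also have "\<dots> = 0" using z by simp
  finally show "emeasure p (space M - ?T) = 0" using eq[of "space M"] by (simp add: Int_absorb2)
qed

text \<open>The Jordan parts, restricted to \<open>exh m\<close>, agree on the cells, which form an
  intersection-stable generator. The purpose is that countably many equations, indexed by
  \<open>m\<close>, \<open>n\<close> and \<open>k\<close>, decide about uncountably many sets of
  \<open>R\<close>.\<close>

lemma signed_eq_0:
  assumes mu: "countably_additive_on R \<mu>" and z: "\<And>m n k. \<mu> (exh m \<inter> cells n k) = 0"
    and B: "B \<in> R"
  shows "\<mu> B = 0"
proof -
  obtain p q where pq: "loc_finite M R p" "loc_finite M R q" "\<forall>B\<in>R. \<mu> B = measure p B - measure q B"
    using jordan_decomposition[OF mu] by blast
  obtain m where m: "B \<subseteq> exh m" using R_sub_exh[OF B] by blast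
  let ?p = "restr p (exh m)" and ?q = "restr q (exh m)"
  have ex: "exh m \<in> sets M" by (rule R_sets[OF exh_R])
  have s: "sets p = sets M" "sets q = sets M" using pq by (auto simp: loc_finite_def)
  have e: "emeasure p A = ennreal (measure p A)" "emeasure q A = ennreal (measure q A)" if "A \<in> R" for A
    using that pq(1,2) by (auto intro!: emeasure_eq_ennreal_measure simp: loc_finite_def)
  let ?E = "{cells n k | n k. True} \<union> {{}}"
  have "?p = ?q"
  proof (rule measure_eqI_generator_eq_countable[where E = ?E and \<Omega> = "space M" and A = "{cells 0 0, cells 0 1}"])
    show "Int_stable ?E" by (rule Int_stable_cells)
    show "?E \<subseteq> Pow (space M)" using sets.sets_into_space[OF cells_sets] by auto
    show "sets ?p = sigma_sets (space M) ?E" "sets ?q = sigma_sets (space M) ?E"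
      using sets_eq_sigma_cells s by simp_all
    \<comment> \<open>At level 0 the indices are at most 1, so two cells cover the space.\<close>
    have "{..Suc 0} = {0, Suc 0}" by auto
    then show "\<Union>{cells 0 0, cells 0 1} = space M"
      using UN_cells[of 0] by simp
    show "{cells 0 0, cells 0 1} \<subseteq> ?E" by blast
    fix X assume "X \<in> ?E"
    then show "emeasure ?p X = emeasure ?q X"
    proof
      assume "X \<in> {cells n k | n k. True}"
      then obtain n k where X: "X = cells n k" by blast
      have "exh m \<inter> X \<in> R" unfolding X by (intro R_Int) auto
      then show ?thesis using e[of "exh m \<inter> X"] pq(3) z[of m n k] s ex X by (simp add: emeasure_restr)
    qed simp
  next
    fix a assume "a \<in> {cells 0 0, cells 0 1}"
    then have "a \<in> sets M" by auto
    then show "emeasure ?p a \<noteq> \<infinity>"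
      using e[OF R_Int[OF exh_R[of m]]] s ex by (auto simp: emeasure_restr)
  qed simp
  then have "emeasure p (exh m \<inter> B) = emeasure q (exh m \<inter> B)"
    using R_sets[OF B] s ex by (metis emeasure_restr)
  then show ?thesis using m B pq(3) by (simp add: Int_absorb1 measure_def)
qed

end

section \<open>Independent increments and triangular arrays\<close>

text \<open>The sigma-algebra of the increments inside \<open>E\<close>, where \<open>E\<close>
  itself may be unbounded. The value type is left open so that this serves both the real values of
  \<open>\<xi>\<close> and the counts of a point process.\<close>

definition incr_alg ::
    "'w measure \<Rightarrow> 'a set set \<Rightarrow> ('w \<Rightarrow> 'a set \<Rightarrow> 'b::topological_space) \<Rightarrow> 'a set \<Rightarrow> 'w measure" where
  "incr_alg P R \<xi> E =
    sigma (space P) {(\<lambda>\<omega>. \<xi> \<omega> B) -` A \<inter> space P | B A. B \<in> R \<and> B \<subseteq> E \<and> A \<in> sets borel}"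

lemma space_incr_alg [simp]: "space (incr_alg P R \<xi> E) = space P"
  unfolding incr_alg_def by (rule space_measure_of) auto

lemma sets_incr_alg:
  "sets (incr_alg P R \<xi> E) =
    sigma_sets (space P) {(\<lambda>\<omega>. \<xi> \<omega> B) -` A \<inter> space P | B A. B \<in> R \<and> B \<subseteq> E \<and> A \<in> sets borel}"
  unfolding incr_alg_def by (rule sets_measure_of) auto

lemma measurable_incr_alg:
  assumes "B \<in> R" "B \<subseteq> E" shows "(\<lambda>\<omega>. \<xi> \<omega> B) \<in> borel_measurable (incr_alg P R \<xi> E)"
  using assms by (intro measurableI) (auto simp: sets_incr_alg intro!: sigma_sets.Basic)

lemma sets_incr_alg_subset:
  assumes "\<And>B. B \<in> R \<Longrightarrow> (\<lambda>\<omega>. \<xi> \<omega> B) \<in> borel_measurable P"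
  shows "sets (incr_alg P R \<xi> E) \<subseteq> sets P"
  unfolding sets_incr_alg using assms by (intro sets.sigma_sets_subset) (auto intro: measurable_sets)

text \<open>A new set \<open>B\<close> splits every earlier block \<open>A\<close> into
  \<open>A \<inter> B\<close> and \<open>A - B\<close> and adds what no block covers. Blocks are
  kept nonempty so that each of them can lie in only one of several disjoint sets.\<close>

lemma finite_disjoint_refinement:
  assumes R: "ring_of_sets \<Omega> R" and "finite \<B>" "\<B> \<subseteq> R"
  shows "\<exists>\<A>. finite \<A> \<and> \<A> \<subseteq> R \<and> disjoint \<A> \<and> {} \<notin> \<A> \<and> \<Union>\<A> = \<Union>\<B> \<and>
    (\<forall>A\<in>\<A>. \<forall>B\<in>\<B>. A \<subseteq> B \<or> A \<inter> B = {})"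
  using assms(2,3)
proof (induction \<B> rule: finite_induct)
  case empty
  show ?case by (intro exI[of _ "{}"]) auto
next
  case (insert B \<B>)
  then obtain \<A> where \<A>: "finite \<A>" "\<A> \<subseteq> R" "disjoint \<A>" "{} \<notin> \<A>" "\<Union>\<A> = \<Union>\<B>"
    "\<forall>A\<in>\<A>. \<forall>B\<in>\<B>. A \<subseteq> B \<or> A \<inter> B = {}"
    by auto
  interpret ring_of_sets \<Omega> R by fact
  have UR: "\<Union>\<A> \<in> R" using \<A> by (intro finite_Union) auto
  define \<C> where "\<C> = ((\<lambda>A. A \<inter> B) ` \<A> \<union> (\<lambda>A. A - B) ` \<A> \<union> {B - \<Union>\<A>}) - {{}}"
  have "finite \<C>" "{} \<notin> \<C>" unfolding \<C>_def using \<A>(1) by auto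
  moreover have "\<C> \<subseteq> R" unfolding \<C>_def using \<A>(2) insert.prems UR by auto
  moreover have "disjoint \<C>"
  proof -
    have d: "A \<inter> A' = {}" if "A \<in> \<A>" "A' \<in> \<A>" "A \<noteq> A'" for A A'
      using \<A>(3) that by (auto simp: disjoint_def)
    show ?thesis
    proof (rule disjointI)
      fix X Y assume X: "X \<in> \<C>" and Y: "Y \<in> \<C>" and ne: "X \<noteq> Y"
      have c: "(\<exists>A\<in>\<A>. Z = A \<inter> B \<or> Z = A - B) \<or> Z = B - \<Union>\<A>" if "Z \<in> \<C>" for Z
        using that unfolding \<C>_def by auto
      have *: "X \<inter> Y = {}" if "A \<in> \<A>" "A' \<in> \<A>" "X = A \<inter> B \<or> X = A - B" "Y = A' \<inter> B \<or> Y = A' - B" for A A'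
        using d[OF that(1,2)] that(3,4) ne by (cases "A = A'") auto
      have **: "X \<inter> Y = {}" if "A \<in> \<A>" "X = A \<inter> B \<or> X = A - B" "Y = B - \<Union>\<A>" for X Y A
        using that by auto
      from c[OF X] show "X \<inter> Y = {}"
      proof
        assume "\<exists>A\<in>\<A>. X = A \<inter> B \<or> X = A - B"
        then obtain A where A: "A \<in> \<A>" "X = A \<inter> B \<or> X = A - B" by blast
        from c[OF Y] show ?thesis
        proof
          assume "\<exists>A\<in>\<A>. Y = A \<inter> B \<or> Y = A - B"
          then obtain A' where "A' \<in> \<A>" "Y = A' \<inter> B \<or> Y = A' - B" by blast
          then show ?thesis using A by (intro *[of A A'])
        qed (rule **[OF A])
      next
        assume X': "X = B - \<Union>\<A>"
        from c[OF Y] ne X' obtain A' where "A' \<in> \<A>" "Y = A' \<inter> B \<or> Y = A' - B" by blast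
        from **[OF this X'] show ?thesis by (simp add: Int_commute)
      qed
    qed
  qed
  moreover have "\<Union>\<C> = \<Union>(insert B \<B>)"
  proof -
    have "\<Union>\<C> = \<Union>((\<lambda>A. A \<inter> B) ` \<A> \<union> (\<lambda>A. A - B) ` \<A> \<union> {B - \<Union>\<A>})"
      unfolding \<C>_def by auto
    also have "\<dots> = B \<union> \<Union>\<A>" by auto
    finally show ?thesis using \<A>(5) by auto
  qed
  moreover have "\<forall>A\<in>\<C>. \<forall>B'\<in>insert B \<B>. A \<subseteq> B' \<or> A \<inter> B' = {}"
  proof (intro ballI)
    fix X B' assume X: "X \<in> \<C>" and B': "B' \<in> insert B \<B>"
    from X consider A where "A \<in> \<A>" "X = A \<inter> B \<or> X = A - B" | "X = B - \<Union>\<A>"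
      unfolding \<C>_def by auto
    then show "X \<subseteq> B' \<or> X \<inter> B' = {}"
    proof cases
      case (1 A)
      then show ?thesis using \<A>(6) B' by (cases "B' = B") blast+
    next
      case 2
      then show ?thesis using \<A>(5) B' by (cases "B' = B") blast+
    qed
  qed
  ultimately show ?case by blast
qed

context prob_space
begin

text \<open>
  Finitely many increments are sums over a common refinement into disjoint sets, to which
  the hypothesis applies.
\<close>

lemma indep_sets_incr_alg:
  fixes \<xi> :: "'a \<Rightarrow> 's set \<Rightarrow> 'b::{second_countable_topology, topological_comm_monoid_add}"
  assumes R: "ring_of_sets \<Omega> R" and ind: "indep_increments M R \<xi>"
    and zero: "\<And>\<omega>. \<omega> \<in> space M \<Longrightarrow> \<xi> \<omega> {} = 0"
    and add: "\<And>\<omega> A B. \<omega> \<in> space M \<Longrightarrow> A \<in> R \<Longrightarrow> B \<in> R \<Longrightarrow> A \<inter> B = {} \<Longrightarrow> \<xi> \<omega> (A \<union> B) = \<xi> \<omega> A + \<xi> \<omega> B"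
    and E: "disjoint_family_on E I"
  shows "indep_sets (\<lambda>i. sets (incr_alg M R \<xi> (E i))) I"
proof -
  interpret ring_of_sets \<Omega> R by fact
  have meas: "(\<lambda>\<omega>. \<xi> \<omega> B) \<in> borel_measurable M" if "B \<in> R" for B
  proof -
    have "indep_vars (\<lambda>_. borel) (\<lambda>i \<omega>. \<xi> \<omega> B) {..<1::nat}"
      using ind[unfolded indep_increments_def, rule_format, of 1 "\<lambda>_. B"] that
      by (simp add: disjoint_family_on_def)
    then show ?thesis by (auto simp: indep_vars_def2)
  qed
  have fadd: "\<xi> \<omega> (\<Union>i\<in>K. h i) = (\<Sum>i\<in>K. \<xi> \<omega> (h i))"
    if "finite K" "disjoint_family_on h K" "\<And>i. i \<in> K \<Longrightarrow> h i \<in> R" "\<omega> \<in> space M" for h :: "nat \<Rightarrow> 's set" and K \<omega>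
    using that(1-3)
  proof (induction K rule: finite_induct)
    case (insert i K)
    have "h i \<inter> (\<Union>i\<in>K. h i) = {}" using insert by (auto simp: disjoint_family_on_def)
    moreover have "(\<Union>i\<in>K. h i) \<in> R" using insert by (intro finite_UN) auto
    ultimately have "\<xi> \<omega> (h i \<union> (\<Union>i\<in>K. h i)) = \<xi> \<omega> (h i) + \<xi> \<omega> (\<Union>i\<in>K. h i)"
      using insert that(4) by (intro add) auto
    moreover have "disjoint_family_on h K" using insert by (auto simp: disjoint_family_on_def)
    ultimately show ?case using insert by simp
  qed (simp add: zero that)
  \<comment> \<open>Cylinder events: finitely many conditions on increments inside
    \<open>E i\<close>. They generate the sigma-algebra of these increments and are stable under
    intersection.\<close>
  define G where "G i = {{\<omega>\<in>space M. \<forall>B\<in>\<B>. \<xi> \<omega> B \<in> C B} | \<B> C. finite \<B> \<and> \<B> \<subseteq> R \<and> (\<forall>B\<in>\<B>. B \<subseteq> E i) \<and> (\<forall>B\<in>\<B>. C B \<in> sets borel)}" for i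
  have G: "indep_sets G I"
    unfolding indep_sets_def
  proof (intro conjI ballI allI impI)
    show "G i \<subseteq> events" for i
    proof
      fix X assume "X \<in> G i"
      then obtain \<B> C where X: "X = {\<omega>\<in>space M. \<forall>B\<in>\<B>. \<xi> \<omega> B \<in> C B}" "finite \<B>" "\<B> \<subseteq> R" "\<forall>B\<in>\<B>. C B \<in> sets borel"
        unfolding G_def by blast
      show "X \<in> events" unfolding X(1)
      proof (intro sets.sets_Collect_finite_All X(2))
        fix B assume B: "B \<in> \<B>"
        then have "(\<lambda>\<omega>. \<xi> \<omega> B) -` C B \<inter> space M \<in> events"
          using X(3,4) by (intro measurable_sets[OF meas]) auto
        then show "{\<omega> \<in> space M. \<xi> \<omega> B \<in> C B} \<in> events"
          by (simp add: vimage_def Int_def conj_commute)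
      qed
    qed
  next
    fix J A assume J: "J \<subseteq> I" "J \<noteq> {}" "finite J" and A: "A \<in> Pi J G"
    define Q where "Q j \<B> C \<longleftrightarrow> A j = {\<omega>\<in>space M. \<forall>B\<in>\<B>. \<xi> \<omega> B \<in> C B} \<and> finite \<B> \<and> \<B> \<subseteq> R \<and>
      (\<forall>B\<in>\<B>. B \<subseteq> E j) \<and> (\<forall>B\<in>\<B>. C B \<in> sets borel)" for j \<B> C
    have "\<exists>\<B> C. Q j \<B> C" if "j \<in> J" for j
    proof -
      have "A j \<in> G j" using A that by auto
      then show ?thesis unfolding G_def Q_def by blast
    qed
    then obtain \<B> C where Q: "\<And>j. j \<in> J \<Longrightarrow> Q j (\<B> j) (C j)" by metis
    have BC: "A j = {\<omega>\<in>space M. \<forall>B\<in>\<B> j. \<xi> \<omega> B \<in> C j B}"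
      "finite (\<B> j)" "\<B> j \<subseteq> R" "\<forall>B\<in>\<B> j. B \<subseteq> E j" "\<forall>B\<in>\<B> j. C j B \<in> sets borel"
      if "j \<in> J" for j
      using Q[OF that, unfolded Q_def] by - (elim conjE, assumption)+
    define Q' where "Q' j \<A> \<longleftrightarrow> finite \<A> \<and> \<A> \<subseteq> R \<and> disjoint \<A> \<and> {} \<notin> \<A> \<and> \<Union>\<A> = \<Union>(\<B> j) \<and>
      (\<forall>A\<in>\<A>. \<forall>B\<in>\<B> j. A \<subseteq> B \<or> A \<inter> B = {})" for j \<A>
    have "\<exists>\<A>. Q' j \<A>" if "j \<in> J" for j
      unfolding Q'_def by (rule finite_disjoint_refinement[OF R BC(2,3)[OF that]])
    then obtain \<A> where Q': "\<And>j. j \<in> J \<Longrightarrow> Q' j (\<A> j)" by metis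
    have \<A>: "finite (\<A> j)" "\<A> j \<subseteq> R" "disjoint (\<A> j)" "{} \<notin> \<A> j" "\<Union>(\<A> j) = \<Union>(\<B> j)"
      "\<forall>A\<in>\<A> j. \<forall>B\<in>\<B> j. A \<subseteq> B \<or> A \<inter> B = {}" if "j \<in> J" for j
      using Q'[OF that, unfolded Q'_def] by - (elim conjE, assumption)+
    have AE: "X \<subseteq> E j" if "j \<in> J" "X \<in> \<A> j" for j X
      using that \<A>(5)[OF that(1)] BC(4)[OF that(1)] by blast
    have dE: "E i \<inter> E j = {}" if "i \<in> J" "j \<in> J" "i \<noteq> j" for i j
      using E J(1) that by (auto simp: disjoint_family_on_def)
    define T where "T = (\<Union>j\<in>J. \<A> j)"
    have dT: "X \<inter> Y = {}" if "X \<in> T" "Y \<in> T" "X \<noteq> Y" for X Y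
    proof -
      obtain i j where ij: "i \<in> J" "X \<in> \<A> i" "j \<in> J" "Y \<in> \<A> j" using \<open>X \<in> T\<close> \<open>Y \<in> T\<close> by (auto simp: T_def)
      show ?thesis
      proof (cases "i = j")
        case True
        then show ?thesis using \<A>(3)[OF ij(1)] ij that(3) by (auto simp: disjoint_def)
      next
        case False
        then show ?thesis using AE[OF ij(1,2)] AE[OF ij(3,4)] dE[OF ij(1,3)] by blast
      qed
    qed
    have fT: "finite T" using J \<A>(1) by (auto simp: T_def)
    obtain h where h: "bij_betw h {..<card T} T"
      using ex_bij_betw_nat_finite[OF fT] by (auto simp: atLeast0LessThan)
    let ?n = "card T"
    have hT: "h i \<in> T" if "i < ?n" for i using h that by (auto simp: bij_betw_def)
    have hd: "disjoint_family_on h {..<?n}"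
      unfolding disjoint_family_on_def
    proof (intro ballI impI)
      fix m n assume mn: "m \<in> {..<?n}" "n \<in> {..<?n}" "m \<noteq> n"
      then have "h m \<noteq> h n" using h by (auto simp: bij_betw_def inj_on_def)
      then show "h m \<inter> h n = {}" using mn hT by (intro dT) auto
    qed
    have TR: "T \<subseteq> R" using \<A>(2) by (auto simp: T_def)
    have iv: "indep_vars (\<lambda>_. borel) (\<lambda>i \<omega>. \<xi> \<omega> (h i)) {..<?n}"
      using ind hd hT TR by (auto simp: indep_increments_def)
    \<comment> \<open>Each block is nonempty and lies in a single \<open>E j\<close>, so different
      \<open>j\<close> use disjoint sets of block indices.\<close>
    define K where "K j = {i. i < ?n \<and> h i \<in> \<A> j}" for j
    have "disjoint_family_on K J"
      unfolding disjoint_family_on_def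
    proof (intro ballI impI)
      fix i j assume ij: "i \<in> J" "j \<in> J" "i \<noteq> j"
      { fix m assume "h m \<in> \<A> i" "h m \<in> \<A> j"
        then have "h m = {}" using AE[OF ij(1)] AE[OF ij(2)] dE[OF ij] by blast
        then have False using \<A>(4)[OF ij(1)] \<open>h m \<in> \<A> i\<close> by auto }
      then show "K i \<inter> K j = {}" by (auto simp: K_def)
    qed
    then have iv2: "indep_vars (\<lambda>j. PiM (K j) (\<lambda>_. borel)) (\<lambda>j \<omega>. restrict (\<lambda>i. \<xi> \<omega> (h i)) (K j)) J"
      by (intro indep_vars_restrict[OF iv]; (assumption | force simp: K_def))
    \<comment> \<open>The event \<open>A j\<close> in terms of the block values:
      \<open>\<xi> \<omega> B\<close> is the sum over the blocks contained in
      \<open>B\<close>.\<close>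
    define S where "S j = {f \<in> space (PiM (K j) (\<lambda>_. borel)). \<forall>B\<in>\<B> j. (\<Sum>i\<in>{i\<in>K j. h i \<subseteq> B}. f i) \<in> C j B}" for j
    have S: "S j \<in> sets (PiM (K j) (\<lambda>_. borel))" if j: "j \<in> J" for j
    proof -
      have "{f \<in> space (PiM (K j) (\<lambda>_. borel)). (\<Sum>i\<in>{i\<in>K j. h i \<subseteq> B}. f i) \<in> C j B} \<in> sets (PiM (K j) (\<lambda>_. borel))"
        if "B \<in> \<B> j" for B
      proof -
        have "(\<lambda>f. \<Sum>i\<in>{i\<in>K j. h i \<subseteq> B}. f i) \<in> borel_measurable (PiM (K j) (\<lambda>_. borel :: 'b measure))"
          by (intro borel_measurable_sum measurable_component_singleton) auto
        from measurable_sets[OF this bspec[OF BC(5)[OF j] that]] show ?thesis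
          by (simp add: vimage_def Int_def conj_commute)
      qed
      then show ?thesis unfolding S_def using BC(2)[OF j]
        by (intro sets.sets_Collect_finite_All) auto
    qed
    have AS: "A j = (\<lambda>\<omega>. restrict (\<lambda>i. \<xi> \<omega> (h i)) (K j)) -` S j \<inter> space M" if j: "j \<in> J" for j
    proof -
      have "\<xi> \<omega> B = (\<Sum>i\<in>{i\<in>K j. h i \<subseteq> B}. restrict (\<lambda>i. \<xi> \<omega> (h i)) (K j) i)"
        if "\<omega> \<in> space M" "B \<in> \<B> j" for \<omega> B
      proof -
        have "B = \<Union>{X \<in> \<A> j. X \<subseteq> B}"
        proof
          show "B \<subseteq> \<Union>{X \<in> \<A> j. X \<subseteq> B}"
          proof
            fix x assume x: "x \<in> B"
            then have "x \<in> \<Union>(\<A> j)" using \<A>(5)[OF j] that by auto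
            then obtain X where X: "X \<in> \<A> j" "x \<in> X" by auto
            then have "X \<subseteq> B" using bspec[OF bspec[OF \<A>(6)[OF j] X(1)] that(2)] x by auto
            then show "x \<in> \<Union>{X \<in> \<A> j. X \<subseteq> B}" using X by auto
          qed
        qed auto
        also have "{X \<in> \<A> j. X \<subseteq> B} = h ` {i\<in>K j. h i \<subseteq> B}"
        proof -
          have "\<A> j \<subseteq> h ` {..<?n}" using j h by (auto simp: T_def bij_betw_def)
          then show ?thesis by (auto simp: K_def)
        qed
        finally have B: "B = (\<Union>i\<in>{i\<in>K j. h i \<subseteq> B}. h i)" .
        have "\<xi> \<omega> (\<Union>i\<in>{i\<in>K j. h i \<subseteq> B}. h i) = (\<Sum>i\<in>{i\<in>K j. h i \<subseteq> B}. \<xi> \<omega> (h i))"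
          using hd hT TR that(1) by (intro fadd) (auto simp: K_def disjoint_family_on_def)
        then show ?thesis using B by simp
      qed
      moreover have "restrict (\<lambda>i. \<xi> \<omega> (h i)) (K j) \<in> space (PiM (K j) (\<lambda>_. borel))" for \<omega>
        by (auto simp: space_PiM)
      ultimately show ?thesis unfolding BC(1)[OF j] S_def by auto
    qed
    have "prob (\<Inter>j\<in>J. (\<lambda>\<omega>. restrict (\<lambda>i. \<xi> \<omega> (h i)) (K j)) -` S j \<inter> space M)
        = (\<Prod>j\<in>J. prob ((\<lambda>\<omega>. restrict (\<lambda>i. \<xi> \<omega> (h i)) (K j)) -` S j \<inter> space M))"
      using J S by (intro indep_varsD_finite[OF iv2]) auto
    then show "prob (\<Inter>j\<in>J. A j) = (\<Prod>j\<in>J. prob (A j))"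
      using AS by simp
  qed
  have "Int_stable (G i)" for i
    unfolding Int_stable_def
  proof (intro ballI)
    fix X Y assume "X \<in> G i" "Y \<in> G i"
    then obtain \<B> C \<B>' C' where X: "X = {\<omega>\<in>space M. \<forall>B\<in>\<B>. \<xi> \<omega> B \<in> C B}" "finite \<B>" "\<B> \<subseteq> R" "\<forall>B\<in>\<B>. B \<subseteq> E i" "\<forall>B\<in>\<B>. C B \<in> sets borel"
      and Y: "Y = {\<omega>\<in>space M. \<forall>B\<in>\<B>'. \<xi> \<omega> B \<in> C' B}" "finite \<B>'" "\<B>' \<subseteq> R" "\<forall>B\<in>\<B>'. B \<subseteq> E i" "\<forall>B\<in>\<B>'. C' B \<in> sets borel"
      unfolding G_def by blast
    \<comment> \<open>\<open>UNIV\<close> stands for the absence of a condition on a set that occurs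
      in only one of the two families.\<close>
    define D where "D B = (if B \<in> \<B> then C B else UNIV) \<inter> (if B \<in> \<B>' then C' B else UNIV)" for B
    have "X \<inter> Y = {\<omega>\<in>space M. \<forall>B\<in>\<B> \<union> \<B>'. \<xi> \<omega> B \<in> D B}"
      unfolding X(1) Y(1) D_def by auto
    moreover have "\<forall>B\<in>\<B> \<union> \<B>'. D B \<in> sets borel" using X(5) Y(5) by (auto simp: D_def)
    ultimately show "X \<inter> Y \<in> G i" unfolding G_def using X(2-4) Y(2-4)
      by (intro CollectI exI[of _ "\<B> \<union> \<B>'"] exI[of _ D]) auto
  qed
  from indep_sets_sigma[OF G this] show ?thesis
  proof (rule indep_sets_mono_sets)
    fix i assume "i \<in> I"
    show "sets (incr_alg M R \<xi> (E i)) \<subseteq> sigma_sets (space M) (G i)"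
      unfolding sets_incr_alg
    proof (rule sigma_sets_subseteq)
      show "{(\<lambda>\<omega>. \<xi> \<omega> B) -` A \<inter> space M | B A. B \<in> R \<and> B \<subseteq> E i \<and> A \<in> sets borel} \<subseteq> G i"
      proof safe
        fix B and A :: "'b set" assume "B \<in> R" "B \<subseteq> E i" "A \<in> sets borel"
        then show "(\<lambda>\<omega>. \<xi> \<omega> B) -` A \<inter> space M \<in> G i"
          unfolding G_def by (intro CollectI exI[of _ "{B}"] exI[of _ "\<lambda>_. A"]) auto
      qed
    qed
  qed
qed

text \<open>The form in which independence is applied: \<open>f i\<close> may be any functional of
  the increments inside \<open>E i\<close>, for instance a count of jumps.\<close>

lemma indep_vars_incr_alg:
  assumes ind: "indep_sets (\<lambda>i. sets (incr_alg M R \<xi> (E i))) I"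
    and f: "\<And>i. i \<in> I \<Longrightarrow> f i \<in> incr_alg M R \<xi> (E i) \<rightarrow>\<^sub>M N i"
  shows "indep_vars N f I"
  unfolding indep_vars_def2
proof (intro conjI ballI)
  have sub: "sets (incr_alg M R \<xi> (E i)) \<subseteq> events" if "i \<in> I" for i
    using ind that by (simp add: indep_sets_def)
  show "random_variable (N i) (f i)" if "i \<in> I" for i
    using measurable_space[OF f[OF that]] measurable_sets[OF f[OF that]] sub[OF that]
    by (intro measurableI) auto
  show "indep_sets (\<lambda>i. {f i -` A \<inter> space M |A. A \<in> sets (N i)}) I"
    using measurable_sets[OF f] by (intro indep_sets_mono_sets[OF ind]) auto
qed

end

section \<open>Truncated row sums of triangular arrays\<close>

text \<open>As \<open>1 + m \<le> exp m\<close>, it suffices that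
  \<open>1 \<le> (1 - m / 2) * (1 + m)\<close>; this is where \<open>m \<le> 1\<close> and the
  factor 1/2 enter.\<close>

lemma exp_minus_le: fixes m :: real assumes "0 \<le> m" "m \<le> 1" shows "exp (- m) \<le> 1 - m / 2"
proof -
  have "1 + m \<le> exp m" by (rule exp_ge_add_one_self)
  moreover have "1 \<le> (1 - m / 2) * (1 + m)"
  proof -
    have "m * m \<le> m * 1" using assms by (intro mult_left_mono) auto
    then show ?thesis by (simp add: algebra_simps)
  qed
  moreover have "(1 - m / 2) * (1 + m) \<le> (1 - m / 2) * exp m"
    using assms by (intro mult_left_mono exp_ge_add_one_self) auto
  ultimately have "1 \<le> (1 - m / 2) * exp m" by linarith
  then show ?thesis by (simp add: exp_minus field_simps)
qed

context prob_space
begin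

lemma indep_vars_prod_expectation:
  fixes X :: "'i \<Rightarrow> 'a \<Rightarrow> real" and f :: "real \<Rightarrow> real"
  assumes "finite I" "indep_vars (\<lambda>_. borel) X I" and f: "f \<in> borel_measurable borel" "\<And>x. \<bar>f x\<bar> \<le> C"
  shows "expectation (\<lambda>\<omega>. \<Prod>i\<in>I. f (X i \<omega>)) = (\<Prod>i\<in>I. expectation (\<lambda>\<omega>. f (X i \<omega>)))"
proof (rule indep_vars_lebesgue_integral[where X = "\<lambda>i \<omega>. f (X i \<omega>)", OF assms(1)])
  show iv: "indep_vars (\<lambda>_. borel) (\<lambda>i \<omega>. f (X i \<omega>)) I"
    using indep_vars_compose2[OF assms(2), of "\<lambda>_. f" "\<lambda>_. borel"] f(1) by simp
  show "integrable M (\<lambda>\<omega>. f (X i \<omega>))" if "i \<in> I" for i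
    using iv that f(2) by (intro integrable_const_bound[where B = C]) (auto simp: indep_vars_def2)
qed

text \<open>
  With \<open>V\<close> the supremum of the truncated row sums, \<open>E exp (- V) > 0\<close>, while independence bounds it by
  \<open>exp (- 1/2 * \<Sum>k. E (min 1 \<bar>Y n k\<bar>))\<close>.
\<close>

lemma row_sums_bound:
  fixes Y :: "nat \<Rightarrow> nat \<Rightarrow> 'a \<Rightarrow> real"
  assumes fin: "\<And>n. finite (K n)" and ind: "\<And>n. indep_vars (\<lambda>_. borel) (Y n) (K n)"
    and bdd: "\<And>\<omega>. \<omega> \<in> space M \<Longrightarrow> \<exists>v. \<forall>n. (\<Sum>k\<in>K n. \<bar>Y n k \<omega>\<bar>) \<le> v"
  shows "\<exists>C. \<forall>n. (\<Sum>k\<in>K n. expectation (\<lambda>\<omega>. min 1 \<bar>Y n k \<omega>\<bar>)) \<le> C"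
proof -
  define m where "m n k \<omega> = min 1 \<bar>Y n k \<omega>\<bar>" for n k \<omega>
  define W where "W n \<omega> = (\<Sum>k\<in>K n. m n k \<omega>)" for n \<omega>
  define V where "V \<omega> = (SUP n. W n \<omega>)" for \<omega>
  have m01: "0 \<le> m n k \<omega>" "m n k \<omega> \<le> 1" for n k \<omega> by (auto simp: m_def)
  have Ym: "Y n k \<in> borel_measurable M" if "k \<in> K n" for n k
    using ind[of n] that by (auto simp: indep_vars_def2)
  have mm: "m n k \<in> borel_measurable M" if "k \<in> K n" for n k
    using Ym[OF that] unfolding m_def by measurable
  have Wm [measurable]: "W n \<in> borel_measurable M" for n
    unfolding W_def using mm by (intro borel_measurable_sum) auto
  have bddW: "bdd_above (range (\<lambda>n. W n \<omega>))" if "\<omega> \<in> space M" for \<omega>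
  proof -
    obtain v where v: "\<And>n. (\<Sum>k\<in>K n. \<bar>Y n k \<omega>\<bar>) \<le> v" using bdd[OF \<open>\<omega> \<in> space M\<close>] by blast
    have "W n \<omega> \<le> (\<Sum>k\<in>K n. \<bar>Y n k \<omega>\<bar>)" for n unfolding W_def m_def by (intro sum_mono) auto
    then have "W n \<omega> \<le> v" for n using v[of n] by (rule order_trans)
    then show ?thesis by (intro bdd_aboveI[of _ v]) auto
  qed
  have Vm [measurable]: "V \<in> borel_measurable M"
    unfolding V_def using bddW by (intro borel_measurable_cSUP) auto
  have WV: "W n \<omega> \<le> V \<omega>" if "\<omega> \<in> space M" for n \<omega>
    unfolding V_def using bddW[OF that] by (intro cSUP_upper) auto
  have W0: "0 \<le> W n \<omega>" for n \<omega> unfolding W_def m_def by (intro sum_nonneg) auto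
  have V0: "0 \<le> V \<omega>" if "\<omega> \<in> space M" for \<omega> using WV[OF that, of 0] W0[of 0 \<omega>] by simp
  define \<delta> where "\<delta> = expectation (\<lambda>\<omega>. exp (- V \<omega>))"
  have intV: "integrable M (\<lambda>\<omega>. exp (- V \<omega>))"
    using V0 by (intro integrable_const_bound[where B = 1]) auto
  \<comment> \<open>\<open>exp (- V \<omega>)\<close> is positive at every point, so its integral
    cannot be 0.\<close>
  have "\<delta> \<noteq> 0"
  proof
    assume "\<delta> = 0"
    then have "AE \<omega> in M. exp (- V \<omega>) = 0"
      unfolding \<delta>_def by (subst (asm) integral_nonneg_eq_0_iff_AE[OF intV]) auto
    then have "AE \<omega> in M. False" by simp
    then show False by simp
  qed
  moreover have "\<delta> \<ge> 0" unfolding \<delta>_def by (rule Bochner_Integration.integral_nonneg) simp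
  ultimately have \<delta>: "\<delta> > 0" by simp
  \<comment> \<open>The constant results from solving \<open>\<delta> \<le> exp (- (S / 2))\<close>
    for the sum \<open>S\<close> of the truncated means.\<close>
  have "(\<Sum>k\<in>K n. expectation (m n k)) \<le> - 2 * ln \<delta>" for n
  proof -
    have intm: "integrable M (m n k)" if "k \<in> K n" for k
      using mm[OF that] by (intro integrable_const_bound[where B = 1]) (auto simp: m_def)
    have inte: "integrable M (\<lambda>\<omega>. exp (- m n k \<omega>))" if "k \<in> K n" for k
    proof (rule integrable_const_bound[where B = 1])
      show "(\<lambda>\<omega>. exp (- m n k \<omega>)) \<in> borel_measurable M" using mm[OF that] by measurable
    qed (simp add: m_def)
    have "\<delta> \<le> expectation (\<lambda>\<omega>. exp (- W n \<omega>))"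
      unfolding \<delta>_def using WV W0
      by (intro integral_mono intV integrable_const_bound[where B = 1]) auto
    also have "\<dots> = expectation (\<lambda>\<omega>. \<Prod>k\<in>K n. exp (- min 1 \<bar>Y n k \<omega>\<bar>))"
      unfolding W_def m_def by (simp add: exp_sum[OF fin] sum_negf[symmetric])
    also have "\<dots> = (\<Prod>k\<in>K n. expectation (\<lambda>\<omega>. exp (- m n k \<omega>)))"
      unfolding m_def
      by (rule indep_vars_prod_expectation[OF fin ind, of "\<lambda>x. exp (- min 1 \<bar>x\<bar>)" 1]) auto
    also have "\<dots> \<le> (\<Prod>k\<in>K n. exp (- (expectation (m n k) / 2)))"
    proof (intro prod_mono conjI)
      fix k assume k: "k \<in> K n"
      show "0 \<le> expectation (\<lambda>\<omega>. exp (- m n k \<omega>))"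
        by (rule Bochner_Integration.integral_nonneg) simp
      have "expectation (\<lambda>\<omega>. exp (- m n k \<omega>)) \<le> expectation (\<lambda>\<omega>. 1 - m n k \<omega> / 2)"
        using intm[OF k] inte[OF k] exp_minus_le[of "m n k \<omega>" for \<omega>]
        by (intro integral_mono) (auto simp: m01)
      also have "\<dots> = 1 - expectation (m n k) / 2"
        using intm[OF k] by (simp add: prob_space)
      also have "\<dots> \<le> exp (- (expectation (m n k) / 2))"
        using exp_ge_add_one_self[of "- (expectation (m n k) / 2)"] by simp
      finally show "expectation (\<lambda>\<omega>. exp (- m n k \<omega>)) \<le> exp (- (expectation (m n k) / 2))" .
    qed
    also have "\<dots> = exp (- ((\<Sum>k\<in>K n. expectation (m n k)) / 2))"
      by (simp add: exp_sum[OF fin, symmetric] sum_negf sum_divide_distrib)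
    finally have "ln \<delta> \<le> - ((\<Sum>k\<in>K n. expectation (m n k)) / 2)"
      using \<delta> by (metis ln_exp ln_le_cancel_iff exp_gt_zero)
    then show ?thesis by simp
  qed
  then show ?thesis unfolding m_def by blast
qed

text \<open>Centred independent variables are uncorrelated, so the mixed terms vanish one index at a
  time; the uniform bound supplies the integrability.\<close>

lemma indep_vars_square_sum:
  fixes X :: "'i \<Rightarrow> 'a \<Rightarrow> real"
  assumes "finite I" "indep_vars (\<lambda>_. borel) X I" "\<And>i \<omega>. i \<in> I \<Longrightarrow> \<bar>X i \<omega>\<bar> \<le> C"
    and "\<And>i. i \<in> I \<Longrightarrow> expectation (X i) = 0"
  shows "expectation (\<lambda>\<omega>. (\<Sum>i\<in>I. X i \<omega>)\<^sup>2) = (\<Sum>i\<in>I. expectation (\<lambda>\<omega>. (X i \<omega>)\<^sup>2))"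
  using assms
proof (induction I rule: finite_induct)
  case (insert i I)
  have m: "X j \<in> borel_measurable M" if "j \<in> insert i I" for j
    using insert.prems(1) that by (auto simp: indep_vars_def2)
  define S where "S \<omega> = (\<Sum>j\<in>I. X j \<omega>)" for \<omega>
  have Sm: "S \<in> borel_measurable M" unfolding S_def using m by (intro borel_measurable_sum) auto
  have Sb: "\<bar>S \<omega>\<bar> \<le> real (card I) * C" for \<omega>
  proof -
    have "\<bar>S \<omega>\<bar> \<le> (\<Sum>j\<in>I. \<bar>X j \<omega>\<bar>)" unfolding S_def by (rule sum_abs)
    also have "\<dots> \<le> (\<Sum>j\<in>I. C)" using insert.prems(2) by (intro sum_mono) auto
    finally show ?thesis by simp
  qed
  have Xb: "\<bar>X i \<omega>\<bar> \<le> C" for \<omega> using insert.prems(2) by auto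
  \<comment> \<open>The bound is assumed for all arguments, so any one of them shows that
    \<open>C\<close> is nonnegative.\<close>
  have C0: "0 \<le> C" using Xb[of undefined] abs_ge_zero[of "X i undefined"] by linarith
  have iX: "integrable M (X i)" using m Xb by (intro integrable_const_bound[where B = C]) auto
  have iS: "integrable M S" using Sm Sb by (intro integrable_const_bound) auto
  have iX2: "integrable M (\<lambda>\<omega>. (X i \<omega>)\<^sup>2)"
    using m Xb C0 by (intro integrable_const_bound[where B = "C\<^sup>2"]) (auto simp: abs_le_square_iff[symmetric])
  have iS2: "integrable M (\<lambda>\<omega>. (S \<omega>)\<^sup>2)"
    using Sm Sb C0 by (intro integrable_const_bound[where B = "(real (card I) * C)\<^sup>2"])
      (auto simp: abs_le_square_iff[symmetric] abs_mult)
  have iv: "indep_var borel (X i) borel S"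
    unfolding S_def using insert by (intro indep_vars_sum) auto
  have z: "expectation (\<lambda>\<omega>. X i \<omega> * S \<omega>) = 0" and iXS: "integrable M (\<lambda>\<omega>. X i \<omega> * S \<omega>)"
    using indep_var_lebesgue_integral[OF iv iX iS] indep_var_integrable[OF iv iX iS] insert.prems(3) by auto
  have "expectation (\<lambda>\<omega>. (\<Sum>j\<in>insert i I. X j \<omega>)\<^sup>2)
      = expectation (\<lambda>\<omega>. (X i \<omega>)\<^sup>2 + 2 * (X i \<omega> * S \<omega>) + (S \<omega>)\<^sup>2)"
    using insert(1,2) by (simp add: S_def power2_sum algebra_simps)
  also have "\<dots> = expectation (\<lambda>\<omega>. (X i \<omega>)\<^sup>2) + expectation (\<lambda>\<omega>. (S \<omega>)\<^sup>2)"
    using iX2 iS2 iXS z by simp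
  also have "expectation (\<lambda>\<omega>. (S \<omega>)\<^sup>2) = (\<Sum>i\<in>I. expectation (\<lambda>\<omega>. (X i \<omega>)\<^sup>2))"
    unfolding S_def using insert.prems indep_vars_subset[OF insert.prems(1)] by (intro insert.IH) auto
  finally show ?case using insert(1,2) by simp
qed simp

text \<open>
  Truncation at \<open>\<epsilon>\<close> does not change the row sums eventually and makes their variance at most
  \<open>\<epsilon> * C\<close>; by Fatou's lemma \<open>Z\<close> then agrees with an independent copy of itself.
\<close>

lemma small_row_sums_const:
  fixes Y :: "nat \<Rightarrow> nat \<Rightarrow> 'a \<Rightarrow> real"
  assumes fin: "\<And>n. finite (K n)" and ind: "\<And>n. indep_vars (\<lambda>_. borel) (Y n) (K n)"
    and bdd: "\<And>\<omega>. \<omega> \<in> space M \<Longrightarrow> \<exists>v. \<forall>n. (\<Sum>k\<in>K n. \<bar>Y n k \<omega>\<bar>) \<le> v"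
    and sum: "\<And>n \<omega>. \<omega> \<in> space M \<Longrightarrow> (\<Sum>k\<in>K n. Y n k \<omega>) = Z \<omega>"
    and small: "\<And>\<omega>. \<omega> \<in> space M \<Longrightarrow> (\<lambda>n. \<Sum>k\<in>K n. (Y n k \<omega>)\<^sup>2) \<longlonglongrightarrow> 0"
  shows "\<exists>c. AE \<omega> in M. Z \<omega> = c"
proof -
  obtain C where C: "\<And>n. (\<Sum>k\<in>K n. expectation (\<lambda>\<omega>. min 1 \<bar>Y n k \<omega>\<bar>)) \<le> C"
    using row_sums_bound[OF fin ind bdd] by blast
  have Ym: "Y n k \<in> borel_measurable M" if "k \<in> K n" for n k
    using ind[of n] that by (auto simp: indep_vars_def2)
  have Zm [measurable]: "Z \<in> borel_measurable M"
  proof (subst measurable_cong[of M _ "\<lambda>\<omega>. \<Sum>k\<in>K 0. Y 0 k \<omega>"])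
    show "(\<lambda>\<omega>. \<Sum>k\<in>K 0. Y 0 k \<omega>) \<in> borel_measurable M" using Ym by (intro borel_measurable_sum) auto
  qed (simp add: sum)
  \<comment> \<open>Comparing \<open>Z\<close> with a copy of itself avoids centring: the means of
    the truncated row sums are not known to converge, but they cancel in differences. The iterated
    integral plays the role of the independent copy.\<close>
  define D where "D = (\<integral>\<^sup>+\<omega>. \<integral>\<^sup>+\<omega>'. ennreal ((Z \<omega> - Z \<omega>')\<^sup>2) \<partial>M \<partial>M)"
  have D: "D \<le> ennreal (2 * (\<epsilon> * C))" if \<epsilon>: "0 < \<epsilon>" "\<epsilon> \<le> 1" for \<epsilon>
  proof -
    \<comment> \<open>Truncation by clamping to the interval from \<open>- \<epsilon>\<close> to
      \<open>\<epsilon>\<close>. Since \<open>\<epsilon> \<le> 1\<close>, clamped values are also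
      bounded by \<open>min 1 \<bar>x\<bar>\<close>, for which the sums of the means are
      bounded.\<close>
    define cl where "cl x = max (- \<epsilon>) (min \<epsilon> x)" for x :: real
    have cl [measurable]: "cl \<in> borel_measurable borel" unfolding cl_def by measurable
    have clb: "\<bar>cl x\<bar> \<le> \<epsilon>" "\<bar>cl x\<bar> \<le> min 1 \<bar>x\<bar>" for x unfolding cl_def using \<epsilon> by auto
    define S where "S n \<omega> = (\<Sum>k\<in>K n. cl (Y n k \<omega>))" for n \<omega>
    have clm: "(\<lambda>\<omega>. cl (Y n k \<omega>)) \<in> borel_measurable M" if "k \<in> K n" for n k
      using Ym[OF that] by measurable
    have icl: "integrable M (\<lambda>\<omega>. cl (Y n k \<omega>))" if "k \<in> K n" for n k
      using clm[OF that] clb(1) by (intro integrable_const_bound[where B = \<epsilon>]) auto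
    have Sm [measurable]: "S n \<in> borel_measurable M" for n
      unfolding S_def using clm by (intro borel_measurable_sum) auto
    have Sb: "\<bar>S n \<omega>\<bar> \<le> real (card (K n)) * \<epsilon>" for n \<omega>
    proof -
      have "\<bar>S n \<omega>\<bar> \<le> (\<Sum>k\<in>K n. \<bar>cl (Y n k \<omega>)\<bar>)" unfolding S_def by (rule sum_abs)
      also have "\<dots> \<le> (\<Sum>k\<in>K n. \<epsilon>)" using clb by (intro sum_mono) auto
      finally show ?thesis by simp
    qed
    have iS: "integrable M (S n)" for n using Sb by (intro integrable_const_bound) auto
    have iS2: "integrable M (\<lambda>\<omega>. (S n \<omega>)\<^sup>2)" for n
      using Sb \<epsilon> by (intro integrable_const_bound[where B = "(real (card (K n)) * \<epsilon>)\<^sup>2"])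
        (auto simp: abs_le_square_iff[symmetric] abs_mult)
    \<comment> \<open>A sum of squares below \<open>\<epsilon>\<^sup>2\<close> forces every entry of
      the row to be at most \<open>\<epsilon>\<close> in absolute value, where clamping changes
      nothing.\<close>
    have Slim: "\<forall>\<^sub>F n in sequentially. S n \<omega> = Z \<omega>" if w: "\<omega> \<in> space M" for \<omega>
    proof -
      have "\<forall>\<^sub>F n in sequentially. (\<Sum>k\<in>K n. (Y n k \<omega>)\<^sup>2) < \<epsilon>\<^sup>2"
        using \<epsilon> by (intro order_tendstoD(2)[OF small[OF w]]) auto
      then show ?thesis
      proof eventually_elim
        case (elim n)
        have "cl (Y n k \<omega>) = Y n k \<omega>" if "k \<in> K n" for k
        proof -
          have "(Y n k \<omega>)\<^sup>2 \<le> (\<Sum>k\<in>K n. (Y n k \<omega>)\<^sup>2)" using that fin by (intro member_le_sum) auto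
          then have "\<bar>Y n k \<omega>\<bar> \<le> \<epsilon>" using elim \<epsilon> by (intro power2_le_imp_le[of "\<bar>Y n k \<omega>\<bar>" \<epsilon>]) auto
          then show ?thesis by (auto simp: cl_def)
        qed
        then show ?case using sum[OF w, of n] by (simp add: S_def)
      qed
    qed
    have var: "expectation (\<lambda>\<omega>. (S n \<omega> - expectation (S n))\<^sup>2) \<le> \<epsilon> * C" for n
    proof -
      define X where "X k \<omega> = cl (Y n k \<omega>) - expectation (\<lambda>\<omega>. cl (Y n k \<omega>))" for k \<omega>
      have eb: "\<bar>expectation (\<lambda>\<omega>. cl (Y n k \<omega>))\<bar> \<le> \<epsilon>" if "k \<in> K n" for k
      proof -
        have "\<bar>expectation (\<lambda>\<omega>. cl (Y n k \<omega>))\<bar> \<le> expectation (\<lambda>\<omega>. \<bar>cl (Y n k \<omega>)\<bar>)"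
          by (rule integral_abs_bound)
        also have "\<dots> \<le> expectation (\<lambda>\<omega>. \<epsilon>)"
          using icl[OF that] clb by (intro integral_mono integrable_abs) auto
        finally show ?thesis by (simp add: prob_space)
      qed
      have "S n \<omega> - expectation (S n) = (\<Sum>k\<in>K n. X k \<omega>)" for \<omega>
        unfolding S_def X_def using icl by (simp add: sum_subtractf)
      then have "expectation (\<lambda>\<omega>. (S n \<omega> - expectation (S n))\<^sup>2) = expectation (\<lambda>\<omega>. (\<Sum>k\<in>K n. X k \<omega>)\<^sup>2)" by simp
      also have "\<dots> = (\<Sum>k\<in>K n. expectation (\<lambda>\<omega>. (X k \<omega>)\<^sup>2))"
      proof (rule indep_vars_square_sum[OF fin])
        show "indep_vars (\<lambda>_. borel) X (K n)"
          unfolding X_def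
          using indep_vars_compose2[OF ind, of n "\<lambda>k x. cl x - expectation (\<lambda>\<omega>. cl (Y n k \<omega>))" "\<lambda>_. borel"] by simp
        show "\<bar>X k \<omega>\<bar> \<le> 2 * \<epsilon>" if "k \<in> K n" for k \<omega>
          using clb(1)[of "Y n k \<omega>"] eb[OF that] unfolding X_def by linarith
        show "expectation (X k) = 0" if "k \<in> K n" for k
          unfolding X_def using icl[OF that] by (simp add: prob_space)
      qed
      also have "\<dots> \<le> (\<Sum>k\<in>K n. \<epsilon> * expectation (\<lambda>\<omega>. min 1 \<bar>Y n k \<omega>\<bar>))"
      proof (rule sum_mono)
        fix k assume k: "k \<in> K n"
        have i2: "integrable M (\<lambda>\<omega>. (cl (Y n k \<omega>))\<^sup>2)"
          using clm[OF k] clb(1) \<epsilon> by (intro integrable_const_bound[where B = "\<epsilon>\<^sup>2"])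
            (auto simp: abs_le_square_iff[symmetric])
        have "expectation (\<lambda>\<omega>. (X k \<omega>)\<^sup>2) = expectation (\<lambda>\<omega>. (cl (Y n k \<omega>))\<^sup>2) - (expectation (\<lambda>\<omega>. cl (Y n k \<omega>)))\<^sup>2"
          unfolding X_def by (rule variance_eq[OF icl[OF k] i2])
        also have "\<dots> \<le> expectation (\<lambda>\<omega>. (cl (Y n k \<omega>))\<^sup>2)" by simp
        also have "\<dots> \<le> expectation (\<lambda>\<omega>. \<epsilon> * min 1 \<bar>Y n k \<omega>\<bar>)"
        proof (rule integral_mono[OF i2])
          show "integrable M (\<lambda>\<omega>. \<epsilon> * min 1 \<bar>Y n k \<omega>\<bar>)"
            using Ym[OF k] by (intro integrable_mult_right integrable_const_bound[where B = 1]) auto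
          show "(cl (Y n k \<omega>))\<^sup>2 \<le> \<epsilon> * min 1 \<bar>Y n k \<omega>\<bar>" for \<omega>
          proof -
            have "\<bar>cl (Y n k \<omega>)\<bar> * \<bar>cl (Y n k \<omega>)\<bar> \<le> \<epsilon> * min 1 \<bar>Y n k \<omega>\<bar>"
              using clb \<epsilon> by (intro mult_mono) auto
            then show ?thesis by (simp add: power2_eq_square)
          qed
        qed
        finally show "expectation (\<lambda>\<omega>. (X k \<omega>)\<^sup>2) \<le> \<epsilon> * expectation (\<lambda>\<omega>. min 1 \<bar>Y n k \<omega>\<bar>)" by simp
      qed
      also have "\<dots> \<le> \<epsilon> * C" unfolding sum_distrib_left[symmetric] using C[of n] \<epsilon> by (intro mult_left_mono) auto
      finally show ?thesis .
    qed
    \<comment> \<open>The iterated integral is twice the variance of \<open>S n\<close>.\<close>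
    have dbl: "(\<integral>\<^sup>+\<omega>. \<integral>\<^sup>+\<omega>'. ennreal ((S n \<omega> - S n \<omega>')\<^sup>2) \<partial>M \<partial>M) \<le> ennreal (2 * (\<epsilon> * C))" for n
    proof -
      let ?m = "expectation (S n)" and ?q = "expectation (\<lambda>\<omega>. (S n \<omega>)\<^sup>2)"
      have v: "expectation (\<lambda>\<omega>. (S n \<omega> - ?m)\<^sup>2) = ?q - ?m\<^sup>2" by (rule variance_eq[OF iS iS2])
      have inner: "(\<integral>\<^sup>+\<omega>'. ennreal ((s - S n \<omega>')\<^sup>2) \<partial>M) = ennreal (s\<^sup>2 - 2 * s * ?m + ?q)" for s
      proof -
        have i: "integrable M (\<lambda>\<omega>'. (s - S n \<omega>')\<^sup>2)"
          unfolding power2_diff using iS iS2 by (intro Bochner_Integration.integrable_add Bochner_Integration.integrable_diff) auto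
        have "(\<integral>\<^sup>+\<omega>'. ennreal ((s - S n \<omega>')\<^sup>2) \<partial>M) = ennreal (expectation (\<lambda>\<omega>'. (s - S n \<omega>')\<^sup>2))"
          by (rule nn_integral_eq_integral[OF i]) simp
        also have "expectation (\<lambda>\<omega>'. (s - S n \<omega>')\<^sup>2) = s\<^sup>2 - 2 * s * ?m + ?q"
          unfolding power2_diff using iS iS2 by (simp add: prob_space)
        finally show ?thesis .
      qed
      have i: "integrable M (\<lambda>\<omega>. (S n \<omega>)\<^sup>2 - 2 * S n \<omega> * ?m + ?q)"
        using iS iS2 by (intro Bochner_Integration.integrable_add Bochner_Integration.integrable_diff) auto
      have nn: "0 \<le> (S n \<omega>)\<^sup>2 - 2 * S n \<omega> * ?m + ?q" for \<omega>
      proof -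
        have "0 \<le> ?q - ?m\<^sup>2" unfolding v[symmetric] by (rule Bochner_Integration.integral_nonneg) simp
        moreover have "0 \<le> (S n \<omega> - ?m)\<^sup>2" by simp
        ultimately show ?thesis unfolding power2_diff by simp
      qed
      have "(\<integral>\<^sup>+\<omega>. \<integral>\<^sup>+\<omega>'. ennreal ((S n \<omega> - S n \<omega>')\<^sup>2) \<partial>M \<partial>M) = ennreal (expectation (\<lambda>\<omega>. (S n \<omega>)\<^sup>2 - 2 * S n \<omega> * ?m + ?q))"
        unfolding inner by (rule nn_integral_eq_integral[OF i]) (simp add: nn)
      also have "expectation (\<lambda>\<omega>. (S n \<omega>)\<^sup>2 - 2 * S n \<omega> * ?m + ?q) = 2 * (?q - ?m\<^sup>2)"
        using iS iS2 by (simp add: prob_space power2_eq_square)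
      also have "ennreal (2 * (?q - ?m\<^sup>2)) \<le> ennreal (2 * (\<epsilon> * C))"
        using var[of n] unfolding v by (intro ennreal_leI) simp
      finally show ?thesis .
    qed
    have "(\<integral>\<^sup>+\<omega>'. ennreal ((Z \<omega> - Z \<omega>')\<^sup>2) \<partial>M) \<le> liminf (\<lambda>n. \<integral>\<^sup>+\<omega>'. ennreal ((S n \<omega> - S n \<omega>')\<^sup>2) \<partial>M)"
      if w: "\<omega> \<in> space M" for \<omega>
    proof -
      have "(\<integral>\<^sup>+\<omega>'. ennreal ((Z \<omega> - Z \<omega>')\<^sup>2) \<partial>M) = (\<integral>\<^sup>+\<omega>'. liminf (\<lambda>n. ennreal ((S n \<omega> - S n \<omega>')\<^sup>2)) \<partial>M)"
      proof (rule nn_integral_cong)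
        fix \<omega>' assume "\<omega>' \<in> space M"
        from Slim[OF this] Slim[OF w]
        have "\<forall>\<^sub>F n in sequentially. ennreal ((S n \<omega> - S n \<omega>')\<^sup>2) = ennreal ((Z \<omega> - Z \<omega>')\<^sup>2)"
          by eventually_elim simp
        then have "(\<lambda>n. ennreal ((S n \<omega> - S n \<omega>')\<^sup>2)) \<longlonglongrightarrow> ennreal ((Z \<omega> - Z \<omega>')\<^sup>2)"
          by (rule tendsto_eventually)
        from lim_imp_Liminf[OF _ this] show "ennreal ((Z \<omega> - Z \<omega>')\<^sup>2) = liminf (\<lambda>n. ennreal ((S n \<omega> - S n \<omega>')\<^sup>2))"
          by simp
      qed
      also have "\<dots> \<le> liminf (\<lambda>n. \<integral>\<^sup>+\<omega>'. ennreal ((S n \<omega> - S n \<omega>')\<^sup>2) \<partial>M)"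
        by (rule nn_integral_liminf) measurable
      finally show ?thesis .
    qed
    then have "D \<le> (\<integral>\<^sup>+\<omega>. liminf (\<lambda>n. \<integral>\<^sup>+\<omega>'. ennreal ((S n \<omega> - S n \<omega>')\<^sup>2) \<partial>M) \<partial>M)"
      unfolding D_def by (intro nn_integral_mono)
    also have "\<dots> \<le> liminf (\<lambda>n. \<integral>\<^sup>+\<omega>. \<integral>\<^sup>+\<omega>'. ennreal ((S n \<omega> - S n \<omega>')\<^sup>2) \<partial>M \<partial>M)"
      by (rule nn_integral_liminf) measurable
    also have "\<dots> \<le> ennreal (2 * (\<epsilon> * C))"
      by (intro Liminf_le always_eventually allI dbl) simp
    finally show ?thesis .
  qed
  have "(\<lambda>n. ennreal (2 * (1 / Suc n * C))) \<longlonglongrightarrow> ennreal (2 * (0 * C))"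
    by (intro tendsto_intros LIMSEQ_inverse_real_of_nat[unfolded inverse_eq_divide])
  then have "D \<le> ennreal (2 * (0 * C))"
  proof (rule tendsto_lowerbound)
    show "\<forall>\<^sub>F n in sequentially. D \<le> ennreal (2 * (1 / Suc n * C))"
      by (intro always_eventually allI D) auto
  qed simp
  then have "D = 0" by simp
  then have "AE \<omega> in M. (\<integral>\<^sup>+\<omega>'. ennreal ((Z \<omega> - Z \<omega>')\<^sup>2) \<partial>M) = 0"
    unfolding D_def by (subst (asm) nn_integral_0_iff_AE) auto
  then have "AE \<omega> in M. AE \<omega>' in M. Z \<omega>' = Z \<omega>"
  proof eventually_elim
    case (elim \<omega>)
    then have "AE \<omega>' in M. ennreal ((Z \<omega> - Z \<omega>')\<^sup>2) = 0" by (subst (asm) nn_integral_0_iff_AE) auto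
    then show ?case by eventually_elim simp
  qed
  \<comment> \<open>Almost every \<open>\<omega>\<close> provides the constant
    \<open>Z \<omega>\<close>, and a probability space has at least one such point.\<close>
  then have "\<exists>\<omega>. AE \<omega>' in M. Z \<omega>' = Z \<omega>"
    by (rule eventually_happens'[rotated]) (simp add: trivial_limit_def)
  then show ?thesis by blast
qed

end

section \<open>The jumps of a signed measure\<close>

lemma space_punctured_line [simp]: "space punctured_line = UNIV - {0}"
  by (simp add: space_restrict_space)

lemma sets_punctured_line: "A \<in> sets punctured_line \<longleftrightarrow> A \<in> sets borel \<and> 0 \<notin> A"
  by (subst sets_restrict_space_iff) auto

lemma space_jump_space: "space (jump_space M) = space M \<times> (UNIV - {0})"
  by (simp add: jump_space_def space_pair_measure)

lemma Times_jump_space [intro]: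
  "A \<in> sets M \<Longrightarrow> U \<in> sets punctured_line \<Longrightarrow> A \<times> U \<in> sets (jump_space M)"
  unfolding jump_space_def by (rule pair_measureI)

lemma fst_jump_space [measurable]: "fst \<in> jump_space M \<rightarrow>\<^sub>M M"
  by (simp add: jump_space_def)

lemma emeasure_count_space_mono:
  assumes "X \<subseteq> A" "A \<subseteq> A'" shows "emeasure (count_space A) X = emeasure (count_space A') X"
  using assms emeasure_count_space[of X A] emeasure_count_space[of X A'] by auto

context localized_borel
begin

abbreviation "J \<equiv> jump_space M"
abbreviation "JR \<equiv> jump_ring M R"

text \<open>The sequence that localizes \<open>JR\<close>: bounded locations and jump sizes away
  from 0.\<close>

definition box :: "nat \<Rightarrow> ('a \<times> real) set" where
  "box m = exh m \<times> {x. x \<noteq> 0 \<and> 1 / real (Suc m) \<le> \<bar>x\<bar>}"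

lemma JR_sets: "C \<in> JR \<Longrightarrow> C \<in> sets J"
  by (simp add: jump_ring_def)

lemma JR_subset: "C \<in> JR \<Longrightarrow> D \<in> sets J \<Longrightarrow> D \<subseteq> C \<Longrightarrow> D \<in> JR"
  unfolding jump_ring_def by blast

lemma box_sets [measurable, simp]: "box m \<in> sets J"
proof -
  have "{x::real. x \<noteq> 0 \<and> 1 / real (Suc m) \<le> \<bar>x\<bar>} \<in> sets punctured_line"
    by (simp add: sets_punctured_line)
  then show ?thesis unfolding box_def using R_sets[OF exh_R] by blast
qed

lemma box_JR [simp]: "box m \<in> JR"
proof -
  have "box m \<subseteq> exh m \<times> {x. 1 / real (Suc m) \<le> \<bar>x\<bar>}" by (auto simp: box_def)
  moreover have "1 / real (Suc m) > 0" by simp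
  ultimately show ?thesis unfolding jump_ring_def using box_sets exh_R by blast
qed

lemma box_incseq: "incseq box"
proof (rule incseq_SucI)
  fix m
  have "1 / real (Suc (Suc m)) \<le> 1 / real (Suc m)" by (simp add: frac_le)
  moreover have "exh m \<subseteq> exh (Suc m)" using exh_incseq by (auto simp: incseq_Suc_iff)
  ultimately show "box m \<subseteq> box (Suc m)" unfolding box_def by force
qed

lemma UN_box: "(\<Union>m. box m) = space J"
proof
  show "(\<Union>m. box m) \<subseteq> space J" using sets.sets_into_space[OF box_sets] by blast
  show "space J \<subseteq> (\<Union>m. box m)"
  proof
    fix z assume "z \<in> space J"
    then obtain t x where z: "z = (t, x)" "t \<in> space M" "x \<noteq> 0" by (auto simp: space_jump_space)
    obtain m where m: "t \<in> exh m" using z(2) UN_exh by auto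
    obtain n where n: "inverse (real (Suc n)) < \<bar>x\<bar>" using reals_Archimedean[of "\<bar>x\<bar>"] z by auto
    have "1 / real (Suc (m + n)) \<le> 1 / real (Suc n)" by (simp add: frac_le)
    then have "1 / real (Suc (m + n)) \<le> \<bar>x\<bar>" using n by (simp add: inverse_eq_divide)
    moreover have "t \<in> exh (m + n)" using m incseqD[OF exh_incseq, of m "m + n"] by auto
    ultimately have "z \<in> box (m + n)" using z by (auto simp: box_def)
    then show "z \<in> (\<Union>m. box m)" by blast
  qed
qed

lemma JR_boundE:
  assumes "C \<in> JR"
  obtains B \<epsilon> where "B \<in> R" "0 < \<epsilon>" "\<And>t x. (t, x) \<in> C \<Longrightarrow> t \<in> B \<and> \<epsilon> \<le> \<bar>x\<bar> \<and> x \<noteq> 0"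
proof -
  obtain B \<epsilon> where "B \<in> R" "0 < \<epsilon>" "C \<subseteq> B \<times> {x. \<epsilon> \<le> \<bar>x\<bar>}" "C \<in> sets J"
    using assms unfolding jump_ring_def by blast
  then show thesis using that[of B \<epsilon>] by fastforce
qed

lemma ring_JR: "ring_of_sets (space J) JR"
proof (rule ring_of_setsI)
  show "JR \<subseteq> Pow (space J)" using JR_sets sets.sets_into_space by blast
  show "{} \<in> JR" by (rule JR_subset[OF box_JR]) auto
  show "a \<union> b \<in> JR" if ab: "a \<in> JR" "b \<in> JR" for a b
  proof -
    obtain A e where A: "A \<in> R" "0 < e" "a \<subseteq> A \<times> {x. e \<le> \<bar>x\<bar>}" using ab(1) unfolding jump_ring_def by blast
    obtain B f where B: "B \<in> R" "0 < f" "b \<subseteq> B \<times> {x. f \<le> \<bar>x\<bar>}" using ab(2) unfolding jump_ring_def by blast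
    have "a \<union> b \<subseteq> (A \<union> B) \<times> {x. min e f \<le> \<bar>x\<bar>}" using A(3) B(3) by auto
    moreover have "a \<union> b \<in> sets J" using ab JR_sets by blast
    moreover have "A \<union> B \<in> R" "0 < min e f" using A B by (auto simp: R_Un)
    ultimately show ?thesis unfolding jump_ring_def by blast
  qed
  show "a - b \<in> JR" if ab: "a \<in> JR" "b \<in> JR" for a b
    using ab JR_sets by (intro JR_subset[OF ab(1)]) auto
qed

lemma Int_box_JR: "C \<in> sets J \<Longrightarrow> C \<inter> box m \<in> JR"
  by (rule JR_subset[OF box_JR]) auto

text \<open>Continuity from below along the boxes, which carries statements from \<open>JR\<close>
  to all measurable sets.\<close>

lemma emeasure_box_SUP:
  assumes "sets \<nu> = sets J" "C \<in> sets J"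
  shows "emeasure \<nu> C = (SUP m. emeasure \<nu> (C \<inter> box m))"
proof -
  have "(SUP m. emeasure \<nu> (C \<inter> box m)) = emeasure \<nu> (\<Union>m. C \<inter> box m)"
    using assms box_incseq by (intro SUP_emeasure_incseq) (auto simp: incseq_def)
  also have "(\<Union>m. C \<inter> box m) = C" using UN_box sets.sets_into_space[OF assms(2)] by blast
  finally show ?thesis by simp
qed

text \<open>The sum of the unit masses at \<open>(t, \<mu> {t})\<close> over all atoms
  \<open>t\<close>, written as an image of counting measure.\<close>

definition jumps :: "('a set \<Rightarrow> real) \<Rightarrow> ('a \<times> real) measure" where
  "jumps \<mu> = distr (count_space {t \<in> space M. \<mu> {t} \<noteq> 0}) J (\<lambda>t. (t, \<mu> {t}))"

lemma sets_jumps [simp, measurable_cong]: "sets (jumps \<mu>) = sets J" and space_jumps [simp]: "space (jumps \<mu>) = space J"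
  by (simp_all add: jumps_def)

lemma emeasure_jumps:
  assumes "C \<in> sets J" shows "emeasure (jumps \<mu>) C = emeasure (count_space (space M)) {t \<in> space M. (t, \<mu> {t}) \<in> C}"
proof -
  have C: "C \<subseteq> space M \<times> (UNIV - {0})" using sets.sets_into_space[OF assms] by (simp add: space_jump_space)
  have "emeasure (jumps \<mu>) C = emeasure (count_space {t \<in> space M. \<mu> {t} \<noteq> 0}) ((\<lambda>t. (t, \<mu> {t})) -` C \<inter> {t \<in> space M. \<mu> {t} \<noteq> 0})"
    unfolding jumps_def using assms by (subst emeasure_distr) (auto simp: space_jump_space)
  also have "(\<lambda>t. (t, \<mu> {t})) -` C \<inter> {t \<in> space M. \<mu> {t} \<noteq> 0} = {t \<in> space M. (t, \<mu> {t}) \<in> C}" using C by auto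
  also have "emeasure (count_space {t \<in> space M. \<mu> {t} \<noteq> 0}) \<dots> = emeasure (count_space (space M)) \<dots>"
    using C by (intro emeasure_count_space_mono) auto
  finally show ?thesis .
qed

text \<open>Each counted atom contributes at least \<open>\<epsilon>\<close> to the finite sum of
  the absolute values of the atoms in \<open>B\<close>.\<close>

lemma finite_jumps:
  assumes mu: "countably_additive_on R \<mu>" and C: "C \<in> JR"
  shows "finite {t \<in> space M. (t, \<mu> {t}) \<in> C}"
proof -
  obtain B \<epsilon> where B: "B \<in> R" "0 < \<epsilon>" "\<And>t x. (t, x) \<in> C \<Longrightarrow> t \<in> B \<and> \<epsilon> \<le> \<bar>x\<bar> \<and> x \<noteq> 0"
    using JR_boundE[OF C] by metis
  let ?T = "{t \<in> space M. (t, \<mu> {t}) \<in> C}"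
  have "ennreal \<epsilon> * emeasure (count_space (space M)) ?T = (\<integral>\<^sup>+t. ennreal \<epsilon> * indicator ?T t \<partial>count_space (space M))"
    by (rule nn_integral_cmult_indicator[symmetric]) auto
  also have "\<dots> \<le> (\<integral>\<^sup>+t. ennreal \<bar>\<mu> {t}\<bar> * indicator B t \<partial>count_space (space M))"
    using B(3) by (intro nn_integral_mono) (auto simp: indicator_def intro!: ennreal_leI)
  also have "\<dots> < \<infinity>" by (rule atoms_summable(1)[OF mu B(1)])
  finally have "emeasure (count_space (space M)) ?T < \<infinity>"
    using B(2) by (auto simp: ennreal_mult_less_top)
  then show ?thesis by (subst (asm) emeasure_count_space) (auto split: if_splits)
qed

lemma emeasure_jumps_card:
  assumes "countably_additive_on R \<mu>" "C \<in> JR"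
  shows "emeasure (jumps \<mu>) C = of_nat (card {t \<in> space M. (t, \<mu> {t}) \<in> C})"
  unfolding emeasure_jumps[OF JR_sets[OF assms(2)]]
  using finite_jumps[OF assms] by (subst emeasure_count_space) auto

lemma jumps_point_measure:
  assumes "countably_additive_on R \<mu>" shows "jumps \<mu> \<in> point_measures J JR"
  unfolding point_measures_def using emeasure_jumps_card[OF assms] by auto

lemma sets_slice [simp]: "sets (slice \<nu> B) = sets punctured_line" and space_slice [simp]: "space (slice \<nu> B) = UNIV - {0}"
  by (simp_all add: slice_def)

lemma slice_jumps:
  assumes "B \<in> sets M"
  shows "slice (jumps \<mu>) B = distr (count_space {t \<in> B. \<mu> {t} \<noteq> 0}) punctured_line (\<lambda>t. \<mu> {t})"
proof (rule measure_eqI)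
  fix A assume "A \<in> sets (slice (jumps \<mu>) B)"
  then have A: "A \<in> sets punctured_line" by simp
  then have 0: "0 \<notin> A" by (simp add: sets_punctured_line)
  have BM: "B \<subseteq> space M" using sets.sets_into_space[OF assms] .
  have "emeasure (slice (jumps \<mu>) B) A = emeasure (jumps \<mu>) (B \<times> A)"
    using assms A by (intro emeasure_slice) auto
  also have "\<dots> = emeasure (count_space (space M)) {t \<in> space M. (t, \<mu> {t}) \<in> B \<times> A}"
    using assms A by (intro emeasure_jumps) auto
  also have "{t \<in> space M. (t, \<mu> {t}) \<in> B \<times> A} = {t \<in> B. \<mu> {t} \<in> A}" using BM by auto
  also have "emeasure (count_space (space M)) {t \<in> B. \<mu> {t} \<in> A} = emeasure (count_space {t \<in> B. \<mu> {t} \<noteq> 0}) {t \<in> B. \<mu> {t} \<in> A}"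
    using BM 0 by (intro emeasure_count_space_mono[symmetric]) auto
  also have "\<dots> = emeasure (distr (count_space {t \<in> B. \<mu> {t} \<noteq> 0}) punctured_line (\<lambda>t. \<mu> {t})) A"
    using A 0 by (subst emeasure_distr) (auto intro!: arg_cong[where f = "emeasure _"])
  finally show "emeasure (slice (jumps \<mu>) B) A = emeasure (distr (count_space {t \<in> B. \<mu> {t} \<noteq> 0}) punctured_line (\<lambda>t. \<mu> {t})) A" .
qed simp

text \<open>The integral adds up the atoms in \<open>B\<close>; subtracting it from
  \<open>\<mu> B\<close> leaves the mass of \<open>B\<close> off the atoms.\<close>

lemma slice_jumps_integral:
  assumes mu: "countably_additive_on R \<mu>" and B: "B \<in> R"
  shows "integrable (slice (jumps \<mu>) B) (\<lambda>x. x)"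
    "(\<integral>x. x \<partial>slice (jumps \<mu>) B) = \<mu> {t \<in> B. \<mu> {t} \<noteq> 0}"
proof -
  have m: "(\<lambda>t. \<mu> {t}) \<in> count_space {t \<in> B. \<mu> {t} \<noteq> 0} \<rightarrow>\<^sub>M punctured_line" by auto
  have i: "(\<lambda>x. x) \<in> borel_measurable punctured_line" by (rule measurable_restrict_space1) simp
  show "integrable (slice (jumps \<mu>) B) (\<lambda>x. x)"
    unfolding slice_jumps[OF R_sets[OF B]] using atoms_summable(2)[OF mu B]
    by (subst integrable_distr_eq[OF m i])
  show "(\<integral>x. x \<partial>slice (jumps \<mu>) B) = \<mu> {t \<in> B. \<mu> {t} \<noteq> 0}"
    unfolding slice_jumps[OF R_sets[OF B]] using atoms_summable(3)[OF mu B]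
    by (subst integral_distr[OF m i])
qed

lemma nn_integral_slice_jumps:
  assumes "B \<in> sets M" "f \<in> borel_measurable punctured_line"
  shows "(\<integral>\<^sup>+x. f x \<partial>slice (jumps \<mu>) B) = (\<integral>\<^sup>+t. f (\<mu> {t}) \<partial>count_space {t \<in> B. \<mu> {t} \<noteq> 0})"
  unfolding slice_jumps[OF assms(1)] using assms(2) by (subst nn_integral_distr) auto

text \<open>
  Giving the atom \<open>t\<close> the weight \<open>(\<xi> \<omega> {t})\<^sup>2\<close> turns the jumps into a finite kernel, measurable in
  \<open>\<omega>\<close> as a limit of sums of squares over cells; dividing by that weight recovers the count.
  Only the increments over subsets of \<open>B0\<close> enter, whence the independence of jumps over disjoint sets.
\<close>

lemma measurable_jumps_ring:
  assumes ca: "\<And>\<omega>. \<omega> \<in> space N \<Longrightarrow> countably_additive_on R (\<xi> \<omega>)"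
    and meas: "\<And>B. B \<in> R \<Longrightarrow> B \<subseteq> B0 \<Longrightarrow> (\<lambda>\<omega>. \<xi> \<omega> B) \<in> borel_measurable N"
    and B0: "B0 \<in> sets M" and C: "C \<in> JR" "C \<subseteq> B0 \<times> UNIV"
  shows "(\<lambda>\<omega>. emeasure (jumps (\<xi> \<omega>)) C) \<in> borel_measurable N"
proof (cases "space M = {}")
  case True
  then have "C = {}" using sets.sets_into_space[OF JR_sets[OF C(1)]] by (auto simp: space_jump_space)
  then show ?thesis by simp
next
  case False
  obtain B' \<epsilon> where B': "B' \<in> R" "0 < \<epsilon>" "\<And>t x. (t, x) \<in> C \<Longrightarrow> t \<in> B' \<and> \<epsilon> \<le> \<bar>x\<bar> \<and> x \<noteq> 0"
    using JR_boundE[OF C(1)] by metis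
  \<comment> \<open>Bounded because of \<open>B'\<close>, and inside \<open>B0\<close> so that only
    the available increments are used.\<close>
  define B where "B = B' \<inter> B0"
  have B: "B \<in> R" "B \<subseteq> B0" using R_Int[OF B'(1) B0] by (auto simp: B_def)
  have CB: "t \<in> B \<and> x \<noteq> 0" if "(t, x) \<in> C" for t x using B'(3)[OF that] that C(2) by (auto simp: B_def)
  have Bs [measurable]: "B \<in> sets M" using R_sets[OF B(1)] .
  define q where "q \<omega> A = (\<integral>\<^sup>+t. ennreal ((\<xi> \<omega> {t})\<^sup>2) * indicator (B \<inter> A) t \<partial>count_space (space M))" for \<omega> A
  have qfin: "q \<omega> A < \<infinity>" if "\<omega> \<in> space N" "A \<in> sets M" for \<omega> A
    unfolding q_def by (rule atoms_summable(5)[OF ca[OF that(1)] R_Int[OF B(1) that(2)]])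
  have qm: "(\<lambda>\<omega>. q \<omega> A) \<in> borel_measurable N" if A: "A \<in> sets M" for A
  proof -
    have BA: "B \<inter> A \<in> R" by (rule R_Int[OF B(1) A])
    have BAk: "B \<inter> A \<inter> cells n k \<in> R" for n k by (rule R_Int[OF BA cells_sets])
    have "(\<lambda>\<omega>. enn2real (q \<omega> A)) \<in> borel_measurable N"
    proof (rule borel_measurable_LIMSEQ_real)
      show "(\<lambda>n. \<Sum>k\<le>2 ^ n. (\<xi> \<omega> (B \<inter> A \<inter> cells n k))\<^sup>2) \<longlonglongrightarrow> enn2real (q \<omega> A)" if "\<omega> \<in> space N" for \<omega>
        unfolding q_def by (rule atoms_summable(4)[OF ca[OF that] BA])
      show "(\<lambda>\<omega>. \<Sum>k\<le>2 ^ n. (\<xi> \<omega> (B \<inter> A \<inter> cells n k))\<^sup>2) \<in> borel_measurable N" for n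
        using B(2) by (intro borel_measurable_sum borel_measurable_power meas BAk) auto
    qed
    then have "(\<lambda>\<omega>. ennreal (enn2real (q \<omega> A))) \<in> borel_measurable N" by measurable
    then show ?thesis using qfin[OF _ A] by (subst measurable_cong[where g = "\<lambda>\<omega>. ennreal (enn2real (q \<omega> A))"]) auto
  qed
  define Q where "Q \<omega> = distr (density (count_space (space M)) (\<lambda>t. ennreal ((\<xi> \<omega> {t})\<^sup>2) * indicator B t)) M (\<lambda>t. t)" for \<omega>
  have idm: "(\<lambda>t. t) \<in> density (count_space (space M)) h \<rightarrow>\<^sub>M M" for h by auto
  have Qs [simp]: "sets (Q \<omega>) = sets M" "space (Q \<omega>) = space M" for \<omega> by (simp_all add: Q_def)
  have Qe: "emeasure (Q \<omega>) A = q \<omega> A" if "A \<in> sets M" for \<omega> A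
  proof -
    have "A \<inter> space M = A" using sets.sets_into_space[OF that] by auto
    then have "emeasure (Q \<omega>) A = (\<integral>\<^sup>+t. ennreal ((\<xi> \<omega> {t})\<^sup>2) * indicator B t * indicator A t \<partial>count_space (space M))"
      unfolding Q_def using sets.sets_into_space[OF that] that
      by (subst emeasure_distr[OF idm]) (auto simp: emeasure_density)
    also have "\<dots> = q \<omega> A" unfolding q_def
      by (intro nn_integral_cong) (auto simp: indicator_def)
    finally show ?thesis .
  qed
  \<comment> \<open>Only kernels of total mass at most 1 are available in \<open>subprob_algebra\<close>.\<close>
  define r where "r \<omega> = 1 + q \<omega> (space M)" for \<omega>
  have rm [measurable]: "r \<in> borel_measurable N" using qm[of "space M"] unfolding r_def by measurable
  have r: "r \<omega> \<noteq> 0" "r \<omega> \<noteq> \<infinity>" if "\<omega> \<in> space N" for \<omega>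
    using qfin[OF that, of "space M"] by (auto simp: r_def add_eq_0_iff_both_eq_0)
  define K where "K \<omega> = scale_measure (inverse (r \<omega>)) (Q \<omega>)" for \<omega>
  have Ks [simp]: "sets (K \<omega>) = sets M" "space (K \<omega>) = space M" for \<omega> by (simp_all add: K_def space_scale_measure)
  have K: "K \<in> N \<rightarrow>\<^sub>M subprob_algebra M"
  proof (rule measurable_subprob_algebra)
    fix \<omega> assume w: "\<omega> \<in> space N"
    show "subprob_space (K \<omega>)"
    proof (rule subprob_spaceI)
      have "emeasure (K \<omega>) (space (K \<omega>)) = inverse (r \<omega>) * q \<omega> (space M)"
        unfolding Ks(2) by (simp add: K_def Qe)
      also have "\<dots> \<le> inverse (r \<omega>) * r \<omega>" unfolding r_def by (intro mult_left_mono) auto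
      also have "\<dots> = 1" using r[OF w] by (simp add: ennreal_inverse_mult mult.commute less_top[symmetric] ennreal_divide_self divide_ennreal_def[symmetric])
      finally show "emeasure (K \<omega>) (space (K \<omega>)) \<le> 1" .
      show "space (K \<omega>) \<noteq> {}" using False by simp
    qed
  next
    fix A assume A: "A \<in> sets M"
    show "(\<lambda>\<omega>. emeasure (K \<omega>) A) \<in> borel_measurable N"
      using qm[OF A] A by (simp add: K_def Qe)
  qed simp
  \<comment> \<open>The size of the atom as a function of both variables, jointly measurable as the
    limit of the masses of the cells around \<open>t\<close>.\<close>
  define y where "y \<omega> t = \<xi> \<omega> (B \<inter> {t})" for \<omega> t
  have ym [measurable]: "(\<lambda>z. y (fst z) (snd z)) \<in> borel_measurable (N \<Otimes>\<^sub>M M)"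
  proof (rule borel_measurable_LIMSEQ_real)
    fix z assume "z \<in> space (N \<Otimes>\<^sub>M M)"
    then obtain \<omega> t where z: "z = (\<omega>, t)" "\<omega> \<in> space N" "t \<in> space M" by (auto simp: space_pair_measure)
    show "(\<lambda>n. \<xi> (fst z) (B \<inter> cells n (cell n (snd z)))) \<longlonglongrightarrow> y (fst z) (snd z)"
      using tendsto_cells[OF ca[OF z(2)] B(1) z(3)] z by (simp add: y_def)
  next
    fix n
    have "(\<lambda>z. \<xi> (fst z) (B \<inter> cells n k)) \<in> borel_measurable (N \<Otimes>\<^sub>M M)" for k
      using B by (intro measurable_compose[OF measurable_fst meas] R_Int cells_sets) auto
    moreover have "(\<lambda>z. cell n (snd z)) \<in> N \<Otimes>\<^sub>M M \<rightarrow>\<^sub>M count_space UNIV" by measurable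
    ultimately show "(\<lambda>z. \<xi> (fst z) (B \<inter> cells n (cell n (snd z)))) \<in> borel_measurable (N \<Otimes>\<^sub>M M)"
      by (rule measurable_compose_countable)
  qed
  \<comment> \<open>Replacing 0 by 1 keeps the values in the punctured line. The default has no
    effect in the end, because the kernel gives no weight to points with
    \<open>y \<omega> t = 0\<close>.\<close>
  define y' where "y' \<omega> t = (if y \<omega> t = 0 then 1 else y \<omega> t)" for \<omega> t
  have "(\<lambda>z. y' (fst z) (snd z)) \<in> borel_measurable (N \<Otimes>\<^sub>M M)" unfolding y'_def by measurable
  then have "(\<lambda>z. y' (fst z) (snd z)) \<in> N \<Otimes>\<^sub>M M \<rightarrow>\<^sub>M punctured_line"
    by (intro measurable_restrict_space2) (auto simp: y'_def)
  then have y'm: "(\<lambda>z. (snd z, y' (fst z) (snd z))) \<in> N \<Otimes>\<^sub>M M \<rightarrow>\<^sub>M J"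
    unfolding jump_space_def by (intro measurable_Pair) auto
  define G :: "_ \<Rightarrow> _ \<Rightarrow> ennreal" where "G \<omega> t = indicator C (t, y' \<omega> t) * inverse (ennreal ((y' \<omega> t)\<^sup>2))" for \<omega> t
  have Gm: "(\<lambda>z. G (fst z) (snd z)) \<in> borel_measurable (N \<Otimes>\<^sub>M M)"
  proof -
    have "(\<lambda>z. indicator C (snd z, y' (fst z) (snd z)) :: ennreal) \<in> borel_measurable (N \<Otimes>\<^sub>M M)"
      using JR_sets[OF C(1)] by (intro measurable_compose[OF y'm]) auto
    moreover have "(\<lambda>z. y' (fst z) (snd z)) \<in> borel_measurable (N \<Otimes>\<^sub>M M)" unfolding y'_def by measurable
    ultimately show ?thesis unfolding G_def by measurable
  qed
  have "(\<lambda>\<omega>. \<integral>\<^sup>+t. G \<omega> t \<partial>K \<omega>) \<in> borel_measurable N"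
    by (rule nn_integral_measurable_subprob_algebra2[OF _ K]) (use Gm in \<open>simp add: split_def\<close>)
  then have "(\<lambda>\<omega>. r \<omega> * (\<integral>\<^sup>+t. G \<omega> t \<partial>K \<omega>)) \<in> borel_measurable N" by measurable
  moreover have "emeasure (jumps (\<xi> \<omega>)) C = r \<omega> * (\<integral>\<^sup>+t. G \<omega> t \<partial>K \<omega>)" if w: "\<omega> \<in> space N" for \<omega>
  proof -
    have Gm1: "G \<omega> \<in> borel_measurable M"
      using measurable_compose[OF measurable_Pair1'[OF w] Gm] by simp
    have "r \<omega> * (\<integral>\<^sup>+t. G \<omega> t \<partial>K \<omega>) = r \<omega> * inverse (r \<omega>) * (\<integral>\<^sup>+t. G \<omega> t \<partial>Q \<omega>)"
      unfolding K_def using Gm1 by (subst nn_integral_scale_measure) (auto simp: mult.assoc measurable_cong_sets[OF Qs(1) refl])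
    also have "r \<omega> * inverse (r \<omega>) = 1"
      using r[OF w] by (simp add: divide_ennreal_def[symmetric] ennreal_divide_self less_top)
    also have "(\<integral>\<^sup>+t. G \<omega> t \<partial>Q \<omega>) = (\<integral>\<^sup>+t. ennreal ((\<xi> \<omega> {t})\<^sup>2) * indicator B t * G \<omega> t \<partial>count_space (space M))"
      unfolding Q_def using Gm1 by (subst nn_integral_distr[OF idm]) (simp_all add: nn_integral_density)
    also have "\<dots> = (\<integral>\<^sup>+t. indicator {t \<in> space M. (t, \<xi> \<omega> {t}) \<in> C} t \<partial>count_space (space M))"
    proof (rule nn_integral_cong)
      fix t assume "t \<in> space (count_space (space M))"
      then have t: "t \<in> space M" by simp
      show "ennreal ((\<xi> \<omega> {t})\<^sup>2) * indicator B t * G \<omega> t = indicator {t \<in> space M. (t, \<xi> \<omega> {t}) \<in> C} t"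
      proof (cases "t \<in> B \<and> \<xi> \<omega> {t} \<noteq> 0")
        case True
        then have "y \<omega> t = \<xi> \<omega> {t}" by (simp add: y_def Int_insert_right)
        then have y': "y' \<omega> t = \<xi> \<omega> {t}" using True by (simp add: y'_def)
        have "ennreal ((\<xi> \<omega> {t})\<^sup>2) * inverse (ennreal ((\<xi> \<omega> {t})\<^sup>2)) = 1"
          using True by (simp add: divide_ennreal_def[symmetric] ennreal_divide_self)
        then show ?thesis using True t unfolding G_def y' by (auto simp: indicator_def)
      next
        case False
        then show ?thesis using CB by (auto simp: indicator_def)
      qed
    qed
    also have "\<dots> = emeasure (jumps (\<xi> \<omega>)) C"
      unfolding emeasure_jumps[OF JR_sets[OF C(1)]] by simp
    finally show ?thesis by simp
  qed
  ultimately show ?thesis by (subst measurable_cong) auto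
qed

lemma measurable_jumps:
  assumes ca: "\<And>\<omega>. \<omega> \<in> space N \<Longrightarrow> countably_additive_on R (\<xi> \<omega>)"
    and meas: "\<And>B. B \<in> R \<Longrightarrow> B \<subseteq> B0 \<Longrightarrow> (\<lambda>\<omega>. \<xi> \<omega> B) \<in> borel_measurable N"
    and B0: "B0 \<in> sets M" and C: "C \<in> sets J" "C \<subseteq> B0 \<times> UNIV"
  shows "(\<lambda>\<omega>. emeasure (jumps (\<xi> \<omega>)) C) \<in> borel_measurable N"
  unfolding emeasure_box_SUP[OF sets_jumps C(1)]
  using C by (intro borel_measurable_SUP measurable_jumps_ring[OF ca meas B0] Int_box_JR) auto

lemma countably_additive_on_Int:
  assumes mu: "countably_additive_on R \<mu>" and E: "E \<in> sets M"
  shows "countably_additive_on R (\<lambda>B. \<mu> (B \<inter> E))"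
  unfolding countably_additive_on_def
proof (intro conjI allI impI)
  show "\<mu> ({} \<inter> E) = 0" using mu by (simp add: countably_additive_on_def)
  fix A :: "nat \<Rightarrow> 'a set" assume A: "range A \<subseteq> R \<and> disjoint_family A \<and> (\<Union>k. A k) \<in> R"
  have 1: "A k \<inter> E \<in> R" for k using A E by (intro R_Int) auto
  have 2: "disjoint_family (\<lambda>k. A k \<inter> E)" using A by (auto simp: disjoint_family_on_def)
  have 3: "(\<Union>k. A k \<inter> E) = (\<Union>k. A k) \<inter> E" by auto
  have 4: "(\<Union>k. A k \<inter> E) \<in> R" unfolding 3 using A E by (intro R_Int) auto
  show "summable (\<lambda>k. \<bar>\<mu> (A k \<inter> E)\<bar>)" "(\<lambda>k. \<mu> (A k \<inter> E)) sums \<mu> ((\<Union>k. A k) \<inter> E)"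
    using countably_additive_onD[OF mu 1 2 4] unfolding 3 by auto
qed

text \<open>The total mass of the Jordan parts on \<open>B\<close> bounds every row. This is the
  pathwise bound required of the triangular arrays.\<close>

lemma sum_abs_cells_bound:
  assumes mu: "countably_additive_on R \<mu>" and B: "B \<in> R"
  shows "\<exists>v. \<forall>n. (\<Sum>k\<le>2 ^ n. \<bar>\<mu> (B \<inter> cells n k)\<bar>) \<le> v"
proof -
  obtain p q where pq: "loc_finite M R p" "loc_finite M R q" "\<forall>B\<in>R. \<mu> B = measure p B - measure q B"
    using jordan_decomposition[OF mu] by blast
  have "(\<Sum>k\<le>2 ^ n. \<bar>\<mu> (B \<inter> cells n k)\<bar>) \<le> measure p B + measure q B" for n
  proof -
    have "\<bar>\<mu> (B \<inter> cells n k)\<bar> \<le> measure p (B \<inter> cells n k) + measure q (B \<inter> cells n k)" for k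
      using bspec[OF pq(3) R_Int[OF B cells_sets]] measure_nonneg[of p "B \<inter> cells n k"] measure_nonneg[of q "B \<inter> cells n k"]
      by (simp add: abs_le_iff)
    then have "(\<Sum>k\<le>2 ^ n. \<bar>\<mu> (B \<inter> cells n k)\<bar>) \<le> (\<Sum>k\<le>2 ^ n. measure p (B \<inter> cells n k) + measure q (B \<inter> cells n k))"
      by (rule sum_mono)
    also have "\<dots> = measure p B + measure q B"
      unfolding sum.distrib
      using sum_cells[OF loc_finite_countably_additive_on[OF pq(1) R_subset_sets] B]
        sum_cells[OF loc_finite_countably_additive_on[OF pq(2) R_subset_sets] B] by simp
    finally show ?thesis .
  qed
  then show ?thesis by blast
qed

lemma countable_all_atoms:
  assumes mu: "countably_additive_on R \<mu>"
  shows "countable {t \<in> space M. \<mu> {t} \<noteq> 0}"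
proof -
  have "{t \<in> space M. \<mu> {t} \<noteq> 0} = (\<Union>m. {t \<in> exh m. \<mu> {t} \<noteq> 0})"
    using UN_exh by auto
  then show ?thesis using countable_atoms[OF mu exh_R] by simp
qed

section \<open>Integrals over slices and the intensity of a random measure\<close>

text \<open>Induction on \<open>f\<close>. Only counts on bounded sets over \<open>B\<close> are
  assumed measurable, so that \<open>N\<close> can be the sigma-algebra of the increments inside a
  given set; the boxes supply the other sets.\<close>

lemma nn_integral_slice_measurable:
  assumes s: "\<And>\<omega>. \<omega> \<in> space N \<Longrightarrow> sets (\<Psi> \<omega>) = sets J" and B: "B \<in> sets M"
    and m: "\<And>C. C \<in> JR \<Longrightarrow> C \<subseteq> B \<times> UNIV \<Longrightarrow> (\<lambda>\<omega>. emeasure (\<Psi> \<omega>) C) \<in> borel_measurable N"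
    and f: "f \<in> borel_measurable punctured_line"
  shows "(\<lambda>\<omega>. \<integral>\<^sup>+x. f x \<partial>slice (\<Psi> \<omega>) B) \<in> borel_measurable N"
  using f
proof (induction rule: borel_measurable_induct)
  case (cong f g)
  then have "(\<integral>\<^sup>+x. f x \<partial>slice \<nu> B) = (\<integral>\<^sup>+x. g x \<partial>slice \<nu> B)" for \<nu>
    by (intro nn_integral_cong) auto
  then show ?case using cong by simp
next
  case (set A)
  have BA: "B \<times> A \<in> sets J" using B set by auto
  have "(\<integral>\<^sup>+x. indicator A x \<partial>slice (\<Psi> \<omega>) B) = (SUP m. emeasure (\<Psi> \<omega>) (B \<times> A \<inter> box m))" if "\<omega> \<in> space N" for \<omega>
    using set B BA s[OF that] by (simp add: emeasure_slice emeasure_box_SUP[OF s[OF that] BA])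
  moreover have "(\<lambda>\<omega>. SUP m. emeasure (\<Psi> \<omega>) (B \<times> A \<inter> box m)) \<in> borel_measurable N"
    by (intro borel_measurable_SUP m Int_box_JR BA) auto
  ultimately show ?case by (subst measurable_cong) auto
next
  case (mult u c)
  have "(\<integral>\<^sup>+x. c * u x \<partial>slice \<nu> B) = c * (\<integral>\<^sup>+x. u x \<partial>slice \<nu> B)" for \<nu>
    using mult by (intro nn_integral_cmult) (simp add: measurable_cong_sets[OF sets_slice refl])
  then show ?case using mult by simp
next
  case (add u v)
  have "(\<integral>\<^sup>+x. v x + u x \<partial>slice \<nu> B) = (\<integral>\<^sup>+x. v x \<partial>slice \<nu> B) + (\<integral>\<^sup>+x. u x \<partial>slice \<nu> B)" for \<nu>
    using add by (intro nn_integral_add) (simp_all add: measurable_cong_sets[OF sets_slice refl])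
  then show ?case using add by simp
next
  case (seq U)
  have "(\<integral>\<^sup>+x. (SUP i. U i) x \<partial>slice \<nu> B) = (SUP i. \<integral>\<^sup>+x. U i x \<partial>slice \<nu> B)" for \<nu>
    unfolding SUP_apply using seq
    by (intro nn_integral_monotone_convergence_SUP) (simp_all add: measurable_cong_sets[OF sets_slice refl])
  then show ?case using seq by simp
qed

lemma id_punctured_line [measurable]: "(\<lambda>x. x) \<in> borel_measurable punctured_line"
  by (rule measurable_restrict_space1) simp

lemma integral_slice_measurable:
  assumes s: "\<And>\<omega>. \<omega> \<in> space N \<Longrightarrow> sets (\<Psi> \<omega>) = sets J" and B: "B \<in> sets M"
    and m: "\<And>C. C \<in> JR \<Longrightarrow> C \<subseteq> B \<times> UNIV \<Longrightarrow> (\<lambda>\<omega>. emeasure (\<Psi> \<omega>) C) \<in> borel_measurable N"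
  shows "(\<lambda>\<omega>. \<integral>x. x \<partial>slice (\<Psi> \<omega>) B) \<in> borel_measurable N"
proof -
  note nm = nn_integral_slice_measurable[OF s B m]
  have [measurable]: "(\<lambda>\<omega>. \<integral>\<^sup>+x. ennreal x \<partial>slice (\<Psi> \<omega>) B) \<in> borel_measurable N"
    "(\<lambda>\<omega>. \<integral>\<^sup>+x. ennreal (- x) \<partial>slice (\<Psi> \<omega>) B) \<in> borel_measurable N"
    "(\<lambda>\<omega>. \<integral>\<^sup>+x. ennreal \<bar>x\<bar> \<partial>slice (\<Psi> \<omega>) B) \<in> borel_measurable N"
    by (rule nm; (assumption | measurable))+
  \<comment> \<open>The Bochner integral is 0 when the slice is not integrable, and integrability is
    itself a measurable condition, namely finiteness of the integral of
    \<open>\<bar>x\<bar>\<close>.\<close>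
  have "(\<integral>x. x \<partial>slice \<nu> B) = (if (\<integral>\<^sup>+x. ennreal \<bar>x\<bar> \<partial>slice \<nu> B) < \<infinity>
      then enn2real (\<integral>\<^sup>+x. ennreal x \<partial>slice \<nu> B) - enn2real (\<integral>\<^sup>+x. ennreal (- x) \<partial>slice \<nu> B) else 0)" for \<nu>
  proof -
    have "(\<lambda>x. x) \<in> borel_measurable (slice \<nu> B)" by (simp add: measurable_cong_sets[OF sets_slice refl])
    then have iff: "integrable (slice \<nu> B) (\<lambda>x. x) \<longleftrightarrow> (\<integral>\<^sup>+x. ennreal \<bar>x\<bar> \<partial>slice \<nu> B) < \<infinity>"
      by (simp add: integrable_iff_bounded)
    show ?thesis
      unfolding iff[symmetric] by (simp add: real_lebesgue_integral_def not_integrable_integral_eq)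
  qed
  then show ?thesis by simp
qed

definition mean_measure :: "'w measure \<Rightarrow> ('w \<Rightarrow> ('a \<times> real) measure) \<Rightarrow> ('a \<times> real) measure" where
  "mean_measure P \<Psi> = measure_of (space J) (sets J) (\<lambda>C. \<integral>\<^sup>+\<omega>. emeasure (\<Psi> \<omega>) C \<partial>P)"

lemma sets_mean_measure [simp]: "sets (mean_measure P \<Psi>) = sets J"
  and space_mean_measure [simp]: "space (mean_measure P \<Psi>) = space J"
  by (simp_all add: mean_measure_def)

lemma emeasure_mean_measure:
  assumes s: "\<And>\<omega>. \<omega> \<in> space P \<Longrightarrow> sets (\<Psi> \<omega>) = sets J"
    and m: "\<And>C. C \<in> sets J \<Longrightarrow> (\<lambda>\<omega>. emeasure (\<Psi> \<omega>) C) \<in> borel_measurable P"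
    and C: "C \<in> sets J"
  shows "emeasure (mean_measure P \<Psi>) C = (\<integral>\<^sup>+\<omega>. emeasure (\<Psi> \<omega>) C \<partial>P)"
  unfolding mean_measure_def
proof (rule emeasure_measure_of_sigma)
  show "sigma_algebra (space J) (sets J)" ..
  show "positive (sets J) (\<lambda>C. \<integral>\<^sup>+\<omega>. emeasure (\<Psi> \<omega>) C \<partial>P)" by (simp add: positive_def)
  show "countably_additive (sets J) (\<lambda>C. \<integral>\<^sup>+\<omega>. emeasure (\<Psi> \<omega>) C \<partial>P)"
  proof (rule countably_additiveI)
    fix A :: "nat \<Rightarrow> _" assume A: "range A \<subseteq> sets J" "disjoint_family A" "(\<Union>i. A i) \<in> sets J"
    have "(\<Sum>i. \<integral>\<^sup>+\<omega>. emeasure (\<Psi> \<omega>) (A i) \<partial>P) = (\<integral>\<^sup>+\<omega>. (\<Sum>i. emeasure (\<Psi> \<omega>) (A i)) \<partial>P)"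
      using A by (intro nn_integral_suminf[symmetric] m) auto
    also have "\<dots> = (\<integral>\<^sup>+\<omega>. emeasure (\<Psi> \<omega>) (\<Union>i. A i) \<partial>P)"
      using A s by (intro nn_integral_cong suminf_emeasure) auto
    finally show "(\<Sum>i. \<integral>\<^sup>+\<omega>. emeasure (\<Psi> \<omega>) (A i) \<partial>P) = (\<integral>\<^sup>+\<omega>. emeasure (\<Psi> \<omega>) (\<Union>i. A i) \<partial>P)" .
  qed
qed fact

text \<open>Campbell's formula, by induction on \<open>f\<close>.\<close>

lemma nn_integral_slice_mean_measure:
  assumes s: "\<And>\<omega>. \<omega> \<in> space P \<Longrightarrow> sets (\<Psi> \<omega>) = sets J"
    and m: "\<And>C. C \<in> sets J \<Longrightarrow> (\<lambda>\<omega>. emeasure (\<Psi> \<omega>) C) \<in> borel_measurable P"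
    and B: "B \<in> sets M" and f: "f \<in> borel_measurable punctured_line"
  shows "(\<integral>\<^sup>+x. f x \<partial>slice (mean_measure P \<Psi>) B) = (\<integral>\<^sup>+\<omega>. \<integral>\<^sup>+x. f x \<partial>slice (\<Psi> \<omega>) B \<partial>P)"
proof -
  have sm: "borel_measurable (slice \<nu> B) = borel_measurable punctured_line" for \<nu>
    by (rule measurable_cong_sets) auto
  have nm: "(\<lambda>\<omega>. \<integral>\<^sup>+x. f x \<partial>slice (\<Psi> \<omega>) B) \<in> borel_measurable P" if "f \<in> borel_measurable punctured_line" for f
    using that by (intro nn_integral_slice_measurable[OF s B] m JR_sets) auto
  show ?thesis
    using f
  proof (induction rule: borel_measurable_induct)
    case (cong f g)
    then have "(\<integral>\<^sup>+x. f x \<partial>slice \<nu> B) = (\<integral>\<^sup>+x. g x \<partial>slice \<nu> B)" for \<nu>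
      by (intro nn_integral_cong) auto
    then show ?case using cong by simp
  next
    case (set A)
    have BA: "B \<times> A \<in> sets J" using B set by auto
    show ?case using set B s
      by (simp add: emeasure_slice emeasure_mean_measure[OF s m BA] cong: nn_integral_cong)
  next
    case (mult u c)
    then show ?case by (simp add: nn_integral_cmult sm nm)
  next
    case (add u v)
    then show ?case by (simp add: nn_integral_add sm nm)
  next
    case (seq U)
    have *: "(\<integral>\<^sup>+x. (SUP i. U i) x \<partial>slice \<nu> B) = (SUP i. \<integral>\<^sup>+x. U i x \<partial>slice \<nu> B)" for \<nu>
      unfolding SUP_apply using seq by (intro nn_integral_monotone_convergence_SUP) (simp_all add: sm)
    show ?case unfolding * using seq
      by (subst nn_integral_monotone_convergence_SUP)
        (auto simp: nm incseq_def le_fun_def intro!: nn_integral_mono)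
  qed
qed

end

section \<open>Removing the fixed atoms and the jumps\<close>

lemma (in prob_space) AE_ex: assumes "AE \<omega> in M. Q \<omega>" shows "\<exists>\<omega>\<in>space M. Q \<omega>"
proof -
  have "AE \<omega> in M. \<omega> \<in> space M \<and> Q \<omega>" using assms by auto
  then have "\<exists>\<omega>. \<omega> \<in> space M \<and> Q \<omega>"
    by (rule eventually_happens'[rotated]) (simp add: trivial_limit_def)
  then show ?thesis by blast
qed

lemma sets_signed_measure_algebra:
  "space (signed_measure_algebra R) = signed_measures R"
  "sets (signed_measure_algebra R) = sigma_sets (signed_measures R)
    {(\<lambda>\<mu>. \<mu> B) -` A \<inter> signed_measures R | B A. B \<in> R \<and> A \<in> sets borel}"
  unfolding signed_measure_algebra_def by (subst space_measure_of sets_measure_of; auto)+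

lemma measurable_signed_measure_algebra:
  "B \<in> R \<Longrightarrow> (\<lambda>\<mu>. \<mu> B) \<in> borel_measurable (signed_measure_algebra R)"
  by (rule measurableI) (auto simp: sets_signed_measure_algebra intro!: sigma_sets.Basic)

locale random_signed_measure = localized_borel M R + prob_space P
  for M :: "'a measure" and R and P :: "'w measure" +
  fixes \<xi> :: "'w \<Rightarrow> 'a set \<Rightarrow> real"
  assumes rsm: "\<xi> \<in> P \<rightarrow>\<^sub>M signed_measure_algebra R"
begin

lemma ca_xi: "\<omega> \<in> space P \<Longrightarrow> countably_additive_on R (\<xi> \<omega>)"
  using measurable_space[OF rsm] by (simp add: sets_signed_measure_algebra signed_measures_iff)

lemma xi_measurable: "B \<in> R \<Longrightarrow> (\<lambda>\<omega>. \<xi> \<omega> B) \<in> borel_measurable P"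
  by (rule measurable_compose[OF rsm measurable_signed_measure_algebra])

lemma sets_incr_alg_xi: "sets (incr_alg P R \<xi> E) \<subseteq> sets P"
  by (intro sets_incr_alg_subset xi_measurable)

definition fixed_atoms :: "'a set" where
  "fixed_atoms = {s \<in> space M. \<not> (AE \<omega> in P. \<xi> \<omega> {s} = 0)}"

text \<open>Infinitely many points of one bounded set with \<open>e s > 1 / real (Suc n)\<close> are
  impossible: along a sequence of them the atoms tend to 0 on every path by summability, hence so do
  the truncated means by dominated convergence.\<close>

lemma countable_fixed_atoms: "countable fixed_atoms"
proof -
  define e where "e s = expectation (\<lambda>\<omega>. min 1 \<bar>\<xi> \<omega> {s}\<bar>)" for s
  define D where "D m n = {s \<in> exh m. e s > 1 / real (Suc n)}" for m n
  have exM: "exh m \<subseteq> space M" for m using UN_exh by auto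
  have int: "integrable P (\<lambda>\<omega>. min 1 \<bar>\<xi> \<omega> {s}\<bar>)" if "s \<in> space M" for s
    using xi_measurable[OF singleton_R[OF that]] by (intro integrable_const_bound[where B = 1]) auto
  have "finite (D m n)" for m n
  proof (rule ccontr)
    assume "infinite (D m n)"
    then obtain s :: "nat \<Rightarrow> 'a" where s: "inj s" "range s \<subseteq> D m n"
      using infinite_countable_subset by blast
    have sM: "s k \<in> space M" "s k \<in> exh m" "e (s k) > 1 / real (Suc n)" for k
      using s(2) exM[of m] by (auto simp: D_def)
    have "(\<lambda>k. e (s k)) \<longlonglongrightarrow> expectation (\<lambda>\<omega>. 0)"
      unfolding e_def
    proof (rule integral_dominated_convergence[where w = "\<lambda>_. 1"])
      show "AE \<omega> in P. (\<lambda>k. min 1 \<bar>\<xi> \<omega> {s k}\<bar>) \<longlonglongrightarrow> 0"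
      proof (rule AE_I2)
        fix \<omega> assume w: "\<omega> \<in> space P"
        have R: "{s k} \<in> R" for k using sM by simp
        have "disjoint_family (\<lambda>k. {s k})" using s(1) by (auto simp: disjoint_family_on_def inj_def)
        moreover have "(\<Union>k. {s k}) \<in> R"
          using sM by (intro R_subset[OF exh_R[of m]] countable_sets) auto
        ultimately have "summable (\<lambda>k. \<bar>\<xi> \<omega> {s k}\<bar>)"
          by (rule countably_additive_onD(1)[OF ca_xi[OF w] R])
        then have "(\<lambda>k. \<bar>\<xi> \<omega> {s k}\<bar>) \<longlonglongrightarrow> 0" by (rule summable_LIMSEQ_zero)
        then have "(\<lambda>k. min 1 \<bar>\<xi> \<omega> {s k}\<bar>) \<longlonglongrightarrow> min 1 0" by (intro tendsto_min tendsto_const)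
        then show "(\<lambda>k. min 1 \<bar>\<xi> \<omega> {s k}\<bar>) \<longlonglongrightarrow> 0" by simp
      qed
      show "(\<lambda>\<omega>. min 1 \<bar>\<xi> \<omega> {s k}\<bar>) \<in> borel_measurable P" for k
        using int[OF sM(1)] by auto
    qed auto
    then have "\<forall>\<^sub>F k in sequentially. e (s k) < 1 / real (Suc n)"
      by (intro order_tendstoD(2)) (auto simp: prob_space)
    then obtain k where "e (s k) < 1 / real (Suc n)" by (auto simp: eventually_sequentially)
    then show False using sM(3)[of k] by simp
  qed
  then have "countable (\<Union>m. \<Union>n. D m n)" by (simp add: countable_finite)
  moreover have "fixed_atoms \<subseteq> (\<Union>m. \<Union>n. D m n)"
  proof
    fix s assume "s \<in> fixed_atoms"
    then have s: "s \<in> space M" "\<not> (AE \<omega> in P. \<xi> \<omega> {s} = 0)" by (auto simp: fixed_atoms_def)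
    have "e s \<noteq> 0"
    proof
      assume "e s = 0"
      then have "AE \<omega> in P. min 1 \<bar>\<xi> \<omega> {s}\<bar> = 0"
        unfolding e_def by (subst (asm) integral_nonneg_eq_0_iff_AE[OF int[OF s(1)]]) auto
      then have "AE \<omega> in P. \<xi> \<omega> {s} = 0" by eventually_elim (auto simp: min_def split: if_splits)
      then show False using s(2) by simp
    qed
    moreover have "e s \<ge> 0" unfolding e_def by (rule Bochner_Integration.integral_nonneg) simp
    ultimately obtain n where n: "inverse (real (Suc n)) < e s" using reals_Archimedean[of "e s"] by auto
    obtain m where "s \<in> exh m" using s(1) UN_exh by auto
    then show "s \<in> (\<Union>m. \<Union>n. D m n)" using n by (auto simp: D_def inverse_eq_divide)
  qed
  ultimately show ?thesis by (rule countable_subset[rotated])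
qed

lemma fixed_atoms_sets: "fixed_atoms \<in> sets M"
  using countable_fixed_atoms by (intro countable_sets) (auto simp: fixed_atoms_def)

definition \<eta> :: "'w \<Rightarrow> 'a set \<Rightarrow> real" where
  "\<eta> \<omega> B = \<xi> \<omega> (B \<inter> (space M - fixed_atoms))"

definition \<Psi> :: "'w \<Rightarrow> ('a \<times> real) measure" where
  "\<Psi> \<omega> = jumps (\<eta> \<omega>)"

definition \<zeta> :: "'w \<Rightarrow> 'a set \<Rightarrow> real" where
  "\<zeta> \<omega> B = \<eta> \<omega> B - (\<integral>x. x \<partial>slice (\<Psi> \<omega>) B)"

lemma ca_eta: "\<omega> \<in> space P \<Longrightarrow> countably_additive_on R (\<eta> \<omega>)"
  unfolding \<eta>_def using fixed_atoms_sets by (intro countably_additive_on_Int ca_xi) auto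

text \<open>\<open>\<eta>\<close> ignores the fixed atoms, so inclusion in \<open>E\<close> is
  required only off them. Taking for \<open>E\<close> the complement of \<open>fixed_atoms\<close>
  later yields independence from the fixed jumps.\<close>

lemma eta_measurable_incr:
  assumes "B \<in> R" "B - fixed_atoms \<subseteq> E"
  shows "(\<lambda>\<omega>. \<eta> \<omega> B) \<in> borel_measurable (incr_alg P R \<xi> E)"
proof -
  have "B \<inter> (space M - fixed_atoms) \<in> R" using fixed_atoms_sets assms(1) by (intro R_Int) auto
  then show ?thesis unfolding \<eta>_def using assms(2) by (intro measurable_incr_alg) auto
qed

lemma from_incr_alg: "f \<in> borel_measurable (incr_alg P R \<xi> E) \<Longrightarrow> f \<in> borel_measurable P"
  using sets_incr_alg_xi by (auto simp: measurable_def)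

lemma eta_measurable: "B \<in> R \<Longrightarrow> (\<lambda>\<omega>. \<eta> \<omega> B) \<in> borel_measurable P"
  by (rule from_incr_alg[OF eta_measurable_incr[where E = UNIV]]) auto

lemma eta_singleton_AE: "s \<in> space M \<Longrightarrow> AE \<omega> in P. \<eta> \<omega> {s} = 0"
proof -
  assume s: "s \<in> space M"
  show ?thesis
  proof (cases "s \<in> fixed_atoms")
    case True
    then have "\<eta> \<omega> {s} = 0" if "\<omega> \<in> space P" for \<omega>
      using ca_xi[OF that] by (simp add: \<eta>_def countably_additive_on_def)
    then show ?thesis by auto
  next
    case False
    then have "\<eta> \<omega> {s} = \<xi> \<omega> {s}" for \<omega> using s by (simp add: \<eta>_def)
    then show ?thesis using False s by (simp add: fixed_atoms_def)
  qed
qed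

lemma sets_Psi [simp]: "sets (\<Psi> \<omega>) = sets J" and space_Psi [simp]: "space (\<Psi> \<omega>) = space J"
  by (simp_all add: \<Psi>_def)

lemma Psi_measurable_incr:
  assumes "C \<in> sets J" "C \<subseteq> B \<times> UNIV" "B \<in> sets M" "B - fixed_atoms \<subseteq> E"
  shows "(\<lambda>\<omega>. emeasure (\<Psi> \<omega>) C) \<in> borel_measurable (incr_alg P R \<xi> E)"
  unfolding \<Psi>_def
  using assms by (intro measurable_jumps[where ?B0.0 = B] ca_eta eta_measurable_incr) auto

lemma Psi_measurable: "C \<in> sets J \<Longrightarrow> (\<lambda>\<omega>. emeasure (\<Psi> \<omega>) C) \<in> borel_measurable P"
  by (rule from_incr_alg[OF Psi_measurable_incr[where B = "space M" and E = UNIV]])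
    (use sets.sets_into_space[of C J] in \<open>auto simp: space_jump_space\<close>)

text \<open>On each path \<open>\<zeta>\<close> is \<open>\<eta>\<close> restricted to the
  complement of its own atoms. The definition through the integral gives measurability; this form
  gives countable additivity.\<close>

lemma zeta_eq:
  assumes "\<omega> \<in> space P" "B \<in> R"
  shows "\<zeta> \<omega> B = \<eta> \<omega> (B \<inter> (space M - {t \<in> space M. \<eta> \<omega> {t} \<noteq> 0}))"
proof -
  let ?A = "{t \<in> B. \<eta> \<omega> {t} \<noteq> 0}"
  have BM: "B \<subseteq> space M" using sets.sets_into_space[OF R_sets[OF assms(2)]] .
  have "\<zeta> \<omega> B = \<eta> \<omega> B - \<eta> \<omega> ?A"
    unfolding \<zeta>_def \<Psi>_def slice_jumps_integral(2)[OF ca_eta[OF assms(1)] assms(2)] ..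
  also have "\<dots> = \<eta> \<omega> (B - ?A)"
    using BM countable_atoms[OF ca_eta[OF assms(1)] assms(2)]
    by (intro Diff_on[OF ca_eta[OF assms(1)] assms(2), symmetric] countable_sets) auto
  also have "B - ?A = B \<inter> (space M - {t \<in> space M. \<eta> \<omega> {t} \<noteq> 0})" using BM by auto
  finally show ?thesis .
qed

lemma ca_zeta: assumes w: "\<omega> \<in> space P" shows "countably_additive_on R (\<zeta> \<omega>)"
proof -
  let ?E = "space M - {t \<in> space M. \<eta> \<omega> {t} \<noteq> 0}"
  have "countably_additive_on R (\<lambda>B. \<eta> \<omega> (B \<inter> ?E))"
    using countable_all_atoms[OF ca_eta[OF w]]
    by (intro countably_additive_on_Int[OF ca_eta[OF w]] sets.compl_sets countable_sets) auto
  moreover have "countably_additive_on R \<mu> \<Longrightarrow> (\<And>B. B \<in> R \<Longrightarrow> \<nu> B = \<mu> B) \<Longrightarrow> countably_additive_on R \<nu>" for \<mu> \<nu> :: "'a set \<Rightarrow> real"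
    unfolding countably_additive_on_def by (auto simp: image_subset_iff)
  ultimately show ?thesis using zeta_eq[OF w] by blast
qed

lemma zeta_singleton: "\<omega> \<in> space P \<Longrightarrow> s \<in> space M \<Longrightarrow> \<zeta> \<omega> {s} = 0"
  using ca_eta[of \<omega>] by (cases "\<eta> \<omega> {s} = 0") (auto simp: zeta_eq countably_additive_on_def)

lemma zeta_measurable_incr:
  assumes "B \<in> R" "B \<subseteq> E" shows "(\<lambda>\<omega>. \<zeta> \<omega> B) \<in> borel_measurable (incr_alg P R \<xi> E)"
proof -
  have "(\<lambda>\<omega>. \<integral>x. x \<partial>slice (\<Psi> \<omega>) B) \<in> borel_measurable (incr_alg P R \<xi> E)"
    using assms R_sets[OF assms(1)]
    by (intro integral_slice_measurable Psi_measurable_incr[where B = B] JR_sets) auto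
  moreover have "(\<lambda>\<omega>. \<eta> \<omega> B) \<in> borel_measurable (incr_alg P R \<xi> E)"
    using assms by (intro eta_measurable_incr) auto
  ultimately show ?thesis unfolding \<zeta>_def by measurable
qed

end

section \<open>The atomless part is deterministic\<close>

locale indep_signed_measure = random_signed_measure M R P \<xi>
  for M :: "'a measure" and R and P :: "'w measure" and \<xi> +
  assumes indep_xi: "indep_increments P R \<xi>"
begin

lemma indep_sets_xi:
  assumes "disjoint_family_on E I"
  shows "indep_sets (\<lambda>i. sets (incr_alg P R \<xi> (E i))) I"
proof (rule indep_sets_incr_alg[OF ring indep_xi _ _ assms])
  show "\<xi> \<omega> {} = 0" if "\<omega> \<in> space P" for \<omega>
    using ca_xi[OF that] by (simp add: countably_additive_on_def)
  show "\<xi> \<omega> (A \<union> B) = \<xi> \<omega> A + \<xi> \<omega> B" if "\<omega> \<in> space P" "A \<in> R" "B \<in> R" "A \<inter> B = {}" for \<omega> A B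
    using that by (intro additive_on[OF ca_xi])
qed

lemma indep_cells:
  assumes "\<And>k. f k \<in> borel_measurable (incr_alg P R \<xi> (cells n k))"
  shows "indep_vars (\<lambda>_. borel) f K"
proof (rule indep_vars_incr_alg[OF indep_sets_xi])
  show "disjoint_family_on (cells n) K" using disjoint_cells[of n] by (auto simp: disjoint_family_on_def)
qed (rule assms)

text \<open>The rows consist of the masses of \<open>\<zeta>\<close> on the cells of
  \<open>B\<close>: each is a functional of the increments inside its own cell, and every row adds
  up to \<open>\<zeta> \<omega> B\<close>.\<close>

lemma zeta_const:
  assumes B: "B \<in> R" shows "\<exists>c. AE \<omega> in P. \<zeta> \<omega> B = c"
proof (rule small_row_sums_const[where K = "\<lambda>n. {..2 ^ n}" and Y = "\<lambda>n k \<omega>. \<zeta> \<omega> (B \<inter> cells n k)"])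
  have BM: "B \<subseteq> space M" using sets.sets_into_space[OF R_sets[OF B]] .
  show "indep_vars (\<lambda>_. borel) (\<lambda>k \<omega>. \<zeta> \<omega> (B \<inter> cells n k)) {..2 ^ n}" for n
    using B by (intro indep_cells zeta_measurable_incr R_Int) auto
  show "\<exists>v. \<forall>n. (\<Sum>k\<in>{..2 ^ n}. \<bar>\<zeta> \<omega> (B \<inter> cells n k)\<bar>) \<le> v" if "\<omega> \<in> space P" for \<omega>
    by (rule sum_abs_cells_bound[OF ca_zeta[OF that] B])
  show "(\<Sum>k\<in>{..2 ^ n}. \<zeta> \<omega> (B \<inter> cells n k)) = \<zeta> \<omega> B" if "\<omega> \<in> space P" for \<omega> n
    by (rule sum_cells[OF ca_zeta[OF that] B])
  show "(\<lambda>n. \<Sum>k\<in>{..2 ^ n}. (\<zeta> \<omega> (B \<inter> cells n k))\<^sup>2) \<longlonglongrightarrow> 0" if "\<omega> \<in> space P" for \<omega>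
    using BM by (intro diffuse_sum_cells_square ca_zeta that B zeta_singleton) auto
qed simp

definition \<alpha> :: "'a set \<Rightarrow> real" where "\<alpha> B = (SOME c. AE \<omega> in P. \<zeta> \<omega> B = c)"

lemma AE_zeta: "B \<in> R \<Longrightarrow> AE \<omega> in P. \<zeta> \<omega> B = \<alpha> B"
  unfolding \<alpha>_def by (rule someI_ex[OF zeta_const])

text \<open>The constants were chosen separately for each set. One instance of countable additivity
  involves only countably many of them, so some path takes all these values at once and passes its
  additivity on.\<close>

lemma ca_alpha: "countably_additive_on R \<alpha>"
  unfolding countably_additive_on_def
proof (intro conjI allI impI)
  obtain \<omega> where "\<omega> \<in> space P" "\<zeta> \<omega> {} = \<alpha> {}" using AE_ex[OF AE_zeta[OF R_empty]] by blast
  then show "\<alpha> {} = 0" using ca_zeta[of \<omega>] by (simp add: countably_additive_on_def)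
  fix A :: "nat \<Rightarrow> 'a set" assume A: "range A \<subseteq> R \<and> disjoint_family A \<and> (\<Union>k. A k) \<in> R"
  then have AR: "A k \<in> R" for k by auto
  have "AE \<omega> in P. (\<forall>k. \<zeta> \<omega> (A k) = \<alpha> (A k)) \<and> \<zeta> \<omega> (\<Union>k. A k) = \<alpha> (\<Union>k. A k)"
    using AE_zeta[OF AR] AE_zeta A by (auto simp: AE_all_countable)
  then obtain \<omega> where w: "\<omega> \<in> space P" "\<And>k. \<zeta> \<omega> (A k) = \<alpha> (A k)" "\<zeta> \<omega> (\<Union>k. A k) = \<alpha> (\<Union>k. A k)"
    using AE_ex by blast
  show "summable (\<lambda>k. \<bar>\<alpha> (A k)\<bar>)" "(\<lambda>k. \<alpha> (A k)) sums \<alpha> (\<Union>k. A k)"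
    using countably_additive_onD[where A = A, OF ca_zeta[OF w(1)] AR] A w by auto
qed

lemma alpha_singleton: assumes "s \<in> space M" shows "\<alpha> {s} = 0"
  using AE_ex[OF AE_zeta[OF singleton_R[OF assms]]] zeta_singleton assms by fastforce

lemma atomless_difference_alpha: "atomless_difference M R \<alpha>"
proof -
  obtain p q where pq: "loc_finite M R p" "loc_finite M R q" "\<forall>B\<in>R. \<alpha> B = measure p B - measure q B"
    "\<forall>s\<in>space M. measure p {s} = max 0 (\<alpha> {s})" "\<forall>s\<in>space M. measure q {s} = max 0 (- \<alpha> {s})"
    using jordan_decomposition[OF ca_alpha] by blast
  have "atomless r" if r: "loc_finite M R r" "\<forall>s\<in>space M. measure r {s} = 0" for r
    unfolding atomless_def
  proof
    fix s assume "s \<in> space r"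
    then have s: "s \<in> space M" using r(1) sets_eq_imp_space_eq[of r M] by (auto simp: loc_finite_def)
    then have "emeasure r {s} = ennreal (measure r {s})"
      using r(1) singleton_R[OF s] unfolding loc_finite_def
      by (intro emeasure_eq_ennreal_measure) (metis infinity_ennreal_def less_irrefl)
    then show "emeasure r {s} = 0" using r(2) s by simp
  qed
  then have "atomless p" "atomless q" using pq(1,2,4,5) alpha_singleton by simp_all
  then show ?thesis unfolding atomless_difference_def using pq(1-3) by blast
qed

text \<open>The exceptional null set may depend on \<open>B\<close>. It suffices to discard those of
  the countably many sets \<open>exh m \<inter> cells n k\<close>, which determine the difference of
  \<open>\<zeta>\<close> and \<open>\<alpha>\<close>.\<close>

lemma AE_zeta_all: "AE \<omega> in P. \<forall>B\<in>R. \<zeta> \<omega> B = \<alpha> B"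
proof -
  have "AE \<omega> in P. \<forall>m n k. \<zeta> \<omega> (exh m \<inter> cells n k) = \<alpha> (exh m \<inter> cells n k)"
    unfolding AE_all_countable by (intro allI AE_zeta R_Int) auto
  then show ?thesis
  proof (rule AE_mp, intro AE_I2 impI ballI)
    fix \<omega> B assume w: "\<omega> \<in> space P" "\<forall>m n k. \<zeta> \<omega> (exh m \<inter> cells n k) = \<alpha> (exh m \<inter> cells n k)" and B: "B \<in> R"
    have "\<zeta> \<omega> B - \<alpha> B = 0"
      using w(2) by (intro signed_eq_0[OF countably_additive_on_diff[OF ca_zeta[OF w(1)] ca_alpha] _ B]) simp
    then show "\<zeta> \<omega> B = \<alpha> B" by simp
  qed
qed

end

section \<open>Poisson law of the jumps\<close>

text \<open>Equality is given only on \<open>0 \<le> t\<close> and \<open>t < 1\<close>, as for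
  generating functions. The first coefficient of the difference not yet known to vanish is isolated
  by dividing by \<open>x ^ m\<close> and letting \<open>x\<close> decrease to 0.\<close>

lemma power_series_unique:
  fixes a b :: "nat \<Rightarrow> real"
  assumes a: "\<And>t. 0 \<le> t \<Longrightarrow> t < 1 \<Longrightarrow> (\<lambda>k. a k * t ^ k) sums f t"
    and b: "\<And>t. 0 \<le> t \<Longrightarrow> t < 1 \<Longrightarrow> (\<lambda>k. b k * t ^ k) sums f t"
  shows "a k = b k"
proof -
  define d where "d k = a k - b k" for k
  have d: "(\<lambda>k. d k * t ^ k) sums 0" if "0 \<le> t" "t < 1" for t
    using sums_diff[OF a[OF that] b[OF that]] by (simp add: d_def left_diff_distrib)
  have "d k = 0"
  proof (induction k rule: less_induct)
    case (less m)
    define f where "f x = (\<Sum>k. d (k + m) * x ^ k)" for x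
    have half: "summable (\<lambda>k. d k * (1 / 2) ^ k)"
      by (rule sums_summable[OF d]) auto
    then have "summable (\<lambda>k. d (k + m) * (1 / 2) ^ (k + m))" by (rule summable_ignore_initial_segment)
    then have "summable (\<lambda>k. d (k + m) * (1 / 2) ^ (k + m) * 2 ^ m)" by (rule summable_mult2)
    then have half': "summable (\<lambda>k. d (k + m) * (1 / 2) ^ k)" by (simp add: power_add field_simps)
    have sm: "(\<lambda>k. d (k + m) * x ^ k) sums f x" if "norm x < 1 / 2" for x
      unfolding f_def using that by (intro summable_sums powser_inside[OF half']) simp
    have lim: "(f \<longlongrightarrow> d (0 + m)) (at 0)"
      by (rule powser_limit_0[where s = "1 / 2", OF _ sm]) auto
    have f0: "f x = 0" if x: "0 < x" "x < 1 / 2" for x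
    proof -
      have "(\<lambda>k. d (k + m) * x ^ (k + m)) sums (0 - (\<Sum>k<m. d k * x ^ k))"
        using x by (intro sums_split_initial_segment d) auto
      then have "(\<lambda>k. x ^ m * (d (k + m) * x ^ k)) sums 0" using less by (simp add: power_add ac_simps)
      moreover have "(\<lambda>k. x ^ m * (d (k + m) * x ^ k)) sums (x ^ m * f x)"
        using x by (intro sums_mult sm) auto
      ultimately have "x ^ m * f x = 0" by (rule sums_unique2[symmetric])
      then show ?thesis using x by simp
    qed
    \<comment> \<open>The shift by 3 keeps the points below 1/2, where \<open>f\<close> is known to
      vanish.\<close>
    have "filterlim (\<lambda>n. 1 / real (n + 3)) (at 0) sequentially"
      unfolding filterlim_at
    proof
      show "(\<lambda>n. 1 / real (n + 3)) \<longlonglongrightarrow> 0"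
        by (rule LIMSEQ_ignore_initial_segment[OF lim_1_over_n])
    qed auto
    from filterlim_compose[OF lim this] have "(\<lambda>n. f (1 / real (n + 3))) \<longlonglongrightarrow> d m" by simp
    moreover have "(\<lambda>n. f (1 / real (n + 3))) = (\<lambda>_. 0)"
      by (intro ext f0) (simp_all add: field_simps)
    ultimately have "(\<lambda>_::nat. 0) \<longlonglongrightarrow> d m" by simp
    then show ?case by (simp add: LIMSEQ_const_iff)
  qed
  then show ?thesis by (simp add: d_def)
qed

definition poisson_weight :: "real \<Rightarrow> nat \<Rightarrow> real" where
  "poisson_weight l k = l ^ k / fact k * exp (- l)"

context prob_space
begin

text \<open>The right-hand side of \<open>pgf\<close> is the generating function of
  \<open>poisson_weight l\<close>, scaled by \<open>c\<close>. The factor \<open>Z\<close> is there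
  to hold the contributions of further coordinates, so that a joint transform can be inverted one
  coordinate at a time.\<close>

lemma poisson_weight_of_transform:
  assumes N: "N \<in> M \<rightarrow>\<^sub>M count_space UNIV" and Z: "Z \<in> borel_measurable M" "\<And>\<omega>. \<bar>Z \<omega>\<bar> \<le> 1"
    and pgf: "\<And>t. 0 \<le> t \<Longrightarrow> t \<le> 1 \<Longrightarrow> expectation (\<lambda>\<omega>. Z \<omega> * t ^ N \<omega>) = c * exp (- ((1 - t) * l))"
  shows "expectation (\<lambda>\<omega>. Z \<omega> * (if N \<omega> = k then 1 else 0)) = c * poisson_weight l k"
proof -
  note [measurable] = N Z(1)
  define a where "a k = expectation (\<lambda>\<omega>. Z \<omega> * (if N \<omega> = k then 1 else 0))" for k
  have "a k = c * poisson_weight l k"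
  proof (rule power_series_unique[where f = "\<lambda>t. c * exp (- ((1 - t) * l))"])
    fix t :: real assume t: "0 \<le> t" "t < 1"
    have i: "integrable M (\<lambda>\<omega>. Z \<omega> * (if N \<omega> = k then 1 else 0) * t ^ k)" for k
    proof (rule integrable_const_bound[where B = 1])
      show "AE \<omega> in M. norm (Z \<omega> * (if N \<omega> = k then 1 else 0) * t ^ k) \<le> 1"
        using Z(2) t by (auto simp: abs_mult power_abs intro!: mult_le_one power_le_one AE_I2)
    qed measurable
    have "(\<lambda>k. expectation (\<lambda>\<omega>. Z \<omega> * (if N \<omega> = k then 1 else 0) * t ^ k)) sums
        expectation (\<lambda>\<omega>. \<Sum>k. Z \<omega> * (if N \<omega> = k then 1 else 0) * t ^ k)"
    proof (rule sums_integral[OF i])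
      show "AE \<omega> in M. summable (\<lambda>k. norm (Z \<omega> * (if N \<omega> = k then 1 else 0) * t ^ k))"
        by (intro AE_I2 summable_finite[of "{N _}"]) auto
      show "summable (\<lambda>k. expectation (\<lambda>\<omega>. norm (Z \<omega> * (if N \<omega> = k then 1 else 0) * t ^ k)))"
      proof (rule summable_comparison_test'[OF summable_geometric[of t], of 0])
        fix k :: nat
        have "expectation (\<lambda>\<omega>. norm (Z \<omega> * (if N \<omega> = k then 1 else 0) * t ^ k)) \<le> expectation (\<lambda>\<omega>. t ^ k)"
        proof (rule integral_mono)
          show "norm (Z \<omega> * (if N \<omega> = k then 1 else 0) * t ^ k) \<le> t ^ k" for \<omega>
            using Z(2)[of \<omega>] t mult_right_mono[of "\<bar>Z \<omega>\<bar>" 1 "t ^ k"] by (auto simp: abs_mult power_abs)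
        qed (use i in auto)
        then show "norm (expectation (\<lambda>\<omega>. norm (Z \<omega> * (if N \<omega> = k then 1 else 0) * t ^ k))) \<le> t ^ k"
          by (simp add: prob_space)
      qed (use t in auto)
    qed
    moreover have "(\<Sum>k. Z \<omega> * (if N \<omega> = k then 1 else 0) * t ^ k) = Z \<omega> * t ^ N \<omega>" for \<omega>
      by (subst suminf_finite[of "{N \<omega>}"]) auto
    ultimately show "(\<lambda>k. a k * t ^ k) sums (c * exp (- ((1 - t) * l)))"
      using pgf[of t] t by (simp add: a_def)
    have "(\<lambda>k. c * exp (- l) * ((l * t) ^ k /\<^sub>R fact k)) sums (c * exp (- l) * exp (l * t))"
      by (intro sums_mult exp_converges)
    moreover have "c * exp (- l) * exp (l * t) = c * exp (- ((1 - t) * l))"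
      by (simp add: exp_add[symmetric] mult.assoc algebra_simps)
    moreover have "(\<lambda>k. c * poisson_weight l k * t ^ k) = (\<lambda>k. c * exp (- l) * ((l * t) ^ k /\<^sub>R fact k))"
      by (simp add: poisson_weight_def power_mult_distrib divide_inverse ac_simps)
    ultimately show "(\<lambda>k. c * poisson_weight l k * t ^ k) sums (c * exp (- ((1 - t) * l)))" by metis
  qed
  then show ?thesis by (simp add: a_def)
qed

text \<open>Induction on the set \<open>A\<close> of coordinates already inverted: these appear as
  indicators, the remaining ones through their transform with free arguments
  \<open>t i\<close>.\<close>

lemma joint_poisson_of_pgf:
  assumes I: "finite I" and N: "\<And>i. i \<in> I \<Longrightarrow> N i \<in> M \<rightarrow>\<^sub>M count_space UNIV"
    and pgf: "\<And>t. (\<And>i. i \<in> I \<Longrightarrow> 0 \<le> t i \<and> t i \<le> 1) \<Longrightarrow>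
      expectation (\<lambda>\<omega>. \<Prod>i\<in>I. t i ^ N i \<omega>) = (\<Prod>i\<in>I. exp (- ((1 - t i) * l i)))"
  shows "prob {\<omega>\<in>space M. \<forall>i\<in>I. N i \<omega> = k i} = (\<Prod>i\<in>I. poisson_weight (l i) (k i))"
proof -
  have "\<forall>t. (\<forall>i\<in>I. 0 \<le> t i \<and> t i \<le> 1) \<longrightarrow>
     expectation (\<lambda>\<omega>. (\<Prod>i\<in>A. if N i \<omega> = k i then 1 else 0) * (\<Prod>i\<in>I - A. t i ^ N i \<omega>))
     = (\<Prod>i\<in>A. poisson_weight (l i) (k i)) * (\<Prod>i\<in>I - A. exp (- ((1 - t i) * l i)))" if "A \<subseteq> I" for A
    using finite_subset[OF that I] that
  proof (induction A rule: finite_induct)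
    case empty
    then show ?case using pgf by simp
  next
    case (insert j A)
    show ?case
    proof (intro allI impI)
      fix t :: "'b \<Rightarrow> real" assume t: "\<forall>i\<in>I. 0 \<le> t i \<and> t i \<le> 1"
      have j: "j \<in> I" using insert by auto
      have split: "I - A = insert j (I - insert j A)" using insert by auto
      have fin: "finite (I - insert j A)" using I by simp
      define Z where "Z \<omega> = (\<Prod>i\<in>A. if N i \<omega> = k i then 1 else 0) * (\<Prod>i\<in>I - insert j A. t i ^ N i \<omega>)" for \<omega>
      define c where "c = (\<Prod>i\<in>A. poisson_weight (l i) (k i)) * (\<Prod>i\<in>I - insert j A. exp (- ((1 - t i) * l i)))"
      have "expectation (\<lambda>\<omega>. Z \<omega> * (if N j \<omega> = k j then 1 else 0)) = c * poisson_weight (l j) (k j)"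
      proof (rule poisson_weight_of_transform[OF N[OF j]])
        have m1: "(\<lambda>\<omega>. if N i \<omega> = k i then 1 else 0 :: real) \<in> borel_measurable M" if "i \<in> I" for i
          using N[OF that] by measurable
        have m2: "(\<lambda>\<omega>. t i ^ N i \<omega>) \<in> borel_measurable M" if "i \<in> I" for i
          using N[OF that] by (rule measurable_compose) simp
        show "Z \<in> borel_measurable M"
          unfolding Z_def using insert.prems by (intro borel_measurable_times borel_measurable_prod m1 m2) auto
        show "\<bar>Z \<omega>\<bar> \<le> 1" for \<omega>
        proof -
          have "0 \<le> (\<Prod>i\<in>A. if N i \<omega> = k i then 1 else 0 :: real)" by (intro prod_nonneg) auto
          moreover have "(\<Prod>i\<in>A. if N i \<omega> = k i then 1 else 0 :: real) \<le> 1" by (intro prod_le_1) auto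
          moreover have "0 \<le> (\<Prod>i\<in>I - insert j A. t i ^ N i \<omega>)" using t by (intro prod_nonneg) auto
          moreover have "(\<Prod>i\<in>I - insert j A. t i ^ N i \<omega>) \<le> 1" using t by (intro prod_le_1) (auto intro!: power_le_one)
          ultimately show ?thesis unfolding Z_def by (simp add: abs_mult mult_le_one)
        qed
        fix s :: real assume s: "0 \<le> s" "s \<le> 1"
        \<comment> \<open>Only the argument of coordinate \<open>j\<close> varies, which turns the
          induction hypothesis into the transform of \<open>N j\<close> against
          \<open>Z\<close>.\<close>
        have "\<forall>i\<in>I. 0 \<le> (t(j := s)) i \<and> (t(j := s)) i \<le> 1" using s t by auto
        with insert.IH insert.prems have "expectation (\<lambda>\<omega>. (\<Prod>i\<in>A. if N i \<omega> = k i then 1 else 0) * (\<Prod>i\<in>I - A. (t(j := s)) i ^ N i \<omega>))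
          = (\<Prod>i\<in>A. poisson_weight (l i) (k i)) * (\<Prod>i\<in>I - A. exp (- ((1 - (t(j := s)) i) * l i)))"
          by blast
        moreover have "(\<Prod>i\<in>I - A. (t(j := s)) i ^ N i \<omega>) = s ^ N j \<omega> * (\<Prod>i\<in>I - insert j A. t i ^ N i \<omega>)" for \<omega>
          unfolding split using fin by (subst prod.insert) (auto intro!: prod.cong)
        moreover have "(\<Prod>i\<in>I - A. exp (- ((1 - (t(j := s)) i) * l i))) = exp (- ((1 - s) * l j)) * (\<Prod>i\<in>I - insert j A. exp (- ((1 - t i) * l i)))"
          unfolding split using fin by (subst prod.insert) (auto intro!: prod.cong)
        ultimately show "expectation (\<lambda>\<omega>. Z \<omega> * s ^ N j \<omega>) = c * exp (- ((1 - s) * l j))"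
          by (simp add: Z_def c_def ac_simps)
      qed
      then show "expectation (\<lambda>\<omega>. (\<Prod>i\<in>insert j A. if N i \<omega> = k i then 1 else 0) * (\<Prod>i\<in>I - insert j A. t i ^ N i \<omega>))
        = (\<Prod>i\<in>insert j A. poisson_weight (l i) (k i)) * (\<Prod>i\<in>I - insert j A. exp (- ((1 - t i) * l i)))"
        using insert(1,2) by (simp add: Z_def c_def ac_simps)
    qed
  qed
  from this[OF subset_refl, rule_format, of "\<lambda>_. 1"]
  have "expectation (\<lambda>\<omega>. \<Prod>i\<in>I. if N i \<omega> = k i then 1 else 0) = (\<Prod>i\<in>I. poisson_weight (l i) (k i))" by simp
  also have "(\<lambda>\<omega>. \<Prod>i\<in>I. if N i \<omega> = k i then 1 else 0 :: real) = indicator {\<omega>. \<forall>i\<in>I. N i \<omega> = k i}"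
    using I by (auto simp: indicator_def fun_eq_iff)
  finally show ?thesis by (simp add: Int_def conj_commute)
qed

text \<open>Together with the empty set, the events \<open>N i \<omega> = k\<close> are stable under
  intersection, and they generate because the values are countable.\<close>

lemma indep_vars_nat:
  assumes N: "\<And>i. i \<in> I \<Longrightarrow> N i \<in> M \<rightarrow>\<^sub>M count_space (UNIV :: nat set)"
    and prod: "\<And>A k. A \<subseteq> I \<Longrightarrow> finite A \<Longrightarrow>
      prob {\<omega>\<in>space M. \<forall>i\<in>A. N i \<omega> = k i} = (\<Prod>i\<in>A. prob {\<omega>\<in>space M. N i \<omega> = k i})"
  shows "indep_vars (\<lambda>_. count_space UNIV) N I"
proof -
  define G where "G i = insert {} (range (\<lambda>k. {\<omega>\<in>space M. N i \<omega> = k}))" for i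
  have ev: "{\<omega>\<in>space M. N i \<omega> = k} \<in> events" if "i \<in> I" for i k
    using N[OF that] by measurable
  have "indep_sets G I"
    unfolding indep_sets_def
  proof (intro conjI ballI allI impI)
    show "G i \<subseteq> events" if "i \<in> I" for i using ev[OF that] by (auto simp: G_def)
  next
    fix A X assume A: "A \<subseteq> I" "A \<noteq> {}" "finite A" and X: "X \<in> Pi A G"
    show "prob (\<Inter>j\<in>A. X j) = (\<Prod>j\<in>A. prob (X j))"
    proof (cases "\<exists>j\<in>A. X j = {}")
      case True
      then have "(\<Inter>j\<in>A. X j) = {}" by auto
      moreover have "(\<Prod>j\<in>A. prob (X j)) = 0" using True A(3) by (intro prod_zero) (auto intro: bexI[rotated])
      ultimately show ?thesis by simp
    next
      case False
      have "\<exists>k. X j = {\<omega>\<in>space M. N j \<omega> = k}" if "j \<in> A" for j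
      proof -
        have "X j \<in> G j" "X j \<noteq> {}" using X False that by auto
        then show ?thesis by (auto simp: G_def)
      qed
      then obtain k where k: "\<And>j. j \<in> A \<Longrightarrow> X j = {\<omega>\<in>space M. N j \<omega> = k j}" by metis
      then have "(\<Inter>j\<in>A. X j) = {\<omega>\<in>space M. \<forall>i\<in>A. N i \<omega> = k i}" using A(2) by auto
      then show ?thesis using prod[OF A(1,3)] k by simp
    qed
  qed
  moreover have "Int_stable (G i)" for i by (auto simp: Int_stable_def G_def)
  ultimately have ind: "indep_sets (\<lambda>i. sigma_sets (space M) (G i)) I" by (rule indep_sets_sigma)
  have "indep_sets (\<lambda>i. {N i -` A \<inter> space M |A. A \<in> sets (count_space UNIV)}) I"
  proof (rule indep_sets_mono_sets[OF ind])
    fix i assume "i \<in> I"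
    show "{N i -` A \<inter> space M |A. A \<in> sets (count_space UNIV)} \<subseteq> sigma_sets (space M) (G i)"
    proof safe
      fix A :: "nat set"
      have "N i -` A \<inter> space M = (\<Union>k. if k \<in> A then {\<omega>\<in>space M. N i \<omega> = k} else {})" by auto
      moreover have "\<dots> \<in> sigma_sets (space M) (G i)"
        by (rule sigma_sets.Union) (auto simp: G_def intro: sigma_sets.Basic sigma_sets.Empty)
      ultimately show "N i -` A \<inter> space M \<in> sigma_sets (space M) (G i)" by metis
    qed
  qed
  then show ?thesis unfolding indep_vars_def2 using N by blast
qed

end

section \<open>Projection of measures on the jump space to locations\<close>

context localized_borel
begin

abbreviation strip :: "'a set \<Rightarrow> ('a \<times> real) set" where
  "strip A \<equiv> A \<times> (UNIV - {0})"

lemma strip_sets [simp]: "A \<in> sets M \<Longrightarrow> strip A \<in> sets J"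
  by (rule Times_jump_space) (auto simp: sets_punctured_line)

lemma UN_strip_cells:
  assumes "U \<in> sets J" shows "(\<Union>k\<le>2 ^ n. U \<inter> strip (cells n k)) = U"
  using sets.sets_into_space[OF assms] UN_cells[of n] unfolding space_jump_space by blast

lemma disjoint_strip_cells: "disjoint_family_on (\<lambda>k. U \<inter> strip (cells n k)) K"
  using disjoint_cells[of n] by (auto simp: disjoint_family_on_def)

text \<open>The part of \<open>\<nu>\<close> in \<open>U\<close>, projected to its locations; it
  makes the estimates for cells available on the jump space.\<close>

definition base :: "('a \<times> real) measure \<Rightarrow> ('a \<times> real) set \<Rightarrow> 'a measure" where
  "base \<nu> U = distr (density \<nu> (indicator U)) M fst"

lemma sets_base [simp]: "sets (base \<nu> U) = sets M" and space_base [simp]: "space (base \<nu> U) = space M"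
  by (simp_all add: base_def)

lemma emeasure_base:
  assumes \<nu>: "sets \<nu> = sets J" and U: "U \<in> sets J" and A: "A \<in> sets M"
  shows "emeasure (base \<nu> U) A = emeasure \<nu> (U \<inter> strip A)"
proof -
  have sp: "space \<nu> = space J" using \<nu> by (rule sets_eq_imp_space_eq)
  have AM: "A \<subseteq> space M" using sets.sets_into_space[OF A] .
  have f: "fst \<in> density \<nu> (indicator U) \<rightarrow>\<^sub>M M"
    using fst_jump_space[of M] by (simp add: measurable_cong_sets[OF \<nu> refl])
  have eq: "fst -` A \<inter> space (density \<nu> (indicator U)) = strip A"
    using AM by (auto simp: sp space_jump_space)
  have "emeasure (base \<nu> U) A = emeasure (density \<nu> (indicator U)) (strip A)"
    unfolding base_def by (subst emeasure_distr[OF f A]) (simp only: eq)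
  also have "\<dots> = emeasure \<nu> (U \<inter> strip A)"
  proof -
    have m: "U \<inter> strip A \<in> sets \<nu>" unfolding \<nu> using U A by (intro sets.Int strip_sets)
    show ?thesis using U A \<nu>
      by (subst emeasure_density) (simp_all add: indicator_inter_arith[symmetric] nn_integral_indicator[OF m])
  qed
  finally show ?thesis .
qed

lemma measure_base:
  "sets \<nu> = sets J \<Longrightarrow> U \<in> sets J \<Longrightarrow> A \<in> sets M \<Longrightarrow> measure (base \<nu> U) A = measure \<nu> (U \<inter> strip A)"
  by (simp add: measure_def emeasure_base)

lemma finite_base:
  assumes "sets \<nu> = sets J" "U \<in> sets J" "emeasure \<nu> U < \<infinity>"
  shows "finite_measure (base \<nu> U)"
proof (rule finite_measureI)
  have "U \<inter> strip (space M) = U" using sets.sets_into_space[OF assms(2)] by (auto simp: space_jump_space)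
  then show "emeasure (base \<nu> U) (space (base \<nu> U)) \<noteq> \<infinity>"
    using assms by (simp add: emeasure_base)
qed

text \<open>Absence of mass on fibres means that the projection has no atoms.\<close>

lemma strip_cells_square:
  assumes \<nu>: "sets \<nu> = sets J" and U: "U \<in> sets J" "emeasure \<nu> U < \<infinity>"
    and diffuse: "\<And>t. t \<in> space M \<Longrightarrow> emeasure \<nu> (strip {t}) = 0"
  shows "(\<lambda>n. \<Sum>k\<le>2 ^ n. (measure \<nu> (U \<inter> strip (cells n k)))\<^sup>2) \<longlonglongrightarrow> 0"
proof -
  have "measure (base \<nu> U) {t} = 0" if t: "t \<in> space M" for t
  proof -
    have "emeasure \<nu> (U \<inter> strip {t}) \<le> emeasure \<nu> (strip {t})"
      using \<nu> t by (intro emeasure_mono) auto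
    then show ?thesis using diffuse[OF t]
      unfolding measure_base[OF \<nu> U(1) singleton_sets[OF t]] by (simp add: measure_def)
  qed
  from finite_diffuse_sum_cells_square[OF finite_base[OF \<nu> U] sets_base this]
  show ?thesis using \<nu> U by (simp add: measure_base)
qed

lemma sum_strip_cells:
  assumes \<nu>: "sets \<nu> = sets J" and U: "U \<in> sets J" "emeasure \<nu> U < \<infinity>"
  shows "(\<Sum>k\<le>2 ^ n. measure \<nu> (U \<inter> strip (cells n k))) = measure \<nu> U"
proof -
  have "measure \<nu> (\<Union>k\<le>2 ^ n. U \<inter> strip (cells n k)) = (\<Sum>k\<le>2 ^ n. measure \<nu> (U \<inter> strip (cells n k)))"
  proof (rule measure_finite_Union)
    show "emeasure \<nu> (U \<inter> strip (cells n k)) \<noteq> \<infinity>" for k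
      using U \<nu> emeasure_mono[of "U \<inter> strip (cells n k)" U \<nu>] by (auto simp: top_unique less_top)
  qed (use U \<nu> disjoint_strip_cells in auto)
  then show ?thesis using UN_strip_cells[OF U(1)] by simp
qed

end

section \<open>The intensity of the jumps and its integrability\<close>

context indep_signed_measure
begin

definition F :: "('a \<times> real) measure" where "F = mean_measure P \<Psi>"

lemma sets_F [simp]: "sets F = sets J" and space_F [simp]: "space F = space J" by (simp_all add: F_def)

lemma emeasure_F: "C \<in> sets J \<Longrightarrow> emeasure F C = (\<integral>\<^sup>+\<omega>. emeasure (\<Psi> \<omega>) C \<partial>P)"
  unfolding F_def by (intro emeasure_mean_measure Psi_measurable) auto

text \<open>Meant for sets of \<open>JR\<close>, where only finitely many points are counted and
  \<open>card\<close> gives their true number.\<close>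

definition cnt :: "'w \<Rightarrow> ('a \<times> real) set \<Rightarrow> nat" where
  "cnt \<omega> C = card {t \<in> space M. (t, \<eta> \<omega> {t}) \<in> C}"

lemma emeasure_Psi: "\<omega> \<in> space P \<Longrightarrow> C \<in> JR \<Longrightarrow> emeasure (\<Psi> \<omega>) C = of_nat (cnt \<omega> C)"
  unfolding \<Psi>_def cnt_def by (intro emeasure_jumps_card ca_eta)

lemma cnt_measurable_incr:
  assumes "C \<in> JR" "C \<subseteq> B \<times> UNIV" "B \<in> sets M" "B - fixed_atoms \<subseteq> E"
  shows "(\<lambda>\<omega>. cnt \<omega> C) \<in> incr_alg P R \<xi> E \<rightarrow>\<^sub>M count_space UNIV"
proof -
  have "(\<lambda>\<omega>. nat \<lfloor>enn2real (emeasure (\<Psi> \<omega>) C)\<rfloor>) \<in> incr_alg P R \<xi> E \<rightarrow>\<^sub>M count_space UNIV"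
    using Psi_measurable_incr[OF JR_sets[OF assms(1)] assms(2-4)] by measurable
  then show ?thesis using emeasure_Psi[OF _ assms(1)]
    by (subst measurable_cong[where g = "\<lambda>\<omega>. nat \<lfloor>enn2real (emeasure (\<Psi> \<omega>) C)\<rfloor>"]) auto
qed

lemma cnt_measurable [measurable]:
  assumes "C \<in> JR" shows "(\<lambda>\<omega>. cnt \<omega> C) \<in> P \<rightarrow>\<^sub>M count_space UNIV"
proof -
  have "C \<subseteq> space M \<times> UNIV" using sets.sets_into_space[OF JR_sets[OF assms]] by (auto simp: space_jump_space)
  from cnt_measurable_incr[OF assms this, of UNIV] show ?thesis
    using sets_incr_alg_xi[of UNIV] by (auto simp: measurable_def)
qed

text \<open>The fixed atoms having been removed, a given \<open>t\<close> is almost surely no atom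
  of \<open>\<eta>\<close>, so the mean count on its fibre is 0.\<close>

lemma F_fiber:
  assumes t: "t \<in> space M" shows "emeasure F (strip {t}) = 0"
proof -
  have "emeasure F (strip {t}) = (\<integral>\<^sup>+\<omega>. emeasure (\<Psi> \<omega>) (strip {t}) \<partial>P)"
    using t by (intro emeasure_F) auto
  also have "\<dots> = (\<integral>\<^sup>+\<omega>. 0 \<partial>P)"
  proof (rule nn_integral_cong_AE)
    show "AE \<omega> in P. emeasure (\<Psi> \<omega>) (strip {t}) = 0"
      using eta_singleton_AE[OF t]
    proof eventually_elim
      case (elim \<omega>)
      then have e: "{t' \<in> space M. (t', \<eta> \<omega> {t'}) \<in> strip {t}} = {}" by auto
      show ?case unfolding \<Psi>_def emeasure_jumps[OF strip_sets[OF singleton_sets[OF t]]] e by simp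
    qed
  qed
  finally show ?thesis by simp
qed

text \<open>Finitely many atoms eventually occupy different cells, whose masses tend to the atoms,
  so each finite part of the sum is at most the lower limit of the row sums. The finite parts
  \<open>T m\<close> exhaust the atoms.\<close>

lemma nn_integral_min_le_liminf:
  assumes w: "\<omega> \<in> space P" and B: "B \<in> R"
  shows "(\<integral>\<^sup>+x. ennreal (min 1 \<bar>x\<bar>) \<partial>slice (\<Psi> \<omega>) B)
    \<le> liminf (\<lambda>n. ennreal (\<Sum>k\<le>2 ^ n. min 1 \<bar>\<eta> \<omega> (B \<inter> cells n k)\<bar>))"
proof -
  let ?\<eta> = "\<eta> \<omega>" and ?S = "\<lambda>n. \<Sum>k\<le>2 ^ n. min 1 \<bar>\<eta> \<omega> (B \<inter> cells n k)\<bar>"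
  have Bs: "B \<in> sets M" using R_sets[OF B] .
  have BM: "B \<subseteq> space M" using sets.sets_into_space[OF Bs] .
  define T where "T m = {t \<in> space M. (t, ?\<eta> {t}) \<in> strip B \<inter> box m}" for m
  have fT: "finite (T m)" for m
    unfolding T_def using Bs by (intro finite_jumps[OF ca_eta[OF w]] Int_box_JR) auto
  have TB: "T m \<subseteq> B" for m by (auto simp: T_def)
  have iT: "incseq T"
    using box_incseq unfolding incseq_def T_def le_fun_def by blast
  have UT: "(\<Union>m. T m) = {t \<in> B. ?\<eta> {t} \<noteq> 0}"
  proof -
    have "(t, ?\<eta> {t}) \<in> (\<Union>m. box m)" if "t \<in> B" "?\<eta> {t} \<noteq> 0" for t
      unfolding UN_box space_jump_space using that BM by auto
    then show ?thesis using BM unfolding T_def by blast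
  qed
  have lim: "(\<lambda>n. ?\<eta> (B \<inter> cells n (cell n t))) \<longlonglongrightarrow> ?\<eta> {t}" if "t \<in> B" for t
  proof -
    have t: "t \<in> space M" "B \<inter> {t} = {t}" using that BM by auto
    show ?thesis using tendsto_cells[OF ca_eta[OF w] B t(1)] t(2) by simp
  qed
  have fm: "(\<Sum>t\<in>T m. ennreal (min 1 \<bar>?\<eta> {t}\<bar>)) \<le> liminf (\<lambda>n. ennreal (?S n))" for m
  proof -
    have "\<forall>\<^sub>F n in sequentially. \<forall>t\<in>T m. \<forall>t'\<in>T m. t \<noteq> t' \<longrightarrow> cell n t \<noteq> cell n t'"
    proof (intro eventually_ball_finite fT ballI)
      fix t t' assume "t \<in> T m" "t' \<in> T m"
      then show "\<forall>\<^sub>F n in sequentially. t \<noteq> t' \<longrightarrow> cell n t \<noteq> cell n t'"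
        using cell_separates[of t t'] TB[of m] BM by (cases "t = t'") auto
    qed
    then have ev: "\<forall>\<^sub>F n in sequentially. (\<Sum>t\<in>T m. min 1 \<bar>?\<eta> (B \<inter> cells n (cell n t))\<bar>) \<le> ?S n"
    proof eventually_elim
      case (elim n)
      then have inj: "inj_on (cell n) (T m)" by (auto simp: inj_on_def)
      have "(\<Sum>t\<in>T m. min 1 \<bar>?\<eta> (B \<inter> cells n (cell n t))\<bar>) = (\<Sum>k\<in>cell n ` T m. min 1 \<bar>?\<eta> (B \<inter> cells n k)\<bar>)"
        by (simp add: sum.reindex[OF inj])
      also have "\<dots> \<le> ?S n"
        using cell_le TB[of m] BM by (intro sum_mono2) auto
      finally show ?case .
    qed
    have "(\<lambda>n. ennreal (\<Sum>t\<in>T m. min 1 \<bar>?\<eta> (B \<inter> cells n (cell n t))\<bar>)) \<longlonglongrightarrow> ennreal (\<Sum>t\<in>T m. min 1 \<bar>?\<eta> {t}\<bar>)"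
      using TB[of m] by (intro tendsto_intros lim) auto
    from lim_imp_Liminf[OF _ this] have "ennreal (\<Sum>t\<in>T m. min 1 \<bar>?\<eta> {t}\<bar>)
        = liminf (\<lambda>n. ennreal (\<Sum>t\<in>T m. min 1 \<bar>?\<eta> (B \<inter> cells n (cell n t))\<bar>))" by simp
    also have "\<dots> \<le> liminf (\<lambda>n. ennreal (?S n))"
      using ev by (intro Liminf_mono) (auto elim!: eventually_mono intro!: ennreal_leI)
    finally show ?thesis by (subst sum_ennreal) simp_all
  qed
  have "(\<integral>\<^sup>+x. ennreal (min 1 \<bar>x\<bar>) \<partial>slice (\<Psi> \<omega>) B) = (\<integral>\<^sup>+t. ennreal (min 1 \<bar>?\<eta> {t}\<bar>) \<partial>count_space {t \<in> B. ?\<eta> {t} \<noteq> 0})"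
    unfolding \<Psi>_def by (rule nn_integral_slice_jumps[OF Bs]) measurable
  also have "\<dots> = (\<integral>\<^sup>+t. (SUP m. ennreal (min 1 \<bar>?\<eta> {t}\<bar>) * indicator (T m) t) \<partial>count_space UNIV)"
  proof (subst nn_integral_count_space_indicator, simp, rule nn_integral_cong)
    fix t
    have "(SUP m. ennreal (min 1 \<bar>?\<eta> {t}\<bar>) * indicator (T m) t) = ennreal (min 1 \<bar>?\<eta> {t}\<bar>) * (SUP m. indicator (T m) t)"
      by (rule SUP_mult_left_ennreal[symmetric])
    also have "(SUP m. indicator (T m) t :: ennreal) = indicator (\<Union>m. T m) t"
    proof (rule antisym)
      show "(SUP m. indicator (T m) t :: ennreal) \<le> indicator (\<Union>m. T m) t"
        by (intro SUP_least) (auto simp: indicator_def)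
      show "indicator (\<Union>m. T m) t \<le> (SUP m. indicator (T m) t :: ennreal)"
      proof (cases "t \<in> (\<Union>m. T m)")
        case True
        then obtain m where "t \<in> T m" by blast
        then have "indicator (\<Union>m. T m) t \<le> (indicator (T m) t :: ennreal)" by (simp add: indicator_def)
        then show ?thesis by (rule order_trans) (rule SUP_upper, simp)
      qed simp
    qed
    finally show "ennreal (min 1 \<bar>?\<eta> {t}\<bar>) * indicator {t \<in> B. ?\<eta> {t} \<noteq> 0} t = (SUP m. ennreal (min 1 \<bar>?\<eta> {t}\<bar>) * indicator (T m) t)"
      unfolding UT by simp
  qed
  also have "\<dots> = (SUP m. \<integral>\<^sup>+t. ennreal (min 1 \<bar>?\<eta> {t}\<bar>) * indicator (T m) t \<partial>count_space UNIV)"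
    using iT by (intro nn_integral_monotone_convergence_SUP) (auto simp: incseq_def le_fun_def indicator_def intro!: mult_left_mono)
  also have "\<dots> = (SUP m. \<Sum>t\<in>T m. ennreal (min 1 \<bar>?\<eta> {t}\<bar>))"
    by (subst nn_integral_count_space_indicator[symmetric]) (simp_all add: nn_integral_count_space_finite fT)
  also have "\<dots> \<le> liminf (\<lambda>n. ennreal (?S n))" by (intro SUP_least fm)
  finally show ?thesis .
qed

text \<open>Campbell's formula, the preceding pathwise inequality and Fatou's lemma reduce this to
  the bounded truncated means of the rows of \<open>\<eta>\<close>.\<close>

lemma F_min:
  assumes B: "B \<in> R" shows "(\<integral>\<^sup>+x. ennreal (min 1 \<bar>x\<bar>) \<partial>slice F B) < \<infinity>"
proof -
  have Bs: "B \<in> sets M" using R_sets[OF B] .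
  have Bk: "B \<inter> cells n k \<in> R" for n k by (rule R_Int[OF B cells_sets])
  have "\<exists>C. \<forall>n. (\<Sum>k\<in>{..2 ^ n}. expectation (\<lambda>\<omega>. min 1 \<bar>\<eta> \<omega> (B \<inter> cells n k)\<bar>)) \<le> C"
  proof (rule row_sums_bound)
    show "indep_vars (\<lambda>_. borel) (\<lambda>k \<omega>. \<eta> \<omega> (B \<inter> cells n k)) {..2 ^ n}" for n
      by (intro indep_cells eta_measurable_incr Bk) auto
    show "\<exists>v. \<forall>n. (\<Sum>k\<in>{..2 ^ n}. \<bar>\<eta> \<omega> (B \<inter> cells n k)\<bar>) \<le> v" if "\<omega> \<in> space P" for \<omega>
      by (rule sum_abs_cells_bound[OF ca_eta[OF that] B])
  qed simp
  then obtain C where C: "\<And>n. (\<Sum>k\<le>2 ^ n. expectation (\<lambda>\<omega>. min 1 \<bar>\<eta> \<omega> (B \<inter> cells n k)\<bar>)) \<le> C" by blast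
  have [measurable]: "(\<lambda>\<omega>. \<eta> \<omega> (B \<inter> cells n k)) \<in> borel_measurable P" for n k
    by (rule eta_measurable[OF Bk])
  have "(\<integral>\<^sup>+x. ennreal (min 1 \<bar>x\<bar>) \<partial>slice F B) = (\<integral>\<^sup>+\<omega>. \<integral>\<^sup>+x. ennreal (min 1 \<bar>x\<bar>) \<partial>slice (\<Psi> \<omega>) B \<partial>P)"
    unfolding F_def by (intro nn_integral_slice_mean_measure Psi_measurable Bs) auto
  also have "\<dots> \<le> (\<integral>\<^sup>+\<omega>. liminf (\<lambda>n. ennreal (\<Sum>k\<le>2 ^ n. min 1 \<bar>\<eta> \<omega> (B \<inter> cells n k)\<bar>)) \<partial>P)"
    by (intro nn_integral_mono nn_integral_min_le_liminf B)
  also have "\<dots> \<le> liminf (\<lambda>n. \<integral>\<^sup>+\<omega>. ennreal (\<Sum>k\<le>2 ^ n. min 1 \<bar>\<eta> \<omega> (B \<inter> cells n k)\<bar>) \<partial>P)"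
    by (rule nn_integral_liminf) measurable
  also have "\<dots> \<le> ennreal C"
  proof (intro Liminf_le always_eventually allI)
    fix n
    have i: "integrable P (\<lambda>\<omega>. min 1 \<bar>\<eta> \<omega> (B \<inter> cells n k)\<bar>)" for k
      by (rule integrable_const_bound[where B = 1]) auto
    have "(\<integral>\<^sup>+\<omega>. ennreal (\<Sum>k\<le>2 ^ n. min 1 \<bar>\<eta> \<omega> (B \<inter> cells n k)\<bar>) \<partial>P)
        = ennreal (expectation (\<lambda>\<omega>. \<Sum>k\<le>2 ^ n. min 1 \<bar>\<eta> \<omega> (B \<inter> cells n k)\<bar>))"
      using i by (intro nn_integral_eq_integral) (auto intro!: sum_nonneg)
    also have "\<dots> \<le> ennreal C" using C[of n] i by (intro ennreal_leI) simp
    finally show "(\<integral>\<^sup>+\<omega>. ennreal (\<Sum>k\<le>2 ^ n. min 1 \<bar>\<eta> \<omega> (B \<inter> cells n k)\<bar>) \<partial>P) \<le> ennreal C" .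
  qed simp
  finally show ?thesis by (rule le_less_trans) simp
qed

end

context localized_borel
begin

text \<open>Markov's inequality: on \<open>C\<close> the integrand is at least
  \<open>min 1 \<epsilon>\<close>.\<close>

lemma finite_JR_of_min:
  assumes \<nu>: "sets \<nu> = sets J" and min: "\<And>B. B \<in> R \<Longrightarrow> (\<integral>\<^sup>+x. ennreal (min 1 \<bar>x\<bar>) \<partial>slice \<nu> B) < \<infinity>"
    and C: "C \<in> JR"
  shows "emeasure \<nu> C < \<infinity>"
proof -
  obtain B \<epsilon> where B: "B \<in> R" "0 < \<epsilon>" "\<And>t x. (t, x) \<in> C \<Longrightarrow> t \<in> B \<and> \<epsilon> \<le> \<bar>x\<bar> \<and> x \<noteq> 0"
    using JR_boundE[OF C] by metis
  let ?U = "{x::real. x \<noteq> 0 \<and> \<epsilon> \<le> \<bar>x\<bar>}"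
  have U: "?U \<in> sets punctured_line" by (simp add: sets_punctured_line)
  have "emeasure \<nu> C \<le> emeasure \<nu> (B \<times> ?U)"
    using B(3) R_sets[OF B(1)] U \<nu> by (intro emeasure_mono) auto
  also have "\<dots> = emeasure (slice \<nu> B) ?U"
    using R_sets[OF B(1)] U \<nu> by (simp add: emeasure_slice)
  finally have le: "emeasure \<nu> C \<le> emeasure (slice \<nu> B) ?U" .
  have "ennreal (min 1 \<epsilon>) * emeasure (slice \<nu> B) ?U = (\<integral>\<^sup>+x. ennreal (min 1 \<epsilon>) * indicator ?U x \<partial>slice \<nu> B)"
    using U by (intro nn_integral_cmult_indicator[symmetric]) simp
  also have "\<dots> \<le> (\<integral>\<^sup>+x. ennreal (min 1 \<bar>x\<bar>) \<partial>slice \<nu> B)"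
    using B(2) by (intro nn_integral_mono) (auto simp: indicator_def intro!: ennreal_leI)
  also have "\<dots> < \<infinity>" by (rule min[OF B(1)])
  finally have "emeasure (slice \<nu> B) ?U < \<infinity>"
    using B(2) by (auto simp: ennreal_mult_less_top)
  then show ?thesis using le by (rule le_less_trans[rotated])
qed

end

text \<open>With at most one point in total the first-order expansion is exact; with more, its error
  is at most their number. Hence only cells with two or more points cause an error.\<close>

lemma small_count_expansion:
  fixes t :: "'i \<Rightarrow> real" and N :: "'i \<Rightarrow> nat"
  assumes I: "finite I" and t: "\<And>i. i \<in> I \<Longrightarrow> 0 \<le> t i \<and> t i \<le> 1"
  shows "\<bar>(\<Prod>i\<in>I. t i ^ N i) - (1 - (\<Sum>i\<in>I. (1 - t i) * real (N i)))\<bar>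
    \<le> (if 2 \<le> (\<Sum>i\<in>I. N i) then real (\<Sum>i\<in>I. N i) else 0)"
proof -
  let ?P = "\<Prod>i\<in>I. t i ^ N i" and ?S = "\<Sum>i\<in>I. (1 - t i) * real (N i)" and ?N = "\<Sum>i\<in>I. N i"
  consider "?N = 0" | "?N = 1" | "2 \<le> ?N" by linarith
  then show ?thesis
  proof cases
    case 1
    then have "\<And>i. i \<in> I \<Longrightarrow> N i = 0" using I by simp
    then show ?thesis by simp
  next
    case 2
    then obtain j where j: "j \<in> I" "N j = 1" "\<And>i. i \<in> I \<Longrightarrow> i \<noteq> j \<Longrightarrow> N i = 0"
      using sum_eq_Suc0_iff[OF I, of N] by auto
    have "?P = t j"
      using I j by (subst prod.remove[OF I j(1)]) (simp add: prod.neutral)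
    moreover have "?S = 1 - t j"
      using I j by (subst sum.remove[OF I j(1)]) (simp add: sum.neutral)
    ultimately show ?thesis using 2 by simp
  next
    case 3
    have "0 \<le> ?P" "?P \<le> 1" using t by (auto intro!: prod_nonneg prod_le_1 power_le_one)
    moreover have "0 \<le> ?S" using t by (intro sum_nonneg mult_nonneg_nonneg) auto
    moreover have "?S \<le> (\<Sum>i\<in>I. real (N i))"
      using t by (intro sum_mono) (simp add: mult_left_le_one_le)
    moreover have "2 \<le> (\<Sum>i\<in>I. real (N i))" using 3 by (simp flip: of_nat_sum)
    ultimately show ?thesis using 3 by (simp add: abs_le_iff)
  qed
qed

text \<open>The upper bound passes through \<open>exp (- x) \<le> 1 / (1 + x)\<close> and
  \<open>1 / (1 + x) \<le> 1 - x + x\<^sup>2\<close>.\<close>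

lemma exp_minus_expansion: fixes x :: real assumes "0 \<le> x" shows "\<bar>exp (- x) - (1 - x)\<bar> \<le> x\<^sup>2"
proof -
  have 1: "1 - x \<le> exp (- x)" using exp_ge_add_one_self[of "- x"] by simp
  have "1 + x \<le> exp x" by (rule exp_ge_add_one_self)
  then have "exp (- x) \<le> 1 / (1 + x)" using assms by (simp add: exp_minus inverse_eq_divide frac_le)
  also have "\<dots> \<le> 1 - x + x\<^sup>2"
  proof -
    have "(1 - x + x\<^sup>2) * (1 + x) = 1 + x * x\<^sup>2" by (simp add: algebra_simps power2_eq_square)
    moreover have "0 \<le> x * x\<^sup>2" using assms by simp
    ultimately have "1 \<le> (1 - x + x\<^sup>2) * (1 + x)" by linarith
    then show ?thesis using assms by (simp add: pos_divide_le_eq)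
  qed
  finally show ?thesis using 1 by simp
qed

context indep_signed_measure
begin

lemma F_finite: "C \<in> JR \<Longrightarrow> emeasure F C < \<infinity>"
  by (rule finite_JR_of_min[OF sets_F F_min])

lemma cnt_additive:
  assumes w: "\<omega> \<in> space P" and I: "finite I" "disjoint_family_on A I" "\<And>i. i \<in> I \<Longrightarrow> A i \<in> JR"
  shows "cnt \<omega> (\<Union>i\<in>I. A i) = (\<Sum>i\<in>I. cnt \<omega> (A i))"
proof -
  have "{t \<in> space M. (t, \<eta> \<omega> {t}) \<in> (\<Union>i\<in>I. A i)} = (\<Union>i\<in>I. {t \<in> space M. (t, \<eta> \<omega> {t}) \<in> A i})" by auto
  moreover have "card (\<Union>i\<in>I. {t \<in> space M. (t, \<eta> \<omega> {t}) \<in> A i}) = (\<Sum>i\<in>I. card {t \<in> space M. (t, \<eta> \<omega> {t}) \<in> A i})"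
    using I finite_jumps[OF ca_eta[OF w]] by (intro card_UN_disjoint) (auto simp: disjoint_family_on_def)
  ultimately show ?thesis by (simp add: cnt_def)
qed

lemma expectation_cnt:
  assumes C: "C \<in> JR"
  shows "integrable P (\<lambda>\<omega>. real (cnt \<omega> C))" "expectation (\<lambda>\<omega>. real (cnt \<omega> C)) = measure F C"
proof -
  have eq: "(\<integral>\<^sup>+\<omega>. ennreal (real (cnt \<omega> C)) \<partial>P) = emeasure F C"
    unfolding emeasure_F[OF JR_sets[OF C]]
    by (intro nn_integral_cong) (simp add: emeasure_Psi C ennreal_of_nat_eq_real_of_nat)
  have m: "(\<lambda>\<omega>. real (cnt \<omega> C)) \<in> borel_measurable P"
    by (rule measurable_compose[OF cnt_measurable[OF C]]) simp
  show "integrable P (\<lambda>\<omega>. real (cnt \<omega> C))"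
    using F_finite[OF C] eq m by (intro integrableI_bounded) auto
  show "expectation (\<lambda>\<omega>. real (cnt \<omega> C)) = measure F C"
    using eq by (subst integral_eq_nn_integral[OF m]) (auto simp: measure_def)
qed

text \<open>There is at most one point over each location, so once the finitely many locations are
  separated no cell holds two.\<close>

lemma cnt_eventually_simple:
  assumes w: "\<omega> \<in> space P" and U: "U \<in> JR"
  shows "\<forall>\<^sub>F n in sequentially. \<forall>k. cnt \<omega> (U \<inter> strip (cells n k)) \<le> 1"
proof -
  let ?T = "{t \<in> space M. (t, \<eta> \<omega> {t}) \<in> U}"
  have fT: "finite ?T" by (rule finite_jumps[OF ca_eta[OF w] U])
  have "\<forall>\<^sub>F n in sequentially. \<forall>t\<in>?T. \<forall>t'\<in>?T. t \<noteq> t' \<longrightarrow> cell n t \<noteq> cell n t'"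
  proof (intro eventually_ball_finite fT ballI)
    fix t t' assume "t \<in> ?T" "t' \<in> ?T"
    then show "\<forall>\<^sub>F n in sequentially. t \<noteq> t' \<longrightarrow> cell n t \<noteq> cell n t'"
      using cell_separates[of t t'] by (cases "t = t'") auto
  qed
  then show ?thesis
  proof eventually_elim
    case (elim n)
    show ?case
    proof
      fix k
      have "t = t'" if "t \<in> {t \<in> space M. (t, \<eta> \<omega> {t}) \<in> U \<inter> strip (cells n k)}"
        "t' \<in> {t \<in> space M. (t, \<eta> \<omega> {t}) \<in> U \<inter> strip (cells n k)}" for t t'
        using elim that by (auto simp: cells_def)
      then show "cnt \<omega> (U \<inter> strip (cells n k)) \<le> 1"
        unfolding cnt_def by (metis (no_types, lifting) One_nat_def card_le_Suc0_iff_eq card.infinite le0)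
    qed
  qed
qed

text \<open>
  Both sides factor over the cells of level \<open>n\<close>. On each cell the factors agree to first order; the errors
  come from cells containing two points, which disappear as the points are separated, and from
  squares of the masses of the cells, whose sum tends to 0 as \<open>F\<close> has no mass on fibres.
\<close>

lemma cnt_pgf:
  assumes I: "finite I" "disjoint_family_on C I" "\<And>i. i \<in> I \<Longrightarrow> C i \<in> JR"
    and t: "\<And>i. i \<in> I \<Longrightarrow> 0 \<le> t i \<and> t i \<le> 1"
  shows "expectation (\<lambda>\<omega>. \<Prod>i\<in>I. t i ^ cnt \<omega> (C i)) = (\<Prod>i\<in>I. exp (- ((1 - t i) * measure F (C i))))"
proof -
  define U where "U = (\<Union>i\<in>I. C i)"
  have UJR: "U \<in> JR" unfolding U_def by (rule ring_of_sets.finite_UN[OF ring_JR I(1)]) (rule I(3))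
  have Us: "U \<in> sets J" by (rule JR_sets[OF UJR])
  define Cn where "Cn n k i = C i \<inter> strip (cells n k)" for n k i
  define Uc where "Uc n k = U \<inter> strip (cells n k)" for n k
  have CnJR: "Cn n k i \<in> JR" if "i \<in> I" for n k i
    unfolding Cn_def using I(3)[OF that] JR_sets[OF I(3)[OF that]] by (intro JR_subset[OF I(3)[OF that]]) auto
  have UcJR: "Uc n k \<in> JR" for n k
    unfolding Uc_def using Us by (intro JR_subset[OF UJR]) auto
  have Uc: "Uc n k = (\<Union>i\<in>I. Cn n k i)" for n k by (auto simp: Uc_def U_def Cn_def)
  have dCn: "disjoint_family_on (Cn n k) I" for n k using I(2) by (auto simp: disjoint_family_on_def Cn_def)
  have cntU: "cnt \<omega> (Uc n k) = (\<Sum>i\<in>I. cnt \<omega> (Cn n k i))" if "\<omega> \<in> space P" for \<omega> n k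
    unfolding Uc using CnJR by (intro cnt_additive[OF that I(1) dCn]) auto
  have dU: "disjoint_family_on (Uc n) K" for n K
    using disjoint_strip_cells[of U n K] by (simp add: Uc_def[abs_def])
  \<comment> \<open>The factor contributed by cell \<open>k\<close>; the mean of its first-order
    expansion is \<open>1 - l n k\<close>.\<close>
  define T where "T n k \<omega> = (\<Prod>i\<in>I. t i ^ cnt \<omega> (Cn n k i))" for n k \<omega>
  define l where "l n k = (\<Sum>i\<in>I. (1 - t i) * measure F (Cn n k i))" for n k
  have cm: "(\<lambda>\<omega>. cnt \<omega> (Cn n k i)) \<in> incr_alg P R \<xi> (cells n k) \<rightarrow>\<^sub>M count_space UNIV" if "i \<in> I" for n k i
    by (rule cnt_measurable_incr[OF CnJR[OF that], where B = "cells n k"]) (auto simp: Cn_def)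
  have Tm: "T n k \<in> borel_measurable (incr_alg P R \<xi> (cells n k))" for n k
    unfolding T_def by (intro borel_measurable_prod measurable_compose[OF cm]) auto
  have Tb: "0 \<le> T n k \<omega>" "T n k \<omega> \<le> 1" for n k \<omega>
    unfolding T_def using t by (auto intro!: prod_nonneg prod_le_1 power_le_one)
  have Ti: "integrable P (T n k)" for n k
    using from_incr_alg[OF Tm] Tb by (intro integrable_const_bound[where B = 1]) auto
  have ET: "0 \<le> expectation (T n k)" "expectation (T n k) \<le> 1" for n k
  proof -
    show "0 \<le> expectation (T n k)" using Tb by (intro Bochner_Integration.integral_nonneg) auto
    have "expectation (T n k) \<le> expectation (\<lambda>\<omega>. 1)" using Ti Tb by (intro integral_mono) auto
    then show "expectation (T n k) \<le> 1" by (simp add: prob_space)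
  qed
  have l0: "0 \<le> l n k" for n k unfolding l_def using t by (intro sum_nonneg mult_nonneg_nonneg) auto
  have lF: "l n k \<le> measure F (Uc n k)" for n k
  proof -
    have "l n k \<le> (\<Sum>i\<in>I. measure F (Cn n k i))"
      unfolding l_def using t by (intro sum_mono) (simp add: mult_left_le_one_le)
    also have "\<dots> = measure F (\<Union>i\<in>I. Cn n k i)"
      using F_finite[OF CnJR] JR_sets[OF CnJR]
      by (intro measure_finite_Union[symmetric] I(1) dCn) (auto simp: less_top)
    finally show ?thesis by (simp add: Uc)
  qed
  \<comment> \<open>The number of points in cells that hold more than one. It is dominated by
    \<open>cnt \<omega> U\<close> and eventually 0 on each path.\<close>
  define Q where "Q n \<omega> = (\<Sum>k\<le>2 ^ n. if 2 \<le> cnt \<omega> (Uc n k) then real (cnt \<omega> (Uc n k)) else 0)" for n \<omega>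
  have qi: "integrable P (\<lambda>\<omega>. if 2 \<le> cnt \<omega> (Uc n k) then real (cnt \<omega> (Uc n k)) else 0)" for n k
  proof (rule Bochner_Integration.integrable_bound[OF expectation_cnt(1)[OF UcJR[of n k]]])
    show "(\<lambda>\<omega>. if 2 \<le> cnt \<omega> (Uc n k) then real (cnt \<omega> (Uc n k)) else 0) \<in> borel_measurable P"
      by (rule measurable_compose[OF cnt_measurable[OF UcJR], of "\<lambda>c. if 2 \<le> c then real c else 0"]) simp
  qed auto
  have cell: "\<bar>expectation (T n k) - exp (- l n k)\<bar>
    \<le> expectation (\<lambda>\<omega>. if 2 \<le> cnt \<omega> (Uc n k) then real (cnt \<omega> (Uc n k)) else 0) + (measure F (Uc n k))\<^sup>2" for n k
  proof -
    let ?L = "\<lambda>\<omega>. 1 - (\<Sum>i\<in>I. (1 - t i) * real (cnt \<omega> (Cn n k i)))"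
    have Li: "integrable P ?L" using expectation_cnt(1)[OF CnJR] by (intro Bochner_Integration.integrable_diff Bochner_Integration.integrable_sum) auto
    have EL: "expectation ?L = 1 - l n k"
      unfolding l_def using expectation_cnt[OF CnJR] by (simp add: prob_space)
    have "\<bar>expectation (T n k) - expectation ?L\<bar> = \<bar>expectation (\<lambda>\<omega>. T n k \<omega> - ?L \<omega>)\<bar>"
      using Ti Li by (subst Bochner_Integration.integral_diff) auto
    also have "\<dots> \<le> expectation (\<lambda>\<omega>. \<bar>T n k \<omega> - ?L \<omega>\<bar>)" by (rule integral_abs_bound)
    also have "\<dots> \<le> expectation (\<lambda>\<omega>. if 2 \<le> cnt \<omega> (Uc n k) then real (cnt \<omega> (Uc n k)) else 0)"
    proof (rule integral_mono)
      show "\<bar>T n k \<omega> - ?L \<omega>\<bar> \<le> (if 2 \<le> cnt \<omega> (Uc n k) then real (cnt \<omega> (Uc n k)) else 0)" if "\<omega> \<in> space P" for \<omega>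
        unfolding T_def cntU[OF that] by (rule small_count_expansion[OF I(1) t])
    qed (use Ti Li qi in auto)
    finally have 1: "\<bar>expectation (T n k) - (1 - l n k)\<bar> \<le> expectation (\<lambda>\<omega>. if 2 \<le> cnt \<omega> (Uc n k) then real (cnt \<omega> (Uc n k)) else 0)"
      unfolding EL .
    have "\<bar>exp (- l n k) - (1 - l n k)\<bar> \<le> (l n k)\<^sup>2" by (rule exp_minus_expansion[OF l0])
    also have "\<dots> \<le> (measure F (Uc n k))\<^sup>2" using lF l0 by (intro power_mono) auto
    finally show ?thesis using 1 by linarith
  qed
  let ?E = "expectation (\<lambda>\<omega>. \<Prod>i\<in>I. t i ^ cnt \<omega> (C i))" and ?X = "\<Prod>i\<in>I. exp (- ((1 - t i) * measure F (C i)))"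
  have main: "\<bar>?E - ?X\<bar> \<le> expectation (Q n) + (\<Sum>k\<le>2 ^ n. (measure F (Uc n k))\<^sup>2)" for n
  proof -
    have "?E = expectation (\<lambda>\<omega>. \<Prod>k\<le>2 ^ n. T n k \<omega>)"
    proof (rule Bochner_Integration.integral_cong[OF refl])
      fix \<omega> assume w: "\<omega> \<in> space P"
      have "cnt \<omega> (C i) = (\<Sum>k\<le>2 ^ n. cnt \<omega> (Cn n k i))" if i: "i \<in> I" for i
      proof -
        have "C i = (\<Union>k\<le>2 ^ n. Cn n k i)" unfolding Cn_def by (rule UN_strip_cells[OF JR_sets[OF I(3)[OF i]], symmetric])
        moreover have "cnt \<omega> (\<Union>k\<le>2 ^ n. Cn n k i) = (\<Sum>k\<le>2 ^ n. cnt \<omega> (Cn n k i))"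
          by (intro cnt_additive[OF w] CnJR i) (auto simp: Cn_def intro: disjoint_strip_cells)
        ultimately show ?thesis by simp
      qed
      then have "(\<Prod>i\<in>I. t i ^ cnt \<omega> (C i)) = (\<Prod>i\<in>I. \<Prod>k\<le>2 ^ n. t i ^ cnt \<omega> (Cn n k i))"
        by (intro prod.cong refl) (simp add: power_sum)
      also have "\<dots> = (\<Prod>k\<le>2 ^ n. T n k \<omega>)" unfolding T_def by (rule prod.swap)
      finally show "(\<Prod>i\<in>I. t i ^ cnt \<omega> (C i)) = (\<Prod>k\<le>2 ^ n. T n k \<omega>)" .
    qed
    also have "\<dots> = (\<Prod>k\<le>2 ^ n. expectation (T n k))"
      by (intro indep_vars_lebesgue_integral indep_cells[OF Tm] Ti) auto
    finally have 1: "?E = (\<Prod>k\<le>2 ^ n. expectation (T n k))" .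
    have "(\<Prod>k\<le>2 ^ n. exp (- l n k)) = exp (- (\<Sum>k\<le>2 ^ n. l n k))" by (simp add: exp_sum sum_negf[symmetric])
    also have "(\<Sum>k\<le>2 ^ n. l n k) = (\<Sum>i\<in>I. (1 - t i) * (\<Sum>k\<le>2 ^ n. measure F (Cn n k i)))"
      unfolding l_def sum_distrib_left by (rule sum.swap)
    also have "\<dots> = (\<Sum>i\<in>I. (1 - t i) * measure F (C i))"
      unfolding Cn_def
      by (intro sum.cong refl arg_cong2[where f = "(*)"] sum_strip_cells[OF sets_F] JR_sets F_finite I(3))
    also have "exp (- \<dots>) = ?X" by (simp add: exp_sum I(1) sum_negf[symmetric])
    finally have 2: "?X = (\<Prod>k\<le>2 ^ n. exp (- l n k))" by simp
    \<comment> \<open>Products of numbers between 0 and 1 differ by at most the sum of the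
      differences of their factors.\<close>
    have "\<bar>?E - ?X\<bar> \<le> (\<Sum>k\<le>2 ^ n. \<bar>expectation (T n k) - exp (- l n k)\<bar>)"
      unfolding 1 2 real_norm_def[symmetric] using ET l0 by (intro norm_prod_diff) auto
    also have "\<dots> \<le> (\<Sum>k\<le>2 ^ n. expectation (\<lambda>\<omega>. if 2 \<le> cnt \<omega> (Uc n k) then real (cnt \<omega> (Uc n k)) else 0) + (measure F (Uc n k))\<^sup>2)"
      by (intro sum_mono cell)
    also have "\<dots> = expectation (Q n) + (\<Sum>k\<le>2 ^ n. (measure F (Uc n k))\<^sup>2)"
      unfolding Q_def sum.distrib using qi by (subst Bochner_Integration.integral_sum) auto
    finally show ?thesis .
  qed
  have "(\<lambda>n. expectation (Q n)) \<longlonglongrightarrow> expectation (\<lambda>\<omega>. 0)"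
  proof (rule integral_dominated_convergence[where w = "\<lambda>\<omega>. real (cnt \<omega> U)"])
    show "integrable P (\<lambda>\<omega>. real (cnt \<omega> U))" by (rule expectation_cnt(1)[OF UJR])
    show "Q n \<in> borel_measurable P" for n
      unfolding Q_def using qi by (intro borel_measurable_sum) auto
    show "AE \<omega> in P. norm (Q n \<omega>) \<le> real (cnt \<omega> U)" for n
    proof (rule AE_I2)
      fix \<omega> assume w: "\<omega> \<in> space P"
      have "Q n \<omega> \<le> (\<Sum>k\<le>2 ^ n. real (cnt \<omega> (Uc n k)))" unfolding Q_def by (intro sum_mono) auto
      also have "\<dots> = real (cnt \<omega> (\<Union>k\<le>2 ^ n. Uc n k))"
        unfolding of_nat_sum[symmetric] using UcJR
        by (intro cnt_additive[OF w, symmetric] arg_cong[where f = real] dU) auto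
      also have "(\<Union>k\<le>2 ^ n. Uc n k) = U" unfolding Uc_def by (rule UN_strip_cells[OF Us])
      finally have "Q n \<omega> \<le> real (cnt \<omega> U)" .
      moreover have "0 \<le> Q n \<omega>" unfolding Q_def by (intro sum_nonneg) auto
      ultimately show "norm (Q n \<omega>) \<le> real (cnt \<omega> U)" by simp
    qed
    show "AE \<omega> in P. (\<lambda>n. Q n \<omega>) \<longlonglongrightarrow> 0"
    proof (rule AE_I2)
      fix \<omega> assume w: "\<omega> \<in> space P"
      have "\<forall>\<^sub>F n in sequentially. Q n \<omega> = 0"
        using cnt_eventually_simple[OF w UJR]
      proof eventually_elim
        case (elim n)
        then have le: "cnt \<omega> (Uc n k) \<le> 1" for k unfolding Uc_def by blast
        have "\<not> 2 \<le> cnt \<omega> (Uc n k)" for k using le[of k] by linarith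
        then show ?case by (simp add: Q_def)
      qed
      then show "(\<lambda>n. Q n \<omega>) \<longlonglongrightarrow> 0" by (rule tendsto_eventually)
    qed
  qed simp
  moreover have "(\<lambda>n. \<Sum>k\<le>2 ^ n. (measure F (Uc n k))\<^sup>2) \<longlonglongrightarrow> 0"
    unfolding Uc_def by (rule strip_cells_square[OF sets_F Us F_finite[OF UJR] F_fiber])
  ultimately have "(\<lambda>n. expectation (Q n) + (\<Sum>k\<le>2 ^ n. (measure F (Uc n k))\<^sup>2)) \<longlonglongrightarrow> expectation (\<lambda>\<omega>. 0) + 0"
    by (rule tendsto_add)
  then have "\<bar>?E - ?X\<bar> \<le> expectation (\<lambda>\<omega>. 0) + 0"
    by (rule LIMSEQ_le_const) (use main in auto)
  then show ?thesis by simp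
qed

lemma cnt_joint:
  assumes "finite I" "disjoint_family_on C I" "\<And>i. i \<in> I \<Longrightarrow> C i \<in> JR"
  shows "prob {\<omega>\<in>space P. \<forall>i\<in>I. cnt \<omega> (C i) = k i} = (\<Prod>i\<in>I. poisson_weight (measure F (C i)) (k i))"
  using assms by (intro joint_poisson_of_pgf cnt_pgf cnt_measurable) auto

lemma cnt_poisson: "C \<in> JR \<Longrightarrow> prob {\<omega>\<in>space P. cnt \<omega> C = k} = poisson_weight (measure F C) k"
  using cnt_joint[of "{()}" "\<lambda>_. C" "\<lambda>_. k"] by (simp add: disjoint_family_on_def)

text \<open>The joint Poisson weights factor, so the integer counts are independent; on the sample
  space they coincide with the values of the random measure.\<close>

lemma indep_increments_Psi: "indep_increments P JR (\<lambda>\<omega>. emeasure (\<Psi> \<omega>))"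
  unfolding indep_increments_def
proof (intro allI impI, elim conjE)
  fix n and C :: "nat \<Rightarrow> ('a \<times> real) set"
  assume C: "\<forall>i<n. C i \<in> JR" "disjoint_family_on C {..<n}"
  have "indep_vars (\<lambda>_. count_space UNIV) (\<lambda>i \<omega>. cnt \<omega> (C i)) {..<n}"
  proof (rule indep_vars_nat)
    show "(\<lambda>\<omega>. cnt \<omega> (C i)) \<in> P \<rightarrow>\<^sub>M count_space UNIV" if "i \<in> {..<n}" for i
      using C that by (intro cnt_measurable) auto
    show "prob {\<omega> \<in> space P. \<forall>i\<in>A. cnt \<omega> (C i) = k i} = (\<Prod>i\<in>A. prob {\<omega> \<in> space P. cnt \<omega> (C i) = k i})"
      if A: "A \<subseteq> {..<n}" "finite A" for A k
      using C A by (subst cnt_joint) (auto simp: disjoint_family_on_def cnt_poisson subset_iff intro!: prod.cong)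
  qed
  then have iv: "indep_vars (\<lambda>_. borel) (\<lambda>i \<omega>. of_nat (cnt \<omega> (C i)) :: ennreal) {..<n}"
    by (rule indep_vars_compose2) auto
  have "{(\<lambda>\<omega>. emeasure (\<Psi> \<omega>) (C i)) -` A \<inter> space P | A. A \<in> sets borel} = {(\<lambda>\<omega>. of_nat (cnt \<omega> (C i)) :: ennreal) -` A \<inter> space P | A. A \<in> sets borel}"
    if "i < n" for i
  proof -
    have "(\<lambda>\<omega>. emeasure (\<Psi> \<omega>) (C i)) -` A \<inter> space P = (\<lambda>\<omega>. of_nat (cnt \<omega> (C i)) :: ennreal) -` A \<inter> space P" for A
      using C(1) that by (auto simp: emeasure_Psi)
    then show ?thesis by simp
  qed
  then show "indep_vars (\<lambda>_. borel) (\<lambda>i \<omega>. emeasure (\<Psi> \<omega>) (C i)) {..<n}"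
    using iv C(1) unfolding indep_vars_def2
    by (subst indep_sets_cong[OF refl, where G = "\<lambda>i. {(\<lambda>\<omega>. of_nat (cnt \<omega> (C i)) :: ennreal) -` A \<inter> space P | A. A \<in> sets borel}"])
      (auto intro!: Psi_measurable JR_sets)
qed

end

section \<open>Existence of the representation\<close>

lemma sets_vimage_algebra_subset:
  assumes "f \<in> N \<rightarrow>\<^sub>M K" "space N = \<Omega>" shows "sets (vimage_algebra \<Omega> f K) \<subseteq> sets N"
proof -
  have "f \<in> \<Omega> \<rightarrow> space K" using assms by (auto simp: measurable_def)
  then have "sets (vimage_algebra \<Omega> f K) = {f -` A \<inter> \<Omega> | A. A \<in> sets K}" by (rule sets_vimage_algebra2)
  then show ?thesis using measurable_sets[OF assms(1)] assms(2) by auto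
qed

lemma (in prob_space) indep_set_mono:
  assumes "indep_set A B" "A' \<subseteq> A" "B' \<subseteq> B" shows "indep_set A' B'"
  unfolding indep_set_def
  by (rule indep_sets_mono_sets[OF assms(1)[unfolded indep_set_def]]) (use assms(2,3) in \<open>auto split: bool.splits\<close>)

lemma sets_point_measure_algebra:
  "space (point_measure_algebra M R) = point_measures M R"
  "sets (point_measure_algebra M R) = sigma_sets (point_measures M R)
    {(\<lambda>\<mu>. emeasure \<mu> B) -` A \<inter> point_measures M R | B A. B \<in> R \<and> A \<in> sets borel}"
  unfolding point_measure_algebra_def by (subst space_measure_of sets_measure_of; auto)+

lemma measurable_point_measure_algebraI:
  assumes "\<And>\<omega>. \<omega> \<in> space N \<Longrightarrow> \<Psi> \<omega> \<in> point_measures M R"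
    and "\<And>B. B \<in> R \<Longrightarrow> (\<lambda>\<omega>. emeasure (\<Psi> \<omega>) B) \<in> borel_measurable N"
  shows "\<Psi> \<in> N \<rightarrow>\<^sub>M point_measure_algebra M R"
  unfolding point_measure_algebra_def
proof (rule measurable_measure_of)
  show "\<Psi> \<in> space N \<rightarrow> point_measures M R" using assms(1) by auto
  fix y assume "y \<in> {(\<lambda>\<mu>. emeasure \<mu> B) -` A \<inter> point_measures M R | B A. B \<in> R \<and> A \<in> sets borel}"
  then obtain B A where y: "y = (\<lambda>\<mu>. emeasure \<mu> B) -` A \<inter> point_measures M R" "B \<in> R" "A \<in> sets borel" by blast
  have "\<Psi> -` y \<inter> space N = (\<lambda>\<omega>. emeasure (\<Psi> \<omega>) B) -` A \<inter> space N"
    using assms(1) by (auto simp: y(1))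
  then show "\<Psi> -` y \<inter> space N \<in> sets N" using measurable_sets[OF assms(2)[OF y(2)] y(3)] by simp
qed auto

lemma measurable_emeasure_point_measure_algebra:
  "B \<in> R \<Longrightarrow> (\<lambda>\<mu>. emeasure \<mu> B) \<in> borel_measurable (point_measure_algebra M R)"
  by (rule measurableI) (auto simp: sets_point_measure_algebra intro!: sigma_sets.Basic)

context indep_signed_measure
begin

lemma poisson_process_Psi: "poisson_process P J JR F \<Psi>"
  unfolding poisson_process_def
proof (intro conjI ballI allI)
  show "loc_finite J JR F" by (simp add: loc_finite_def F_finite[unfolded infinity_ennreal_def])
  show "\<Psi> \<in> P \<rightarrow>\<^sub>M point_measure_algebra J JR"
    unfolding \<Psi>_def by (intro measurable_point_measure_algebraI jumps_point_measure ca_eta)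
      (auto simp: \<Psi>_def[symmetric] intro: Psi_measurable JR_sets)
  show "indep_increments P JR (\<lambda>\<omega>. emeasure (\<Psi> \<omega>))" by (rule indep_increments_Psi)
  fix C k assume C: "C \<in> JR"
  have "{\<omega> \<in> space P. emeasure (\<Psi> \<omega>) C = of_nat k} = {\<omega> \<in> space P. cnt \<omega> C = k}"
    using C by (auto simp: emeasure_Psi)
  then show "prob {\<omega> \<in> space P. emeasure (\<Psi> \<omega>) C = of_nat k}
      = measure F C ^ k / fact k * exp (- measure F C)"
    using cnt_poisson[OF C] by (simp add: poisson_weight_def)
qed

lemma enumerate_fixed_atoms:
  "\<exists>p s. bij_betw s {j. enat j < p} fixed_atoms"
proof (cases "finite fixed_atoms")
  case True
  then obtain s where "bij_betw s {0..<card fixed_atoms} fixed_atoms"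
    using ex_bij_betw_nat_finite by blast
  moreover have "{j. enat j < enat (card fixed_atoms)} = {0..<card fixed_atoms}" by auto
  ultimately show ?thesis by metis
next
  case False
  then have "bij_betw (from_nat_into fixed_atoms) UNIV fixed_atoms"
    using countable_fixed_atoms by (intro bij_betw_from_nat_into)
  moreover have "{j. enat j < \<infinity>} = UNIV" by auto
  ultimately show ?thesis by metis
qed

text \<open>Countable additivity over the fixed atoms in \<open>B\<close>, whose absolute
  convergence supplies the unordered sum.\<close>

lemma fixed_part_eq:
  assumes w: "\<omega> \<in> space P" and s: "bij_betw s {j. enat j < p} fixed_atoms" and B: "B \<in> R"
  shows "(\<lambda>j. \<xi> \<omega> {s j} * measure (return M (s j)) B) summable_on {j. enat j < p}"
    "fixed_part M p (\<lambda>j \<omega>. \<xi> \<omega> {s j}) s \<omega> B = \<xi> \<omega> (B \<inter> fixed_atoms)"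
proof -
  let ?I = "{j. enat j < p}"
  let ?L = "{j \<in> ?I. s j \<in> B}"
  have Bs: "B \<in> sets M" using R_sets[OF B] .
  have D: "fixed_atoms \<subseteq> space M" by (auto simp: fixed_atoms_def)
  have inj: "inj_on s ?I" using s by (simp add: bij_betw_def)
  have ret: "measure (return M (s j)) B = indicator B (s j)" for j
    using Bs by (simp add: measure_return)
  have sL: "s ` ?L = B \<inter> fixed_atoms" using s by (auto simp: bij_betw_def)
  have sD: "s j \<in> space M" if "j \<in> ?I" for j using that s D by (auto simp: bij_betw_def)
  let ?f = "\<lambda>j. \<xi> \<omega> {s j} * measure (return M (s j)) B"
  \<comment> \<open>Indices without a fixed atom in \<open>B\<close> get the empty set, which
    produces a sequence over all natural numbers also for finite \<open>p\<close>.\<close>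
  define A where "A j = (if j \<in> ?L then {s j} else {})" for j
  have 0: "\<xi> \<omega> {} = 0" using ca_xi[OF w] by (simp add: countably_additive_on_def)
  have AR: "A j \<in> R" for j using sD by (auto simp: A_def)
  have dA: "disjoint_family A" using inj by (auto simp: A_def disjoint_family_on_def inj_on_def)
  have UA: "(\<Union>j. A j) = B \<inter> fixed_atoms" unfolding sL[symmetric] by (auto simp: A_def split: if_splits)
  have "(\<Union>j. A j) \<in> R" unfolding UA using fixed_atoms_sets by (intro R_Int B)
  from countably_additive_onD[OF ca_xi[OF w] AR dA this]
  have sm: "summable (\<lambda>j. \<bar>\<xi> \<omega> (A j)\<bar>)" "(\<lambda>j. \<xi> \<omega> (A j)) sums \<xi> \<omega> (B \<inter> fixed_atoms)" unfolding UA by auto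
  have hs: "((\<lambda>j. \<xi> \<omega> (A j)) has_sum \<xi> \<omega> (B \<inter> fixed_atoms)) UNIV"
    using sm by (intro norm_summable_imp_has_sum) auto
  have "((\<lambda>j. ?f j) has_sum \<xi> \<omega> (B \<inter> fixed_atoms)) ?I"
    by (rule has_sum_cong_neutral[THEN iffD1, OF _ _ _ hs]) (auto simp: A_def 0 ret)
  then show "?f summable_on ?I" "fixed_part M p (\<lambda>j \<omega>. \<xi> \<omega> {s j}) s \<omega> B = \<xi> \<omega> (B \<inter> fixed_atoms)"
    unfolding fixed_part_def by (auto simp: has_sum_imp_summable infsumI)
qed

lemma representation_exists:
  "\<exists>p X s \<alpha> \<Psi> F. increment_representation P M R \<xi> p X s \<alpha> \<Psi> F \<and> reduced_jumps P p X s"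
proof -
  obtain p s where s: "bij_betw s {j. enat j < p} fixed_atoms" using enumerate_fixed_atoms by blast
  let ?I = "{j. enat j < p}"
  define X where "X j \<omega> = \<xi> \<omega> {s j}" for j \<omega>
  have sD: "s j \<in> fixed_atoms" "s j \<in> space M" if "enat j < p" for j
    using that s by (auto simp: bij_betw_def fixed_atoms_def)
  have inj: "inj_on s ?I" using s by (simp add: bij_betw_def)
  have "increment_representation P M R \<xi> p X s \<alpha> \<Psi> F"
    unfolding increment_representation_def
  proof (intro conjI allI impI ballI)
    show "indep_vars (\<lambda>_. borel) X ?I"
    proof (rule indep_vars_incr_alg[OF indep_sets_xi])
      show "disjoint_family_on (\<lambda>j. {s j}) ?I" using inj by (auto simp: disjoint_family_on_def inj_on_def)
      show "X j \<in> borel_measurable (incr_alg P R \<xi> {s j})" if "j \<in> ?I" for j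
        unfolding X_def using that sD by (intro measurable_incr_alg) auto
    qed
    show "s j \<in> space M" if "enat j < p" for j by (rule sD(2)[OF that])
    show "atomless_difference M R \<alpha>" by (rule atomless_difference_alpha)
    show "poisson_process P J JR F \<Psi>" by (rule poisson_process_Psi)
    show "emeasure F (strip {t}) = 0" if "t \<in> space M" for t by (rule F_fiber[OF that])
    show "(\<integral>\<^sup>+x. ennreal (min 1 \<bar>x\<bar>) \<partial>slice F B) < \<infinity>" if "B \<in> R" for B by (rule F_min[OF that])
    \<comment> \<open>The fixed jumps use only increments on \<open>fixed_atoms\<close>, and
      \<open>\<Psi>\<close> only those off it; the disjointness of the two sets is the source of the
      independence.\<close>
    let ?A = "case_bool fixed_atoms (space M - fixed_atoms)"
    have "disjoint_family_on ?A UNIV" by (auto simp: disjoint_family_on_def split: bool.splits)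
    from indep_sets_xi[OF this]
    have "indep_set (sets (incr_alg P R \<xi> fixed_atoms)) (sets (incr_alg P R \<xi> (space M - fixed_atoms)))"
      unfolding indep_set_def by (rule indep_sets_cong[THEN iffD1, rotated -1]) (auto split: bool.splits)
    moreover have "sets (vimage_algebra (space P) (\<lambda>\<omega>. \<lambda>j\<in>?I. X j \<omega>) (PiM ?I (\<lambda>_. borel))) \<subseteq> sets (incr_alg P R \<xi> fixed_atoms)"
    proof (rule sets_vimage_algebra_subset)
      show "(\<lambda>\<omega>. \<lambda>j\<in>?I. X j \<omega>) \<in> incr_alg P R \<xi> fixed_atoms \<rightarrow>\<^sub>M PiM ?I (\<lambda>_. borel)"
        unfolding X_def using sD by (intro measurable_restrict measurable_incr_alg) auto
    qed simp
    moreover have "sets (vimage_algebra (space P) \<Psi> (point_measure_algebra J JR)) \<subseteq> sets (incr_alg P R \<xi> (space M - fixed_atoms))"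
    proof (rule sets_vimage_algebra_subset)
      show "\<Psi> \<in> incr_alg P R \<xi> (space M - fixed_atoms) \<rightarrow>\<^sub>M point_measure_algebra J JR"
      proof (rule measurable_point_measure_algebraI)
        show "\<Psi> \<omega> \<in> point_measures J JR" if "\<omega> \<in> space (incr_alg P R \<xi> (space M - fixed_atoms))" for \<omega>
          unfolding \<Psi>_def using that by (intro jumps_point_measure ca_eta) simp
        show "(\<lambda>\<omega>. emeasure (\<Psi> \<omega>) C) \<in> borel_measurable (incr_alg P R \<xi> (space M - fixed_atoms))" if "C \<in> JR" for C
          using JR_sets[OF that] sets.sets_into_space[OF JR_sets[OF that]]
          by (intro Psi_measurable_incr[where B = "space M"]) (auto simp: space_jump_space)
      qed
    qed simp
    ultimately show "indep_set (sets (vimage_algebra (space P) (\<lambda>\<omega>. \<lambda>j\<in>?I. X j \<omega>) (PiM ?I (\<lambda>_. borel))))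
      (sets (vimage_algebra (space P) \<Psi> (point_measure_algebra J JR)))"
      by (rule indep_set_mono)
  next
    show "AE \<omega> in P. \<forall>B\<in>R. (\<lambda>j. X j \<omega> * measure (return M (s j)) B) summable_on ?I \<and>
      integrable (slice (\<Psi> \<omega>) B) (\<lambda>x. x) \<and>
      \<xi> \<omega> B = fixed_part M p X s \<omega> B + \<alpha> B + (\<integral>x. x \<partial>slice (\<Psi> \<omega>) B)"
      using AE_zeta_all
    proof (rule AE_mp, intro AE_I2 impI ballI)
      fix \<omega> B assume w: "\<omega> \<in> space P" and z: "\<forall>B\<in>R. \<zeta> \<omega> B = \<alpha> B" and B: "B \<in> R"
      have BM: "B \<subseteq> space M" using sets.sets_into_space[OF R_sets[OF B]] .
      have "\<xi> \<omega> B = \<xi> \<omega> (B \<inter> fixed_atoms) + \<eta> \<omega> B"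
      proof -
        have "\<xi> \<omega> ((B \<inter> fixed_atoms) \<union> (B \<inter> (space M - fixed_atoms))) = \<xi> \<omega> (B \<inter> fixed_atoms) + \<xi> \<omega> (B \<inter> (space M - fixed_atoms))"
          using fixed_atoms_sets by (intro additive_on[OF ca_xi[OF w]] R_Int B) auto
        moreover have "(B \<inter> fixed_atoms) \<union> (B \<inter> (space M - fixed_atoms)) = B" using BM by auto
        ultimately show ?thesis by (simp add: \<eta>_def)
      qed
      moreover have "\<eta> \<omega> B = \<alpha> B + (\<integral>x. x \<partial>slice (\<Psi> \<omega>) B)" using bspec[OF z B] by (simp add: \<zeta>_def)
      moreover have "integrable (slice (\<Psi> \<omega>) B) (\<lambda>x. x)"
        unfolding \<Psi>_def by (rule slice_jumps_integral(1)[OF ca_eta[OF w] B])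
      ultimately show "(\<lambda>j. X j \<omega> * measure (return M (s j)) B) summable_on ?I \<and>
        integrable (slice (\<Psi> \<omega>) B) (\<lambda>x. x) \<and>
        \<xi> \<omega> B = fixed_part M p X s \<omega> B + \<alpha> B + (\<integral>x. x \<partial>slice (\<Psi> \<omega>) B)"
        using fixed_part_eq[OF w s B] by (simp add: X_def[abs_def])
    qed
  qed
  moreover have "reduced_jumps P p X s"
    unfolding reduced_jumps_def X_def using inj sD by (auto simp: fixed_atoms_def)
  ultimately show ?thesis by blast
qed

end

section \<open>Independence of the increments of a representation\<close>

context prob_space
begin

text \<open>Required because a representation gives the values of \<open>\<xi>\<close> only almost
  surely.\<close>

lemma indep_vars_AE_cong:
  assumes ind: "indep_vars N X I" and AE: "\<And>i. i \<in> I \<Longrightarrow> AE \<omega> in M. X i \<omega> = Y i \<omega>"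
    and Y: "\<And>i. i \<in> I \<Longrightarrow> random_variable (N i) (Y i)"
  shows "indep_vars N Y I"
  unfolding indep_vars_def2
proof (intro conjI ballI Y, assumption)
  have X: "random_variable (N i) (X i)" if "i \<in> I" for i
    using ind that by (auto simp: indep_vars_def2)
  show "indep_sets (\<lambda>i. {Y i -` A \<inter> space M |A. A \<in> sets (N i)}) I"
    unfolding indep_sets_def
  proof (intro conjI ballI allI impI)
    show "{Y i -` A \<inter> space M |A. A \<in> sets (N i)} \<subseteq> events" if "i \<in> I" for i
      using measurable_sets[OF Y[OF that]] by auto
  next
    fix K B assume K: "K \<subseteq> I" "K \<noteq> {}" "finite K" and B: "B \<in> (\<Pi> i\<in>K. {Y i -` A \<inter> space M |A. A \<in> sets (N i)})"
    have "\<exists>A. B i = Y i -` A \<inter> space M \<and> A \<in> sets (N i)" if "i \<in> K" for i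
      using Pi_mem[OF B that] by blast
    then obtain A where A: "\<And>i. i \<in> K \<Longrightarrow> B i = Y i -` A i \<inter> space M" "\<And>i. i \<in> K \<Longrightarrow> A i \<in> sets (N i)" by metis
    have Xs: "X i -` A i \<inter> space M \<in> events" and Ys: "Y i -` A i \<inter> space M \<in> events" if "i \<in> K" for i
      using measurable_sets[OF X A(2)] measurable_sets[OF Y A(2)] K(1) that by auto
    have 1: "prob (X i -` A i \<inter> space M) = prob (B i)" if "i \<in> K" for i
      unfolding A(1)[OF that]
    proof (rule finite_measure_eq_AE)
      show "AE x in M. (x \<in> X i -` A i \<inter> space M) = (x \<in> Y i -` A i \<inter> space M)"
      proof -
        have "AE x in M. X i x = Y i x" using AE K(1) that by blast
        then show ?thesis by eventually_elim auto
      qed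
    qed (use Xs Ys that in auto)
    have "prob (\<Inter>i\<in>K. B i) = prob (\<Inter>i\<in>K. X i -` A i \<inter> space M)"
    proof (rule finite_measure_eq_AE)
      have "AE x in M. \<forall>i\<in>K. X i x = Y i x"
        using AE K by (intro AE_finite_allI) auto
      then show "AE x in M. (x \<in> (\<Inter>i\<in>K. B i)) = (x \<in> (\<Inter>i\<in>K. X i -` A i \<inter> space M))"
        by eventually_elim (simp add: A(1))
      show "(\<Inter>i\<in>K. B i) \<in> events" using Ys A(1) by (intro sets.finite_INT K(2,3)) simp
      show "(\<Inter>i\<in>K. X i -` A i \<inter> space M) \<in> events" using Xs by (intro sets.finite_INT K(2,3)) simp
    qed
    also have "\<dots> = (\<Prod>i\<in>K. prob (X i -` A i \<inter> space M))"
      using A K by (intro indep_varsD[OF ind]) auto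
    finally show "prob (\<Inter>i\<in>K. B i) = (\<Prod>i\<in>K. prob (B i))" using 1 by simp
  qed
qed

text \<open>The pairs formed by \<open>U i\<close> and \<open>V i\<close> are independent in
  \<open>i\<close>: events with one condition on each component are stable under intersection, and
  their probabilities factor between the two families and then within each.\<close>

lemma indep_vars_add_indep:
  fixes U V :: "'i \<Rightarrow> 'a \<Rightarrow> real"
  assumes U: "indep_vars (\<lambda>_. borel) U I" and V: "indep_vars (\<lambda>_. borel) V I"
    and UV: "indep_set (sets \<A>) (sets \<B>)" and sp: "space \<A> = space M" "space \<B> = space M"
    and UA: "\<And>i. i \<in> I \<Longrightarrow> U i \<in> borel_measurable \<A>" and VB: "\<And>i. i \<in> I \<Longrightarrow> V i \<in> borel_measurable \<B>"
  shows "indep_vars (\<lambda>_. borel) (\<lambda>i \<omega>. U i \<omega> + V i \<omega>) I"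
proof -
  have Um: "U i \<in> borel_measurable M" and Vm: "V i \<in> borel_measurable M" if "i \<in> I" for i
    using U V that by (auto simp: indep_vars_def2)
  define G where "G i = {(U i -` a \<inter> space M) \<inter> (V i -` b \<inter> space M) | a b. a \<in> sets borel \<and> b \<in> sets borel}" for i
  have G: "indep_sets G I"
    unfolding indep_sets_def
  proof (intro conjI ballI allI impI)
    show "G i \<subseteq> events" if "i \<in> I" for i
      unfolding G_def using measurable_sets[OF Um[OF that]] measurable_sets[OF Vm[OF that]] by auto
  next
    fix K X assume K: "K \<subseteq> I" "K \<noteq> {}" "finite K" and X: "X \<in> Pi K G"
    have "\<exists>a b. X i = (U i -` a \<inter> space M) \<inter> (V i -` b \<inter> space M) \<and> a \<in> sets borel \<and> b \<in> sets borel" if "i \<in> K" for i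
      using Pi_mem[OF X that] unfolding G_def by blast
    then obtain a b where ab: "\<And>i. i \<in> K \<Longrightarrow> X i = (U i -` a i \<inter> space M) \<inter> (V i -` b i \<inter> space M)"
      "\<And>i. i \<in> K \<Longrightarrow> a i \<in> sets borel" "\<And>i. i \<in> K \<Longrightarrow> b i \<in> sets borel" by metis
    let ?U = "\<lambda>i. U i -` a i \<inter> space M" and ?V = "\<lambda>i. V i -` b i \<inter> space M"
    have A: "?U i \<in> sets \<A>" and B: "?V i \<in> sets \<B>" if "i \<in> K" for i
      using measurable_sets[OF UA ab(2)] measurable_sets[OF VB ab(3)] K(1) that sp by auto
    have prodUV: "prob (x \<inter> y) = prob x * prob y" if "x \<in> sets \<A>" "y \<in> sets \<B>" for x y
      using indep_setD[OF UV] that by blast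
    have "prob (\<Inter>i\<in>K. X i) = prob ((\<Inter>i\<in>K. ?U i) \<inter> (\<Inter>i\<in>K. ?V i))"
      using ab(1) by (intro arg_cong[where f = prob]) auto
    also have "\<dots> = prob (\<Inter>i\<in>K. ?U i) * prob (\<Inter>i\<in>K. ?V i)"
      using K A B by (intro prodUV sets.finite_INT) auto
    also have "\<dots> = (\<Prod>i\<in>K. prob (?U i)) * (\<Prod>i\<in>K. prob (?V i))"
      using ab K by (intro arg_cong2[where f = "(*)"] indep_varsD[OF U] indep_varsD[OF V]) auto
    also have "\<dots> = (\<Prod>i\<in>K. prob (?U i \<inter> ?V i))"
      unfolding prod.distrib[symmetric] using prodUV A B by (intro prod.cong) auto
    also have "\<dots> = (\<Prod>i\<in>K. prob (X i))" using ab(1) by (intro prod.cong) auto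
    finally show "prob (\<Inter>i\<in>K. X i) = (\<Prod>i\<in>K. prob (X i))" .
  qed
  have "Int_stable (G i)" for i
    unfolding Int_stable_def
  proof (intro ballI)
    fix x y assume "x \<in> G i" "y \<in> G i"
    then obtain a b a' b' where x: "x = (U i -` a \<inter> space M) \<inter> (V i -` b \<inter> space M)" "a \<in> sets borel" "b \<in> sets borel"
      and y: "y = (U i -` a' \<inter> space M) \<inter> (V i -` b' \<inter> space M)" "a' \<in> sets borel" "b' \<in> sets borel" unfolding G_def by blast
    have "x \<inter> y = (U i -` (a \<inter> a') \<inter> space M) \<inter> (V i -` (b \<inter> b') \<inter> space M)" unfolding x(1) y(1) by auto
    then show "x \<inter> y \<in> G i" unfolding G_def using x(2,3) y(2,3) by blast
  qed
  from indep_sets_sigma[OF G this] have ind: "indep_sets (\<lambda>i. sigma_sets (space M) (G i)) I" .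
  have sub: "G i \<subseteq> Pow (space M)" for i by (auto simp: G_def)
  have "indep_sets (\<lambda>i. {(\<lambda>\<omega>. U i \<omega> + V i \<omega>) -` A \<inter> space M |A. A \<in> sets borel}) I"
  proof (rule indep_sets_mono_sets[OF ind])
    fix i assume i: "i \<in> I"
    let ?S = "sigma (space M) (G i)"
    have S: "space ?S = space M" "sets ?S = sigma_sets (space M) (G i)" using sub by auto
    have "U i -` a \<inter> space M \<in> G i" if "a \<in> sets borel" for a
    proof -
      have "U i -` a \<inter> space M = (U i -` a \<inter> space M) \<inter> (V i -` UNIV \<inter> space M)" by auto
      then show ?thesis unfolding G_def using that sets.top[of borel] by (intro CollectI exI[of _ a] exI[of _ UNIV]) auto
    qed
    then have u: "U i \<in> borel_measurable ?S" by (intro measurableI) (auto simp: S)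
    have "V i -` b \<inter> space M \<in> G i" if "b \<in> sets borel" for b
    proof -
      have "V i -` b \<inter> space M = (U i -` UNIV \<inter> space M) \<inter> (V i -` b \<inter> space M)" by auto
      then show ?thesis unfolding G_def using that sets.top[of borel] by (intro CollectI exI[of _ UNIV] exI[of _ b]) auto
    qed
    then have v: "V i \<in> borel_measurable ?S" by (intro measurableI) (auto simp: S)
    have "(\<lambda>\<omega>. U i \<omega> + V i \<omega>) \<in> borel_measurable ?S" using u v by measurable
    from measurable_sets[OF this] show "{(\<lambda>\<omega>. U i \<omega> + V i \<omega>) -` A \<inter> space M |A. A \<in> sets borel} \<subseteq> sigma_sets (space M) (G i)"
      unfolding S by auto
  qed
  then show ?thesis unfolding indep_vars_def2 using Um Vm by auto
qed

end

text \<open>The letters for a given representation keep clear of \<open>\<Psi>\<close>, which in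
  this context already denotes the jumps of \<open>\<eta>\<close>.\<close>

locale represented = random_signed_measure M R P \<xi>
  for M :: "'a measure" and R and P :: "'w measure" and \<xi> +
  fixes p :: enat and X :: "nat \<Rightarrow> 'w \<Rightarrow> real" and s :: "nat \<Rightarrow> 'a" and a :: "'a set \<Rightarrow> real"
    and Q :: "'w \<Rightarrow> ('a \<times> real) measure" and G :: "('a \<times> real) measure"
  assumes rep: "increment_representation P M R \<xi> p X s a Q G"
begin

abbreviation "I \<equiv> {j. enat j < p}"

lemma indep_X: "indep_vars (\<lambda>_. borel) X I"
  and s_space: "j \<in> I \<Longrightarrow> s j \<in> space M"
  and a_atomless: "atomless_difference M R a"
  and poisson_Q: "poisson_process P J JR G Q"
  and indep_X_Q: "indep_set (sets (vimage_algebra (space P) (\<lambda>\<omega>. \<lambda>j\<in>I. X j \<omega>) (PiM I (\<lambda>_. borel))))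
      (sets (vimage_algebra (space P) Q (point_measure_algebra J JR)))"
  and G_fiber: "t \<in> space M \<Longrightarrow> emeasure G (strip {t}) = 0"
  and AE_rep: "AE \<omega> in P. \<forall>B\<in>R. (\<lambda>j. X j \<omega> * measure (return M (s j)) B) summable_on I \<and>
      integrable (slice (Q \<omega>) B) (\<lambda>x. x) \<and>
      \<xi> \<omega> B = fixed_part M p X s \<omega> B + a B + (\<integral>x. x \<partial>slice (Q \<omega>) B)"
  using rep unfolding increment_representation_def by blast+

lemma Q_measurable: "Q \<in> P \<rightarrow>\<^sub>M point_measure_algebra J JR"
  and indep_Q: "indep_increments P JR (\<lambda>\<omega>. emeasure (Q \<omega>))"
  and loc_finite_G: "loc_finite J JR G"
  and prob_Q: "C \<in> JR \<Longrightarrow> prob {\<omega> \<in> space P. emeasure (Q \<omega>) C = of_nat k} = poisson_weight (measure G C) k"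
  using poisson_Q unfolding poisson_process_def poisson_weight_def by blast+

lemma Q_point: "\<omega> \<in> space P \<Longrightarrow> Q \<omega> \<in> point_measures J JR"
  using measurable_space[OF Q_measurable] by (simp add: sets_point_measure_algebra)

lemma sets_Q: "\<omega> \<in> space P \<Longrightarrow> sets (Q \<omega>) = sets J"
  using Q_point[of \<omega>] unfolding point_measures_def by blast

lemma emeasure_Q_measurable: "C \<in> JR \<Longrightarrow> (\<lambda>\<omega>. emeasure (Q \<omega>) C) \<in> borel_measurable P"
  by (rule measurable_compose[OF Q_measurable measurable_emeasure_point_measure_algebra])

lemma return_indicator: "B \<in> R \<Longrightarrow> measure (return M (s j)) B = indicator B (s j)"
  using R_sets by (simp add: measure_return)

lemma indep_sets_Q:
  assumes "disjoint_family_on E K"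
  shows "indep_sets (\<lambda>i. sets (incr_alg P JR (\<lambda>\<omega>. emeasure (Q \<omega>)) (E i))) K"
proof (rule indep_sets_incr_alg[OF ring_JR indep_Q _ _ assms])
  show "emeasure (Q \<omega>) (A \<union> B) = emeasure (Q \<omega>) A + emeasure (Q \<omega>) B"
    if "\<omega> \<in> space P" "A \<in> JR" "B \<in> JR" "A \<inter> B = {}" for \<omega> A B
    using that sets_Q[OF that(1)] JR_sets by (intro plus_emeasure[symmetric]) auto
qed simp

lemma integral_Q_measurable:
  assumes B: "B \<in> R" and m: "\<And>C. C \<in> JR \<Longrightarrow> C \<subseteq> B \<times> UNIV \<Longrightarrow> (\<lambda>\<omega>. emeasure (Q \<omega>) C) \<in> borel_measurable N"
    and N: "space N = space P"
  shows "(\<lambda>\<omega>. \<integral>x. x \<partial>slice (Q \<omega>) B) \<in> borel_measurable N"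
  using R_sets[OF B] sets_Q N by (intro integral_slice_measurable m) auto

text \<open>The fixed part as a function of the coordinates alone. The ordered limit is measurable
  for the product sigma-algebra and agrees with the unordered sum wherever that exists.\<close>

definition fixed_sum :: "'a set \<Rightarrow> (nat \<Rightarrow> real) \<Rightarrow> real" where
  "fixed_sum B f = lim (\<lambda>m. \<Sum>j<m. if j \<in> I \<and> s j \<in> B then f j else 0)"

lemma fixed_sum_measurable:
  assumes "{j \<in> I. s j \<in> B} \<subseteq> K"
  shows "fixed_sum B \<in> borel_measurable (PiM K (\<lambda>_. borel))"
proof -
  have "(\<lambda>f. if j \<in> I \<and> s j \<in> B then f j else 0) \<in> borel_measurable (PiM K (\<lambda>_. borel :: real measure))" for j
    using assms by (cases "j \<in> I \<and> s j \<in> B") (auto intro!: measurable_component_singleton)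
  then show ?thesis unfolding fixed_sum_def[abs_def]
    by (intro borel_measurable_lim_metric borel_measurable_sum) auto
qed

lemma AE_fixed_sum:
  assumes B: "B \<in> R"
  shows "AE \<omega> in P. fixed_part M p X s \<omega> B = fixed_sum B (\<lambda>j. X j \<omega>)"
  using AE_rep
proof eventually_elim
  case (elim \<omega>)
  let ?f = "\<lambda>j. X j \<omega> * measure (return M (s j)) B"
  let ?g = "\<lambda>j. if j \<in> I \<and> s j \<in> B then X j \<omega> else 0"
  have "(?f has_sum fixed_part M p X s \<omega> B) I"
    using elim B unfolding fixed_part_def by (intro has_sum_infsum) auto
  then have "(?g has_sum fixed_part M p X s \<omega> B) UNIV"
    by (rule has_sum_cong_neutral[THEN iffD1, rotated -1]) (auto simp: return_indicator[OF B])
  then have "?g sums fixed_part M p X s \<omega> B" by (rule has_sum_imp_sums)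
  then show ?case unfolding fixed_sum_def sums_def by (simp add: limI)
qed

text \<open>An increment is a function of the \<open>X j\<close> located in \<open>B i\<close>, plus
  a function of the points of \<open>Q\<close> over \<open>B i\<close>, plus a constant. Disjoint
  \<open>B i\<close> give disjoint index sets and disjoint regions, and the two families are
  independent of each other.\<close>

lemma indep_increments_xi: "indep_increments P R \<xi>"
  unfolding indep_increments_def
proof (intro allI impI, elim conjE)
  fix n and B :: "nat \<Rightarrow> 'a set"
  assume "\<forall>i<n. B i \<in> R" and disj: "disjoint_family_on B {..<n}"
  then have B: "B i \<in> R" if "i \<in> {..<n}" for i using that by auto
  define K where "K i = {j \<in> I. s j \<in> B i}" for i
  have dK: "disjoint_family_on K {..<n}" using disj unfolding disjoint_family_on_def K_def by blast
  let ?A = "vimage_algebra (space P) (\<lambda>\<omega>. \<lambda>j\<in>I. X j \<omega>) (PiM I (\<lambda>_. borel))"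
  let ?B = "vimage_algebra (space P) Q (point_measure_algebra J JR)"
  define U where "U i \<omega> = fixed_sum (B i) (\<lambda>j. X j \<omega>)" for i \<omega>
  define V where "V i \<omega> = (\<integral>x. x \<partial>slice (Q \<omega>) (B i))" for i \<omega>
  have fs_restrict: "fixed_sum D (restrict f L) = fixed_sum D f" if "{j \<in> I. s j \<in> D} \<subseteq> L" for D f L
    unfolding fixed_sum_def using that by (intro arg_cong[where f = lim] ext sum.cong) auto
  have U: "indep_vars (\<lambda>_. borel) U {..<n}"
  proof -
    have "indep_vars (\<lambda>i. PiM (K i) (\<lambda>_. borel)) (\<lambda>i \<omega>. restrict (\<lambda>j. X j \<omega>) (K i)) {..<n}"
      using dK by (intro indep_vars_restrict[OF indep_X]; (assumption | force simp: K_def))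
    from indep_vars_compose2[OF this, of "\<lambda>i. fixed_sum (B i)" "\<lambda>_. borel"]
    have "indep_vars (\<lambda>_. borel) (\<lambda>i \<omega>. fixed_sum (B i) (restrict (\<lambda>j. X j \<omega>) (K i))) {..<n}"
      using fixed_sum_measurable unfolding K_def by blast
    then show ?thesis unfolding U_def[abs_def] by (simp add: fs_restrict K_def)
  qed
  have V: "indep_vars (\<lambda>_. borel) V {..<n}"
  proof (rule indep_vars_incr_alg[OF indep_sets_Q])
    show "disjoint_family_on (\<lambda>i. B i \<times> (UNIV :: real set)) {..<n}" using disj by (auto simp: disjoint_family_on_def)
    show "V i \<in> borel_measurable (incr_alg P JR (\<lambda>\<omega>. emeasure (Q \<omega>)) (B i \<times> UNIV))" if "i \<in> {..<n}" for i
      unfolding V_def using B[OF that] by (intro integral_Q_measurable measurable_incr_alg) auto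
  qed
  have UV: "indep_vars (\<lambda>_. borel) (\<lambda>i \<omega>. U i \<omega> + V i \<omega>) {..<n}"
  proof (rule indep_vars_add_indep[OF U V indep_X_Q])
    have XI: "(\<lambda>\<omega>. \<lambda>j\<in>I. X j \<omega>) \<in> space P \<rightarrow> space (PiM I (\<lambda>_. borel))" by (auto simp: space_PiM)
    show "U i \<in> borel_measurable ?A" for i
    proof -
      have "(\<lambda>\<omega>. fixed_sum (B i) (\<lambda>j\<in>I. X j \<omega>)) \<in> borel_measurable ?A"
        by (rule measurable_compose[OF measurable_vimage_algebra1[OF XI] fixed_sum_measurable]) auto
      then show ?thesis unfolding U_def[abs_def] by (subst (asm) fs_restrict) auto
    qed
    show "V i \<in> borel_measurable ?B" if i: "i \<in> {..<n}" for i
      unfolding V_def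
    proof (rule integral_Q_measurable[OF B[OF i]])
      have "Q \<in> space P \<rightarrow> space (point_measure_algebra J JR)" using Q_point by (auto simp: sets_point_measure_algebra)
      then show "(\<lambda>\<omega>. emeasure (Q \<omega>) C) \<in> borel_measurable ?B" if "C \<in> JR" for C
        using that by (intro measurable_compose[OF measurable_vimage_algebra1 measurable_emeasure_point_measure_algebra])
    qed simp
  qed auto
  have "indep_vars (\<lambda>_. borel) (\<lambda>i \<omega>. U i \<omega> + V i \<omega> + a (B i)) {..<n}"
    using indep_vars_compose2[OF UV, of "\<lambda>i x. x + a (B i)" "\<lambda>_. borel"] by simp
  then show "indep_vars (\<lambda>_. borel) (\<lambda>i \<omega>. \<xi> \<omega> (B i)) {..<n}"
  proof (rule indep_vars_AE_cong)
    fix i assume i: "i \<in> {..<n}"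
    show "AE \<omega> in P. U i \<omega> + V i \<omega> + a (B i) = \<xi> \<omega> (B i)"
      using AE_rep AE_fixed_sum[OF B[OF i]]
      by eventually_elim (use B[OF i] in \<open>simp add: U_def V_def\<close>)
    show "(\<lambda>\<omega>. \<xi> \<omega> (B i)) \<in> borel_measurable P" by (rule xi_measurable[OF B[OF i]])
  qed
qed

end

section \<open>Uniqueness\<close>

context localized_borel
begin

lemma point_measure_integer_base:
  assumes Q: "Q \<in> point_measures J JR" and C: "C \<in> JR"
  shows "finite_measure (base Q C)" "A \<in> sets M \<Longrightarrow> \<exists>k::nat. emeasure (base Q C) A = of_nat k"
proof -
  have s: "sets Q = sets J" and n: "\<And>D. D \<in> JR \<Longrightarrow> \<exists>k::nat. emeasure Q D = of_nat k"
    using Q unfolding point_measures_def by blast+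
  note Cs = JR_sets[OF C]
  show "finite_measure (base Q C)"
    using n[OF C] by (intro finite_base s Cs) (auto simp: of_nat_less_top)
  assume A: "A \<in> sets M"
  have "C \<inter> strip A \<in> JR" using Cs A by (intro JR_subset[OF C]) auto
  then show "\<exists>k::nat. emeasure (base Q C) A = of_nat k"
    unfolding emeasure_base[OF s Cs A] by (rule n)
qed

lemma point_measure_carrier:
  assumes Q: "Q \<in> point_measures J JR" and C: "C \<in> JR"
  shows "\<exists>T. countable T \<and> T \<subseteq> space M \<and> (\<forall>T'. countable T' \<and> T \<subseteq> T' \<and> T' \<subseteq> space M \<longrightarrow>
    emeasure Q C = emeasure Q (C \<inter> strip T'))"
proof -
  have s: "sets Q = sets J" using Q unfolding point_measures_def by blast
  note Cs = JR_sets[OF C]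
  let ?p = "base Q C" and ?T = "{t. measure (base Q C) {t} \<noteq> 0}"
  note pa = integer_measure_atomic[OF point_measure_integer_base(1)[OF Q C] sets_base point_measure_integer_base(2)[OF Q C]]
  have TM: "?T \<subseteq> space M"
  proof
    fix t assume "t \<in> ?T"
    then have "{t} \<in> sets ?p" using measure_notin_sets[of "{t}" ?p] by auto
    then show "t \<in> space M" using sets.sets_into_space by fastforce
  qed
  have "emeasure Q C = emeasure Q (C \<inter> strip T')" if T': "countable T'" "?T \<subseteq> T'" "T' \<subseteq> space M" for T'
  proof -
    have T's: "T' \<in> sets M" by (rule countable_sets[OF T'(1,3)])
    have "emeasure ?p (space M - T') \<le> emeasure ?p (space M - ?T)"
      using T'(2) countable_sets[OF pa(1) TM] by (intro emeasure_mono) auto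
    then have z: "emeasure Q (C \<inter> strip (space M - T')) = 0"
      using pa(2) emeasure_base[OF s Cs, of "space M - T'"] T's by simp
    have "C = (C \<inter> strip T') \<union> (C \<inter> strip (space M - T'))"
      using sets.sets_into_space[OF Cs] T'(3) by (auto simp: space_jump_space)
    then have "emeasure Q C = emeasure Q ((C \<inter> strip T') \<union> (C \<inter> strip (space M - T')))" by simp
    also have "\<dots> = emeasure Q (C \<inter> strip T') + emeasure Q (C \<inter> strip (space M - T'))"
    proof (rule plus_emeasure[symmetric])
      show "C \<inter> strip T' \<in> sets Q" "C \<inter> strip (space M - T') \<in> sets Q"
        unfolding s using T's by (intro sets.Int Cs strip_sets sets.Diff sets.top; assumption)+
    qed auto
    finally show ?thesis using z by simp
  qed
  then show ?thesis using pa(1) TM by blast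
qed

text \<open>On a common countable carrier both measures are sums over fibres; the boxes then reach
  all measurable sets.\<close>

lemma point_measure_eqI:
  assumes Q: "Q \<in> point_measures J JR" "Q' \<in> point_measures J JR"
    and eq: "\<And>t A. t \<in> space M \<Longrightarrow> A \<in> sets punctured_line \<Longrightarrow> emeasure Q ({t} \<times> A) = emeasure Q' ({t} \<times> A)"
  shows "Q = Q'"
proof (rule measure_eqI)
  have s: "sets Q = sets J" "sets Q' = sets J" using Q unfolding point_measures_def by blast+
  then show "sets Q = sets Q'" by simp
  have JR: "emeasure Q C = emeasure Q' C" if C: "C \<in> JR" for C
  proof -
    note Cs = JR_sets[OF C]
    obtain T where T: "countable T" "T \<subseteq> space M" "emeasure Q C = emeasure Q (C \<inter> strip T)" "emeasure Q' C = emeasure Q' (C \<inter> strip T)"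
    proof -
      obtain T1 where T1: "countable T1" "T1 \<subseteq> space M"
        "\<forall>T'. countable T' \<and> T1 \<subseteq> T' \<and> T' \<subseteq> space M \<longrightarrow> emeasure Q C = emeasure Q (C \<inter> strip T')"
        using point_measure_carrier[OF Q(1) C] by blast
      obtain T2 where T2: "countable T2" "T2 \<subseteq> space M"
        "\<forall>T'. countable T' \<and> T2 \<subseteq> T' \<and> T' \<subseteq> space M \<longrightarrow> emeasure Q' C = emeasure Q' (C \<inter> strip T')"
        using point_measure_carrier[OF Q(2) C] by blast
      show thesis
      proof (rule that)
        show c: "countable (T1 \<union> T2)" and m: "T1 \<union> T2 \<subseteq> space M" using T1(1,2) T2(1,2) by simp_all
        show "emeasure Q C = emeasure Q (C \<inter> strip (T1 \<union> T2))" using c m by (intro T1(3)[rule_format]) simp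
        show "emeasure Q' C = emeasure Q' (C \<inter> strip (T1 \<union> T2))" using c m by (intro T2(3)[rule_format]) simp
      qed
    qed
    have fib: "C \<inter> strip {t} = {t} \<times> (Pair t -` C)" if "t \<in> T" for t
      using sets.sets_into_space[OF Cs] by (auto simp: space_jump_space)
    have sec: "Pair t -` C \<in> sets punctured_line" for t
      using sets_Pair1[of C M punctured_line t] Cs by (simp add: jump_space_def)
    have UT: "C \<inter> strip T = (\<Union>t\<in>T. C \<inter> strip {t})" by auto
    have sum: "emeasure r (C \<inter> strip T) = (\<integral>\<^sup>+t. emeasure r (C \<inter> strip {t}) \<partial>count_space T)" if r: "sets r = sets J" for r
      unfolding UT
    proof (rule emeasure_UN_countable[OF _ T(1)])
      show "C \<inter> strip {t} \<in> sets r" if "t \<in> T" for t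
        unfolding r using that T(2) Cs by (intro sets.Int strip_sets singleton_sets) auto
      show "disjoint_family_on (\<lambda>t. C \<inter> strip {t}) T" by (auto simp: disjoint_family_on_def)
    qed
    have "emeasure Q (C \<inter> strip {t}) = emeasure Q' (C \<inter> strip {t})" if "t \<in> T" for t
      unfolding fib[OF that] using that T(2) by (intro eq sec) auto
    then have "emeasure Q (C \<inter> strip T) = emeasure Q' (C \<inter> strip T)"
      unfolding sum[OF s(1)] sum[OF s(2)] by (intro nn_integral_cong) auto
    then show ?thesis using T(3,4) by simp
  qed
  fix C assume "C \<in> sets Q"
  then have C: "C \<in> sets J" using s by simp
  show "emeasure Q C = emeasure Q' C"
    unfolding emeasure_box_SUP[OF s(1) C] emeasure_box_SUP[OF s(2) C]
    using JR[OF Int_box_JR[OF C]] by simp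
qed

text \<open>The slice takes only the values 0 and 1, so it is zero or a point mass, and a point mass
  sits at its mean. Integrality is known only on \<open>JR\<close>, so the values are determined
  inside the boxes and passed to the limit.\<close>

lemma simple_fiber:
  assumes Q: "Q \<in> point_measures J JR" and t: "t \<in> space M" and le: "emeasure Q (strip {t}) \<le> 1"
    and int: "integrable (slice Q {t}) (\<lambda>x. x)" and A: "A \<in> sets punctured_line"
  shows "emeasure Q ({t} \<times> A) = indicator A (\<integral>x. x \<partial>slice Q {t})"
proof -
  have s: "sets Q = sets J" and n: "\<And>D. D \<in> JR \<Longrightarrow> \<exists>k::nat. emeasure Q D = of_nat k"
    using Q unfolding point_measures_def by blast+
  let ?k = "slice Q {t}"
  define y where "y = (\<integral>x. x \<partial>?k)"
  have e: "emeasure ?k A = emeasure Q ({t} \<times> A)" if "A \<in> sets punctured_line" for A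
    using that t by (intro emeasure_slice[OF s]) auto
  have 01: "emeasure ?k A = 0 \<or> emeasure ?k A = 1" if A: "A \<in> sets punctured_line" for A
  proof -
    have tA: "{t} \<times> A \<in> sets J" using t A by auto
    have eA: "emeasure ?k A = (SUP m. emeasure Q ({t} \<times> A \<inter> box m))"
      unfolding e[OF A] by (rule emeasure_box_SUP[OF s tA])
    have vals: "emeasure Q ({t} \<times> A \<inter> box m) = 0 \<or> emeasure Q ({t} \<times> A \<inter> box m) = 1" for m
    proof -
      obtain k :: nat where k: "emeasure Q ({t} \<times> A \<inter> box m) = of_nat k" using n[OF Int_box_JR[OF tA]] by blast
      have "emeasure Q ({t} \<times> A \<inter> box m) \<le> emeasure Q (strip {t})"
        using sets.sets_into_space[OF A] t unfolding s by (intro emeasure_mono) (auto simp: s)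
      then have "(of_nat k :: ennreal) \<le> 1" unfolding k using le by (rule order_trans)
      then have "k \<le> 1" by (simp add: ennreal_of_nat_eq_real_of_nat)
      then show ?thesis using k by (cases k) auto
    qed
    show ?thesis
    proof (cases "\<exists>m. emeasure Q ({t} \<times> A \<inter> box m) = 1")
      case True
      then obtain m where m: "emeasure Q ({t} \<times> A \<inter> box m) = 1" by blast
      have "emeasure ?k A \<le> 1" unfolding eA using vals by (intro SUP_least) (metis order_refl zero_le_one)
      moreover have "1 \<le> emeasure ?k A" unfolding eA using m by (metis SUP_upper UNIV_I)
      ultimately show ?thesis by (intro disjI2 antisym)
    next
      case False
      then show ?thesis unfolding eA using vals by simp
    qed
  qed
  have top: "UNIV - {0::real} \<in> sets punctured_line" by (simp add: sets_punctured_line)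
  show ?thesis
  proof (cases "emeasure ?k (UNIV - {0}) = 0")
    \<comment> \<open>Without a point the mean is 0, which lies outside \<open>A\<close>, so both
      sides vanish.\<close>
    case True
    have "AE x in ?k. False"
    proof (rule AE_I[OF _ True])
      show "UNIV - {0} \<in> sets ?k" by (simp only: sets_slice top)
    qed auto
    then have "y = (\<integral>x. 0 \<partial>?k)" unfolding y_def using borel_measurable_integrable[OF int] by (intro integral_cong_AE) auto
    then have "y = 0" by simp
    moreover have "emeasure ?k A \<le> emeasure ?k (UNIV - {0})"
      using A by (intro emeasure_mono) (auto simp: sets_punctured_line top)
    ultimately show ?thesis using True e[OF A] A unfolding y_def[symmetric] by (simp add: sets_punctured_line)
  next
    case False
    then have "emeasure ?k (space ?k) = 1" using 01[OF top] by simp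
    then interpret k: prob_space ?k by (rule prob_spaceI)
    \<comment> \<open>The whole mass cannot lie strictly on one side of the mean;
      \<open>c = 1\<close> and \<open>c = - 1\<close> treat the two sides.\<close>
    have half: "emeasure ?k {x. x \<noteq> 0 \<and> c * x > c * y} = 0" if c: "c \<noteq> 0" for c
    proof (rule ccontr)
      let ?U = "{x. x \<noteq> 0 \<and> c * x > c * y}"
      assume ne: "emeasure ?k ?U \<noteq> 0"
      have U: "?U \<in> sets punctured_line" by (simp add: sets_punctured_line)
      from 01[OF U] ne have "emeasure ?k ?U = 1" by blast
      then have "k.prob ?U = 1" by (simp add: measure_def)
      then have AE: "AE x in ?k. x \<in> ?U" using U by (subst (asm) k.prob_eq_1) auto
      have i: "integrable ?k (\<lambda>x. c * x - c * y)" using int by simp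
      have "(\<integral>x. c * x - c * y \<partial>?k) = 0" using int by (simp add: k.prob_space[simplified] y_def)
      then have "AE x in ?k. c * x - c * y = 0"
      proof (subst (asm) integral_nonneg_eq_0_iff_AE[OF i])
        show "AE x in ?k. 0 \<le> c * x - c * y" using AE by eventually_elim auto
      qed
      with AE have "AE x in ?k. False" by eventually_elim auto
      then show False by simp
    qed
    have "AE x in ?k. x = y"
    proof (rule AE_I[where N = "{x. x \<noteq> 0 \<and> 1 * x > 1 * y} \<union> {x. x \<noteq> 0 \<and> - 1 * x > - 1 * y}"])
      have m: "{x. x \<noteq> 0 \<and> 1 * x > 1 * y} \<in> sets ?k" "{x. x \<noteq> 0 \<and> - 1 * x > - 1 * y} \<in> sets ?k"
        by (auto simp: sets_punctured_line)
      then show "{x. x \<noteq> 0 \<and> 1 * x > 1 * y} \<union> {x. x \<noteq> 0 \<and> - 1 * x > - 1 * y} \<in> sets ?k" by (rule sets.Un)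
      have "{x. x \<noteq> 0 \<and> 1 * x > 1 * y} \<in> null_sets ?k" "{x. x \<noteq> 0 \<and> - 1 * x > - 1 * y} \<in> null_sets ?k"
        using m half[of 1] half[of "- 1"] by (simp_all add: null_sets_def)
      then have "{x. x \<noteq> 0 \<and> 1 * x > 1 * y} \<union> {x. x \<noteq> 0 \<and> - 1 * x > - 1 * y} \<in> null_sets ?k" by (rule null_sets.Un)
      then show "emeasure ?k ({x. x \<noteq> 0 \<and> 1 * x > 1 * y} \<union> {x. x \<noteq> 0 \<and> - 1 * x > - 1 * y}) = 0"
        by (simp only: null_sets_def mem_Collect_eq)
    qed auto
    then have "(\<integral>\<^sup>+x. indicator A x \<partial>?k) = (\<integral>\<^sup>+x. indicator A y \<partial>?k)"
      by (intro nn_integral_cong_AE) (auto elim!: eventually_mono)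
    then have "emeasure ?k A = indicator A y"
      using A by (simp add: k.emeasure_space_1[simplified])
    then show ?thesis using e[OF A] by (simp add: y_def)
  qed
qed

end

text \<open>Since \<open>1 - l \<le> exp (- l)\<close>, the left-hand side is at most
  \<open>1 - (1 - l) * (1 + l)\<close>, which is \<open>l\<^sup>2\<close>.\<close>

lemma poisson_weight_tail: fixes l :: real assumes "0 \<le> l"
  shows "1 - poisson_weight l 0 - poisson_weight l 1 \<le> l\<^sup>2"
proof -
  have "1 - l \<le> exp (- l)" using exp_ge_add_one_self[of "- l"] by simp
  then have "(1 - l) * (1 + l) \<le> exp (- l) * (1 + l)" using assms by (intro mult_right_mono) auto
  then show ?thesis by (simp add: poisson_weight_def power2_eq_square algebra_simps)
qed

section \<open>Almost sure properties of the Poisson process in a representation\<close>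

context represented
begin

lemma sets_G: "sets G = sets J" and G_finite: "C \<in> JR \<Longrightarrow> emeasure G C < \<infinity>"
  using loc_finite_G by (auto simp: loc_finite_def)

lemma Q_events:
  assumes "C \<in> JR" "A \<in> sets borel"
  shows "{\<omega> \<in> space P. emeasure (Q \<omega>) C \<in> A} \<in> events"
proof -
  have "(\<lambda>\<omega>. emeasure (Q \<omega>) C) -` A \<inter> space P \<in> events"
    by (rule measurable_sets[OF emeasure_Q_measurable[OF assms(1)] assms(2)])
  then show ?thesis by (simp add: vimage_def Int_def conj_commute)
qed

lemma prob_Q_ge_2:
  assumes C: "C \<in> JR"
  shows "prob {\<omega> \<in> space P. emeasure (Q \<omega>) C \<in> - {0, 1}} \<le> (measure G C)\<^sup>2"
proof -
  have e: "{\<omega> \<in> space P. emeasure (Q \<omega>) C = of_nat k} \<in> events" for k :: nat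
    using Q_events[OF C, of "{of_nat k}"] by simp
  have "prob {\<omega> \<in> space P. emeasure (Q \<omega>) C \<in> {0, 1}}
      = prob ({\<omega> \<in> space P. emeasure (Q \<omega>) C = of_nat 0} \<union> {\<omega> \<in> space P. emeasure (Q \<omega>) C = of_nat 1})"
    by (intro arg_cong[where f = prob]) auto
  also have "\<dots> = poisson_weight (measure G C) 0 + poisson_weight (measure G C) 1"
    unfolding prob_Q[OF C, symmetric] by (rule finite_measure_Union[OF e e]) auto
  finally have "prob {\<omega> \<in> space P. emeasure (Q \<omega>) C \<in> {0, 1}} = poisson_weight (measure G C) 0 + poisson_weight (measure G C) 1" .
  moreover have "prob {\<omega> \<in> space P. emeasure (Q \<omega>) C \<in> - {0, 1}} = 1 - prob {\<omega> \<in> space P. emeasure (Q \<omega>) C \<in> {0, 1}}"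
  proof -
    have "{\<omega> \<in> space P. emeasure (Q \<omega>) C \<in> - {0, 1}} = space P - {\<omega> \<in> space P. emeasure (Q \<omega>) C \<in> {0, 1}}" by auto
    then show ?thesis using prob_compl[OF Q_events[OF C, of "{0, 1}"]] by simp
  qed
  ultimately show ?thesis using poisson_weight_tail[of "measure G C"] by simp
qed

text \<open>Two points of a box over one location share a cell at every level. At level
  \<open>n\<close> some cell holds two or more points with probability at most the sum of the
  squared masses, which tends to 0 as \<open>G\<close> has no mass on fibres.\<close>

lemma AE_simple: "AE \<omega> in P. \<forall>t\<in>space M. emeasure (Q \<omega>) (strip {t}) \<le> 1"
proof -
  have box: "AE \<omega> in P. \<forall>t\<in>space M. emeasure (Q \<omega>) (box m \<inter> strip {t}) \<le> 1" for m
  proof -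
    have JRk: "box m \<inter> strip (cells n k) \<in> JR" for n k by (rule JR_subset[OF box_JR]) auto
    define E where "E n = (\<Union>k\<le>2 ^ n. {\<omega> \<in> space P. emeasure (Q \<omega>) (box m \<inter> strip (cells n k)) \<in> - {0, 1}})" for n
    have Ek: "{\<omega> \<in> space P. emeasure (Q \<omega>) (box m \<inter> strip (cells n k)) \<in> - {0, 1}} \<in> events" for n k
      by (rule Q_events[OF JRk]) auto
    then have E: "E n \<in> events" for n unfolding E_def by (intro sets.finite_UN) auto
    have PE: "prob (E n) \<le> (\<Sum>k\<le>2 ^ n. (measure G (box m \<inter> strip (cells n k)))\<^sup>2)" for n
    proof -
      have "prob (E n) \<le> (\<Sum>k\<le>2 ^ n. prob {\<omega> \<in> space P. emeasure (Q \<omega>) (box m \<inter> strip (cells n k)) \<in> - {0, 1}})"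
        unfolding E_def using Ek by (intro finite_measure_subadditive_finite) auto
      also have "\<dots> \<le> (\<Sum>k\<le>2 ^ n. (measure G (box m \<inter> strip (cells n k)))\<^sup>2)"
        by (intro sum_mono prob_Q_ge_2 JRk)
      finally show ?thesis .
    qed
    have INT: "(\<Inter>n. E n) \<in> events" using E by (intro sets.countable_INT) auto
    have "prob (\<Inter>n. E n) \<le> (\<Sum>k\<le>2 ^ n. (measure G (box m \<inter> strip (cells n k)))\<^sup>2)" for n
    proof -
      have "prob (\<Inter>n. E n) \<le> prob (E n)" by (intro finite_measure_mono E) auto
      then show ?thesis using PE[of n] by simp
    qed
    moreover have "(\<lambda>n. \<Sum>k\<le>2 ^ n. (measure G (box m \<inter> strip (cells n k)))\<^sup>2) \<longlonglongrightarrow> 0"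
      by (rule strip_cells_square[OF sets_G box_sets G_finite[OF box_JR] G_fiber])
    ultimately have "prob (\<Inter>n. E n) \<le> 0" by (intro LIMSEQ_le_const) auto
    then have "prob (\<Inter>n. E n) = 0" by (intro antisym measure_nonneg)
    then have "(\<Inter>n. E n) \<in> null_sets P"
      using INT by (simp add: null_sets_def emeasure_eq_measure)
    then have "AE \<omega> in P. \<omega> \<notin> (\<Inter>n. E n)" by (rule AE_not_in)
    then show ?thesis
    proof (rule AE_mp, intro AE_I2 impI ballI)
      fix \<omega> t assume w: "\<omega> \<in> space P" "\<omega> \<notin> (\<Inter>n. E n)" and t: "t \<in> space M"
      then obtain n where "\<omega> \<notin> E n" by blast
      then have v: "emeasure (Q \<omega>) (box m \<inter> strip (cells n (cell n t))) \<in> {0, 1}"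
        using w(1) cell_le[OF t, of n] by (auto simp: E_def)
      have "emeasure (Q \<omega>) (box m \<inter> strip {t}) \<le> emeasure (Q \<omega>) (box m \<inter> strip (cells n (cell n t)))"
        using mem_cells[OF t] sets_Q[OF w(1)] JR_sets[OF JRk] by (intro emeasure_mono) auto
      also have "\<dots> \<le> 1" using v by auto
      finally show "emeasure (Q \<omega>) (box m \<inter> strip {t}) \<le> 1" .
    qed
  qed
  have "AE \<omega> in P. \<forall>m. \<forall>t\<in>space M. emeasure (Q \<omega>) (box m \<inter> strip {t}) \<le> 1"
    unfolding AE_all_countable using box by blast
  then show ?thesis
  proof (rule AE_mp, intro AE_I2 impI ballI)
    fix \<omega> t assume w: "\<omega> \<in> space P" "\<forall>m. \<forall>t\<in>space M. emeasure (Q \<omega>) (box m \<inter> strip {t}) \<le> 1" and t: "t \<in> space M"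
    show "emeasure (Q \<omega>) (strip {t}) \<le> 1"
      unfolding emeasure_box_SUP[OF sets_Q[OF w(1)] strip_sets[OF singleton_sets[OF t]]]
      using w(2) t by (intro SUP_least) (simp add: Int_commute)
  qed
qed

text \<open>A countable union of fibres has measure 0 under \<open>G\<close>, and a Poisson count of
  mean 0 vanishes almost surely.\<close>

lemma AE_null_strip:
  assumes T: "countable T" "T \<subseteq> space M"
  shows "AE \<omega> in P. emeasure (Q \<omega>) (strip T) = 0"
proof -
  have Ts: "T \<in> sets M" by (rule countable_sets[OF T])
  have "(\<Union>t\<in>T. strip {t}) \<in> null_sets G"
    using T G_fiber sets_G by (intro null_sets_UN') (auto simp: null_sets_def subset_iff)
  moreover have "(\<Union>t\<in>T. strip {t}) = strip T" by auto
  ultimately have G0: "emeasure G (strip T) = 0" by (simp add: null_sets_def)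
  have "AE \<omega> in P. emeasure (Q \<omega>) (strip T \<inter> box m) = 0" for m
  proof -
    have C: "strip T \<inter> box m \<in> JR" using Ts by (intro Int_box_JR) auto
    have "emeasure G (strip T \<inter> box m) \<le> emeasure G (strip T)"
      unfolding sets_G using Ts sets_G by (intro emeasure_mono) auto
    then have "measure G (strip T \<inter> box m) = 0" using G0 by (simp add: measure_def)
    then have "prob {\<omega> \<in> space P. emeasure (Q \<omega>) (strip T \<inter> box m) = 0} = 1"
      using prob_Q[OF C, of 0] by (simp add: poisson_weight_def)
    moreover have "{\<omega> \<in> space P. emeasure (Q \<omega>) (strip T \<inter> box m) = 0} \<in> events"
      using Q_events[OF C, of "{0}"] by simp
    ultimately show ?thesis by (subst (asm) prob_Collect_eq_1) auto
  qed
  then have "AE \<omega> in P. \<forall>m. emeasure (Q \<omega>) (strip T \<inter> box m) = 0" by (simp add: AE_all_countable)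
  then show ?thesis
  proof (rule AE_mp, intro AE_I2 impI)
    fix \<omega> assume w: "\<omega> \<in> space P" "\<forall>m. emeasure (Q \<omega>) (strip T \<inter> box m) = 0"
    then show "emeasure (Q \<omega>) (strip T) = 0"
      using Ts by (subst emeasure_box_SUP[OF sets_Q[OF w(1)]]) auto
  qed
qed

lemma countable_locations: "countable (s ` I)" "s ` I \<subseteq> space M"
  using s_space by auto

text \<open>Countable sets are null for atomless measures, so restricting to the locations of the
  fixed jumps removes \<open>a\<close>.\<close>

lemma a_countable:
  assumes B: "B \<in> R" and T: "countable T" "T \<subseteq> space M" shows "a (B \<inter> T) = 0"
proof -
  obtain p q where pq: "loc_finite M R p" "loc_finite M R q" "atomless p" "atomless q"
    "\<forall>B\<in>R. a B = measure p B - measure q B"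
    using a_atomless unfolding atomless_difference_def by blast
  have BT: "B \<inter> T \<in> R" by (rule R_Int[OF B countable_sets[OF T]])
  have z: "measure r (B \<inter> T) = 0" if r: "loc_finite M R r" "atomless r" for r
  proof -
    have sr: "sets r = sets M" using r(1) by (simp add: loc_finite_def)
    then have sp: "space r = space M" by (rule sets_eq_imp_space_eq)
    have "(\<Union>t\<in>B \<inter> T. {t}) \<in> null_sets r"
      using r(2) T sr sp by (intro null_sets_UN') (auto simp: atomless_def null_sets_def subset_iff)
    then show ?thesis by (simp add: null_sets_def measure_def)
  qed
  show ?thesis using pq(5) BT z[OF pq(1,3)] z[OF pq(2,4)] by simp
qed

lemma fixed_part_locations:
  assumes B: "B \<in> R" and T: "s ` I \<subseteq> T" "T \<in> sets M"
  shows "fixed_part M p X s \<omega> (B \<inter> T) = fixed_part M p X s \<omega> B"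
  unfolding fixed_part_def
  using T by (intro infsum_cong) (auto simp: return_indicator[OF B] return_indicator[OF R_Int[OF B T(2)]] indicator_def)

lemma fixed_part_singleton:
  assumes inj: "inj_on s I" and j: "j \<in> I"
  shows "fixed_part M p X s \<omega> {s j} = X j \<omega>"
proof -
  have ret: "measure (return M (s i)) {s j} = indicator {s j} (s i)" for i
    using s_space[OF j] by (intro return_indicator) auto
  have "fixed_part M p X s \<omega> {s j} = (\<Sum>\<^sub>\<infinity>i\<in>{j}. X i \<omega>)"
    unfolding fixed_part_def
    by (rule infsum_cong_neutral) (use inj j in \<open>auto simp: ret indicator_def inj_on_def\<close>)
  then show ?thesis by simp
qed

lemma fixed_part_off:
  assumes "t \<in> space M" "t \<notin> s ` I" shows "fixed_part M p X s \<omega> {t} = 0"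
proof -
  have ret: "measure (return M (s i)) {t} = indicator {t} (s i)" for i
    using assms(1) by (intro return_indicator) auto
  show ?thesis unfolding fixed_part_def
    by (rule infsum_0) (use assms(2) in \<open>auto simp: ret indicator_def\<close>)
qed

text \<open>Off \<open>T\<close> neither the fixed part nor \<open>a\<close> charges
  \<open>{t}\<close>, so \<open>\<xi> \<omega> {t}\<close> is the mean of the slice and hence the
  size of its only point, if there is one. The right-hand side involves only \<open>\<xi>\<close>
  and \<open>T\<close>, and one null set serves all \<open>t\<close>.\<close>

lemma AE_Q_fiber:
  assumes T: "countable T" "T \<subseteq> space M" "s ` I \<subseteq> T"
  shows "AE \<omega> in P. \<forall>t\<in>space M. \<forall>A\<in>sets punctured_line.
    emeasure (Q \<omega>) ({t} \<times> A) = (if t \<in> T then 0 else indicator A (\<xi> \<omega> {t}))"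
  using AE_space AE_simple AE_null_strip[OF T(1,2)] AE_rep
proof eventually_elim
  case (elim \<omega>)
  show ?case
  proof (intro ballI)
    fix t A assume t: "t \<in> space M" and A: "A \<in> sets punctured_line"
    show "emeasure (Q \<omega>) ({t} \<times> A) = (if t \<in> T then 0 else indicator A (\<xi> \<omega> {t}))"
    proof (cases "t \<in> T")
      case True
      have "emeasure (Q \<omega>) ({t} \<times> A) \<le> emeasure (Q \<omega>) (strip T)"
        using True A T sets_Q[OF elim(1)] countable_sets[OF T(1,2)]
        by (intro emeasure_mono) (auto simp: sets_punctured_line)
      then show ?thesis using True elim(3) by simp
    next
      case False
      have tR: "{t} \<in> R" using t by simp
      have "a ({t} \<inter> {t}) = 0" using t by (intro a_countable tR) auto
      moreover have "fixed_part M p X s \<omega> {t} = 0" using t False T(3) by (intro fixed_part_off) auto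
      ultimately have "\<xi> \<omega> {t} = (\<integral>x. x \<partial>slice (Q \<omega>) {t})" using elim(4) tR by simp
      moreover have "emeasure (Q \<omega>) ({t} \<times> A) = indicator A (\<integral>x. x \<partial>slice (Q \<omega>) {t})"
        using elim(1,2,4) t tR by (intro simple_fiber Q_point A) auto
      ultimately show ?thesis using False by simp
    qed
  qed
qed

end

section \<open>Comparison of two representations\<close>

lemma enat_less_finite: "{j. enat j < enat n} = {..<n}"
  by auto

lemma enat_segments_equal:
  assumes "bij_betw f {j. enat j < p} {j. enat j < p'}" shows "p = p'"
proof -
  have inf: "{j. enat j < \<infinity>} = (UNIV :: nat set)" by auto
  show ?thesis
    using bij_betw_same_card[OF assms] bij_betw_finite[OF assms]
    by (cases p; cases p') (auto simp: enat_less_finite inf)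
qed

lemma representation_unique:
  assumes r: "represented M R P \<xi> p X s a Q G" and r': "represented M R P \<xi> p' X' s' a' Q' G'"
  shows "AE \<omega> in P. \<forall>B\<in>R. fixed_part M p X s \<omega> B = fixed_part M p' X' s' \<omega> B"
    and "\<forall>B\<in>R. a B = a' B" and "AE \<omega> in P. Q \<omega> = Q' \<omega>" and "G = G'"
proof -
  interpret r: represented M R P \<xi> p X s a Q G by fact
  interpret r': represented M R P \<xi> p' X' s' a' Q' G' by fact
  \<comment> \<open>With the locations of both representations in one countable set, the fibre
    formula reads the same for \<open>Q\<close> and \<open>Q'\<close>.\<close>
  let ?T = "s ` r.I \<union> s' ` r'.I"
  have T: "countable ?T" "?T \<subseteq> space M" using r.countable_locations r'.countable_locations by auto
  have Ts: "?T \<in> sets M" by (rule r.countable_sets[OF T])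
  show QQ': "AE \<omega> in P. Q \<omega> = Q' \<omega>"
    using AE_space r.AE_Q_fiber[OF T Un_upper1] r'.AE_Q_fiber[OF T Un_upper2]
    by eventually_elim (auto intro!: r.point_measure_eqI r.Q_point r'.Q_point)
  have eq: "AE \<omega> in P. \<forall>B\<in>R. fixed_part M p X s \<omega> B + a B = fixed_part M p' X' s' \<omega> B + a' B"
    using QQ' r.AE_rep r'.AE_rep by eventually_elim auto
  show fixed: "AE \<omega> in P. \<forall>B\<in>R. fixed_part M p X s \<omega> B = fixed_part M p' X' s' \<omega> B"
    using eq
  proof eventually_elim
    case (elim \<omega>)
    show ?case
    proof
      fix B assume B: "B \<in> R"
      then have BT: "B \<inter> ?T \<in> R" by (rule r.R_Int[OF _ Ts])
      have "fixed_part M p X s \<omega> (B \<inter> ?T) + a (B \<inter> ?T) = fixed_part M p' X' s' \<omega> (B \<inter> ?T) + a' (B \<inter> ?T)"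
        using elim BT by blast
      then show "fixed_part M p X s \<omega> B = fixed_part M p' X' s' \<omega> B"
        unfolding r.a_countable[OF B T] r'.a_countable[OF B T]
          r.fixed_part_locations[OF B Un_upper1 Ts] r'.fixed_part_locations[OF B Un_upper2 Ts] by simp
    qed
  qed
  have "AE \<omega> in P. \<forall>B\<in>R. a B = a' B"
    using eq fixed by eventually_elim auto
  \<comment> \<open>The statement does not depend on \<open>\<omega>\<close>, and the whole space is
    not a null set.\<close>
  then show "\<forall>B\<in>R. a B = a' B" by simp
  have "emeasure G C = emeasure G' C" if C: "C \<in> r.JR" for C
  proof -
    have "r.prob {\<omega> \<in> space P. emeasure (Q \<omega>) C = of_nat 0} = r.prob {\<omega> \<in> space P. emeasure (Q' \<omega>) C = of_nat 0}"
    proof (rule r.finite_measure_eq_AE)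
      show "AE \<omega> in P. (\<omega> \<in> {\<omega> \<in> space P. emeasure (Q \<omega>) C = of_nat 0}) = (\<omega> \<in> {\<omega> \<in> space P. emeasure (Q' \<omega>) C = of_nat 0})"
        using QQ' by eventually_elim simp
      show "{\<omega> \<in> space P. emeasure (Q \<omega>) C = of_nat 0} \<in> sets P" using r.Q_events[OF C, of "{0}"] by simp
      show "{\<omega> \<in> space P. emeasure (Q' \<omega>) C = of_nat 0} \<in> sets P" using r'.Q_events[OF C, of "{0}"] by simp
    qed
    then have "measure G C = measure G' C"
      unfolding r.prob_Q[OF C] r'.prob_Q[OF C] by (simp add: poisson_weight_def)
    then show ?thesis using r.G_finite[OF C] r'.G_finite[OF C]
      by (simp add: emeasure_eq_ennreal_measure less_top)
  qed
  note JR = this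
  show "G = G'"
  proof (rule measure_eqI)
    show "sets G = sets G'" using r.sets_G r'.sets_G by simp
    fix C assume "C \<in> sets G"
    then have C: "C \<in> sets r.J" using r.sets_G by simp
    show "emeasure G C = emeasure G' C"
      unfolding r.emeasure_box_SUP[OF r.sets_G C] r.emeasure_box_SUP[OF r'.sets_G C]
      using JR[OF r.Int_box_JR[OF C]] by simp
  qed
qed

text \<open>At a single location the fixed part is one \<open>X j\<close> or 0. A location missing
  from the other list would make its variable almost surely 0, against reducedness, so both lists
  have the same locations.\<close>

lemma reduced_representation_unique:
  assumes r: "represented M R P \<xi> p X s a Q G" and r': "represented M R P \<xi> p' X' s' a' Q' G'"
    and red: "reduced_jumps P p X s" and red': "reduced_jumps P p' X' s'"
  shows "p = p' \<and> (\<exists>\<pi>. bij_betw \<pi> {j. enat j < p} {j. enat j < p} \<and>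
            (\<forall>j. enat j < p \<longrightarrow> s' (\<pi> j) = s j \<and> (AE \<omega> in P. X' (\<pi> j) \<omega> = X j \<omega>)))"
proof -
  interpret r: represented M R P \<xi> p X s a Q G by fact
  interpret r': represented M R P \<xi> p' X' s' a' Q' G' by fact
  note fixed = representation_unique(1)[OF r r']
  have inj: "inj_on s r.I" "inj_on s' r'.I"
    and ne: "\<And>j. j \<in> r.I \<Longrightarrow> \<not> (AE \<omega> in P. X j \<omega> = 0)" "\<And>j. j \<in> r'.I \<Longrightarrow> \<not> (AE \<omega> in P. X' j \<omega> = 0)"
    using red red' by (auto simp: reduced_jumps_def)
  have "s j \<in> s' ` r'.I" if j: "j \<in> r.I" for j
  proof (rule ccontr)
    assume n: "s j \<notin> s' ` r'.I"
    have "AE \<omega> in P. X j \<omega> = 0"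
      using fixed
    proof eventually_elim
      case (elim \<omega>)
      then have "fixed_part M p X s \<omega> {s j} = fixed_part M p' X' s' \<omega> {s j}" using r.s_space[OF j] by simp
      then show ?case using r.fixed_part_singleton[OF inj(1) j] r'.fixed_part_off[OF r.s_space[OF j] n] by simp
    qed
    then show False using ne(1)[OF j] by simp
  qed
  moreover have "s' j \<in> s ` r.I" if j: "j \<in> r'.I" for j
  proof (rule ccontr)
    assume n: "s' j \<notin> s ` r.I"
    have "AE \<omega> in P. X' j \<omega> = 0"
      using fixed
    proof eventually_elim
      case (elim \<omega>)
      then have "fixed_part M p X s \<omega> {s' j} = fixed_part M p' X' s' \<omega> {s' j}" using r'.s_space[OF j] by simp
      then show ?case using r'.fixed_part_singleton[OF inj(2) j] r.fixed_part_off[OF r'.s_space[OF j] n] by simp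
    qed
    then show False using ne(2)[OF j] by simp
  qed
  ultimately have im: "s ` r.I = s' ` r'.I" by blast
  \<comment> \<open>The index under which the other list contains the location
    \<open>s j\<close>.\<close>
  define \<pi> where "\<pi> = inv_into r'.I s' \<circ> s"
  have "bij_betw s r.I (s ` r.I)" using inj(1) by (rule inj_on_imp_bij_betw)
  moreover have "bij_betw (inv_into r'.I s') (s ` r.I) r'.I"
    unfolding im by (rule bij_betw_inv_into[OF inj_on_imp_bij_betw[OF inj(2)]])
  ultimately have bij: "bij_betw \<pi> r.I r'.I" unfolding \<pi>_def by (rule bij_betw_trans)
  then have pp: "p = p'" by (rule enat_segments_equal)
  have "s' (\<pi> j) = s j \<and> (AE \<omega> in P. X' (\<pi> j) \<omega> = X j \<omega>)" if j: "j \<in> r.I" for j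
  proof -
    have pj: "\<pi> j \<in> r'.I" using bij j by (auto simp: bij_betw_def)
    have sj: "s' (\<pi> j) = s j" unfolding \<pi>_def comp_def using im j by (intro f_inv_into_f) auto
    have "AE \<omega> in P. X' (\<pi> j) \<omega> = X j \<omega>"
      using fixed
    proof eventually_elim
      case (elim \<omega>)
      then have "fixed_part M p X s \<omega> {s j} = fixed_part M p' X' s' \<omega> {s' (\<pi> j)}" using r.s_space[OF j] sj by simp
      then show ?case using r.fixed_part_singleton[OF inj(1) j] r'.fixed_part_singleton[OF inj(2) pj] by simp
    qed
    then show ?thesis using sj by simp
  qed
  then show ?thesis using bij pp by blast
qed

theorem theorem2p22:
  fixes P :: "'w measure" and M :: "'a measure" and R :: "'a set set"
    and \<xi> :: "'w \<Rightarrow> 'a set \<Rightarrow> real"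
  assumes "prob_space P" and "localized_borel_space M R"
    and "\<xi> \<in> P \<rightarrow>\<^sub>M signed_measure_algebra R"
  shows "(indep_increments P R \<xi> \<longleftrightarrow>
      (\<exists>p X s \<alpha> \<Psi> F. increment_representation P M R \<xi> p X s \<alpha> \<Psi> F)) \<and>
    (indep_increments P R \<xi> \<longrightarrow>
      (\<exists>p X s \<alpha> \<Psi> F. increment_representation P M R \<xi> p X s \<alpha> \<Psi> F \<and>
        reduced_jumps P p X s)) \<and>
    (\<forall>p X s \<alpha> \<Psi> F p' X' s' \<alpha>' \<Psi>' F'.
      increment_representation P M R \<xi> p X s \<alpha> \<Psi> F \<and>
      increment_representation P M R \<xi> p' X' s' \<alpha>' \<Psi>' F' \<longrightarrow>
        (AE \<omega> in P. \<forall>B \<in> R. fixed_part M p X s \<omega> B = fixed_part M p' X' s' \<omega> B) \<and>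
        (\<forall>B \<in> R. \<alpha> B = \<alpha>' B) \<and>
        (AE \<omega> in P. \<Psi> \<omega> = \<Psi>' \<omega>) \<and>
        F = F' \<and>
        (reduced_jumps P p X s \<and> reduced_jumps P p' X' s' \<longrightarrow>
          p = p' \<and>
          (\<exists>\<pi>. bij_betw \<pi> {j. enat j < p} {j. enat j < p} \<and>
            (\<forall>j. enat j < p \<longrightarrow> s' (\<pi> j) = s j \<and> (AE \<omega> in P. X' (\<pi> j) \<omega> = X j \<omega>)))))"
proof -
  have l: "localized_borel M R" using assms(2) by unfold_locales
  have rsm: "random_signed_measure M R P \<xi>"
    using assms l by (simp add: random_signed_measure_def random_signed_measure_axioms_def)
  have rep: "represented M R P \<xi> p X s a Q G" if "increment_representation P M R \<xi> p X s a Q G" for p X s a Q G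
    using rsm that by (simp add: represented_def represented_axioms_def)
  have ex: "\<exists>p X s \<alpha> \<Psi> F. increment_representation P M R \<xi> p X s \<alpha> \<Psi> F \<and> reduced_jumps P p X s"
    if "indep_increments P R \<xi>"
  proof -
    interpret indep_signed_measure M R P \<xi>
      using rsm that by (simp add: indep_signed_measure_def indep_signed_measure_axioms_def)
    show ?thesis by (rule representation_exists)
  qed
  have conv: "indep_increments P R \<xi>" if "increment_representation P M R \<xi> p X s a Q G" for p X s a Q G
    by (rule represented.indep_increments_xi[OF rep[OF that]])
  show ?thesis
  proof (intro conjI allI impI)
    show "indep_increments P R \<xi> \<longleftrightarrow> (\<exists>p X s \<alpha> \<Psi> F. increment_representation P M R \<xi> p X s \<alpha> \<Psi> F)"
      using ex conv by metis
    show "\<exists>p X s \<alpha> \<Psi> F. increment_representation P M R \<xi> p X s \<alpha> \<Psi> F \<and> reduced_jumps P p X s"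
      if "indep_increments P R \<xi>" by (rule ex[OF that])
  next
    fix p X s \<alpha> \<Psi> F p' X' s' \<alpha>' \<Psi>' F'
    assume "increment_representation P M R \<xi> p X s \<alpha> \<Psi> F \<and> increment_representation P M R \<xi> p' X' s' \<alpha>' \<Psi>' F'"
    then have r: "represented M R P \<xi> p X s \<alpha> \<Psi> F" "represented M R P \<xi> p' X' s' \<alpha>' \<Psi>' F'" using rep by auto
    note u = representation_unique[OF r]
    show "AE \<omega> in P. \<forall>B \<in> R. fixed_part M p X s \<omega> B = fixed_part M p' X' s' \<omega> B" by (rule u(1))
    show "\<forall>B \<in> R. \<alpha> B = \<alpha>' B" by (rule u(2))
    show "AE \<omega> in P. \<Psi> \<omega> = \<Psi>' \<omega>" by (rule u(3))
    show "F = F'" by (rule u(4))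
    assume "reduced_jumps P p X s \<and> reduced_jumps P p' X' s'"
    then have red: "reduced_jumps P p X s" "reduced_jumps P p' X' s'" by auto
    note ru = reduced_representation_unique[OF r red]
    show "p = p'" by (rule conjunct1[OF ru])
    show "\<exists>\<pi>. bij_betw \<pi> {j. enat j < p} {j. enat j < p} \<and>
            (\<forall>j. enat j < p \<longrightarrow> s' (\<pi> j) = s j \<and> (AE \<omega> in P. X' (\<pi> j) \<omega> = X j \<omega>))"
      by (rule conjunct2[OF ru])
  qed
qed

end
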